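(* Let $a>0$. A function $f$ belongs to $A^2(S_a,\mathbf C^{(m)})$ if and only if $$f(x)=\frac{1}{(2\pi)^m}\int_{\mathbf R^m}e(x,\underline\xi)\,g(\underline\xi)\,d\underline\xi,\qquad x\in S_a,$$ where $g=\mathcal F(f)\in L^2(\mathbf R^m,\mathbf C^{(m)})$ (the Fourier transform of the restriction of $f$ to $\mathbf R^m=\{x_0=0\}$) satisfies $$\frac{1}{(2\pi)^m}\int_{\mathbf R^m}\big(e^{2a|\underline\xi|}-e^{-2a|\underline\xi|}\big)\frac{|g(\underline\xi)|^2}{2|\underline\xi|}\,d\underline\xi<\infty .$$ Moreover, $A^2(S_a,\mathbf C^{(m)})$ has a reproducing (Bergman) kernel, given by $$B(w,\overline x)=\frac{1}{(2\pi)^m}\int_{\mathbf R^m}e(w+\overline x,\underline\xi)\,\frac{2|\underline\xi|}{e^{2a|\underline\xi|}-e^{-2a|\underline\xi|}}\,d\underline\xi,\qquad w,x\in S_a,$$ in the sense that $B(\cdot,\overline x)\in A^2(S_a,\mathbf C^{(m)})$ for each $x\in S_a$ and $f(x)=\int_{-a}^{a}\int_{\mathbf R^m}\overline{B(w,\overline x)}\,f(w)\,d\underline w\,dw_0$ for all $f\in A^2(S_a,\mathbf C^{(m)})$ and $x\in S_a$.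
   Context: $\mathbf C^{(m)}$ is the complex Clifford algebra generated by $\mathbf e_1,\dots,\mathbf e_m$ with $\mathbf e_j\mathbf e_k+\mathbf e_k\mathbf e_j=-2\delta_{jk}$, unit $\mathbf e_0=1$, norm $|\sum_T x_T\mathbf e_T|=(\sum_T|x_T|^2)^{1/2}$; the conjugation is $\overline{\sum_T x_T\mathbf e_T}=\sum_T\overline{x_T}\,\overline{\mathbf e_T}$ with $\overline{\mathbf e_{j_1}\cdots\mathbf e_{j_l}}=\overline{\mathbf e_{j_l}}\cdots\overline{\mathbf e_{j_1}}$, $\overline{\mathbf e_j}=-\mathbf e_j$ ($j\ge1$), $\overline{\mathbf e_0}=\mathbf e_0$. Points of $\mathbf R^{m+1}$ are paravectors $x=x_0+\underline x$, $\underline x=\sum_{j=1}^m x_j\mathbf e_j$, with $\overline x=x_0-\underline x$; thus $w+\overline x=(w_0+x_0)+(\underline w-\underline x)$. $F$ is left-monogenic on an open set if $\sum_{k=0}^m\mathbf e_k\partial F/\partial x_k=0$ there. Fourier transform: $\mathcal F(f)(\underline\xi)=\int_{\mathbf R^m}e^{-i\langle\underline x,\underline\xi\rangle}f(\underline x)d\underline x$ (componentwise, extended to $L^2$). For $\underline\xi\ne0$: $\chi_\pm(\underline\xi)=\frac12(1\pm i\underline\xi/|\underline\xi|)$, $e^\pm(x,\underline\xi)=e^{i\langle\underline x,\underline\xi\rangle}e^{\mp x_0|\underline\xi|}\chi_\pm(\underline\xi)$, $e=e^++e^-$. $S_a=\{x:|x_0|<a\}$, and $A^2(S_a,\mathbf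 C^{(m)})$ is the space of left-monogenic $f$ on $S_a$ with $\|f\|^2_{A^2}=\int_{-a}^a\int_{\mathbf R^m}|f(x_0+\underline x)|^2d\underline x\,dx_0<\infty$. *)

theory Defs
  imports "HOL-Analysis.Analysis"
begin

text \<open>
  Complex Clifford algebra C^(m) with generators e_j, j ranging over a finite linearly
  ordered index type 'n with CARD('n) = m.  An element sum_T x_T e_T is represented by its
  coefficient vector in complex ^ ('n set) (T ranges over subsets of the index type, T = {}
  is e_0 = 1).  The library norm on this vector type is (sum_T |x_T|^2)^(1/2), as in the paper.
\<close>

type_synonym 'n cliff = "complex ^ ('n set)"

definition sym_diff :: "'a set \<Rightarrow> 'a set \<Rightarrow> 'a set" where
  "sym_diff S T = (S - T) \<union> (T - S)"

text \<open>Sign with e_S e_T = cl_sign S T e_(S symdiff T), for e_j e_k + e_k e_j = -2 delta_jk: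
  (-1)^(number of inversions + number of common generators).\<close>
definition cl_sign :: "'n::{finite,linorder} set \<Rightarrow> 'n set \<Rightarrow> complex" where
  "cl_sign S T = (-1) ^ (card {(s,t). s \<in> S \<and> t \<in> T \<and> t < s} + card (S \<inter> T))"

definition cl_mult :: "'n::{finite,linorder} cliff \<Rightarrow> 'n cliff \<Rightarrow> 'n cliff" (infixl "\<odot>" 70) where
  "x \<odot> y = (\<chi> U. \<Sum>S\<in>UNIV. \<Sum>T\<in>UNIV.
        if sym_diff S T = U then cl_sign S T * (x $ S) * (y $ T) else 0)"

definition cl_one :: "'n::{finite,linorder} cliff" where
  "cl_one = (\<chi> T. if T = {} then 1 else 0)"

definition cl_e :: "'n::{finite,linorder} \<Rightarrow> 'n cliff" where
  "cl_e j = (\<chi> T. if T = {j} then 1 else 0)"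

text \<open>Conjugation: coefficientwise complex conjugation, and conj(e_{j1}...e_{jk})
  = conj(e_{jk})...conj(e_{j1}) = (-e_{jk})...(-e_{j1}) = (-1)^(k(k+1)/2) e_{j1}...e_{jk}.\<close>
definition cl_conj :: "'n::{finite,linorder} cliff \<Rightarrow> 'n cliff" where
  "cl_conj x = (\<chi> T. (-1) ^ (card T * (card T + 1) div 2) * cnj (x $ T))"

definition cl_vec :: "(real, 'n::{finite,linorder}) vec \<Rightarrow> 'n cliff" where
  "cl_vec \<xi> = (\<Sum>j\<in>UNIV. complex_of_real (\<xi> $ j) *s cl_e j)"

text \<open>Points of R^(m+1) are pairs (x0, underline x).\<close>

definition strip :: "real \<Rightarrow> (real \<times> ((real, 'n) vec)) set" where
  "strip a = {x. \<bar>fst x\<bar> < a}"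

definition left_monogenic_on ::
  "(real \<times> ((real, 'n) vec)) set \<Rightarrow> (real \<times> ((real, 'n) vec) \<Rightarrow> ('n::{finite,linorder}) cliff) \<Rightarrow> bool" where
  "left_monogenic_on S F \<longleftrightarrow> open S \<and>
     (\<forall>x\<in>S. F differentiable (at x)) \<and>
     (\<forall>x\<in>S. cl_one \<odot> frechet_derivative F (at x) (1, 0)
            + (\<Sum>j\<in>UNIV. cl_e j \<odot> frechet_derivative F (at x) (0, axis j 1)) = 0)"

definition A2 :: "real \<Rightarrow> (real \<times> ((real, 'n::{finite,linorder}) vec) \<Rightarrow> 'n cliff) set" where
  "A2 a = {f. left_monogenic_on (strip a) f \<and>
              (\<integral>\<^sup>+ x\<in>strip a. ennreal ((norm (f x))\<^sup>2) \<partial>lborel) < \<infinity>}"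

definition L2 :: "((real, 'n::finite) vec \<Rightarrow> ('m::finite) cliff) \<Rightarrow> bool" where
  "L2 h \<longleftrightarrow> h \<in> borel_measurable lborel \<and> integrable lborel (\<lambda>x. (norm (h x))\<^sup>2)"

definition fourier1 :: "((real, 'n::finite) vec \<Rightarrow> ('m::finite) cliff) \<Rightarrow> (real, 'n) vec \<Rightarrow> ('m::finite) cliff" where
  "fourier1 h \<xi> = (\<integral>x. exp (- \<i> * complex_of_real (x \<bullet> \<xi>)) *s h x \<partial>lborel)"

text \<open>L^2 Fourier transform (Plancherel extension): g = F(h) iff h, g in L^2 and the Fourier
  integrals of the truncations h * 1_{|x|<R} converge to g in L^2 as R tends to infinity.
  This determines g up to null sets.\<close>
definition fourier_L2 :: "((real, 'n::finite) vec \<Rightarrow> ('m::finite) cliff) \<Rightarrow> ((real, 'n) vec \<Rightarrow> ('m::finite) cliff) \<Rightarrow> bool" where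
  "fourier_L2 h g \<longleftrightarrow> L2 h \<and> L2 g \<and>
     ((\<lambda>R::real. \<integral>\<^sup>+ \<xi>. ennreal ((norm (fourier1 (\<lambda>x. indicator (ball 0 R) x *\<^sub>R h x) \<xi> - g \<xi>))\<^sup>2) \<partial>lborel)
        \<longlongrightarrow> 0) at_top"

definition chi_pm :: "complex \<Rightarrow> (real, 'n::{finite,linorder}) vec \<Rightarrow> 'n cliff" where
  "chi_pm s \<xi> = (1/2) *s (cl_one + (s * \<i> / complex_of_real (norm \<xi>)) *s cl_vec \<xi>)"

text \<open>e^+- (x, xi) = exp(i <x,xi>) exp(-+ x0 |xi|) chi_+-(xi) for xi \<noteq> 0 (set to 0 at xi = 0,
  a null set); e = e^+ + e^-.\<close>
definition e_plus :: "real \<times> ((real, 'n::{finite,linorder}) vec) \<Rightarrow> (real, 'n) vec \<Rightarrow> 'n cliff" where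
  "e_plus x \<xi> = (if \<xi> = 0 then 0 else
     (exp (\<i> * complex_of_real (snd x \<bullet> \<xi>)) * complex_of_real (exp (- fst x * norm \<xi>)))
       *s chi_pm 1 \<xi>)"

definition e_minus :: "real \<times> ((real, 'n::{finite,linorder}) vec) \<Rightarrow> (real, 'n) vec \<Rightarrow> 'n cliff" where
  "e_minus x \<xi> = (if \<xi> = 0 then 0 else
     (exp (\<i> * complex_of_real (snd x \<bullet> \<xi>)) * complex_of_real (exp (fst x * norm \<xi>)))
       *s chi_pm (-1) \<xi>)"

definition e_ker :: "real \<times> ((real, 'n::{finite,linorder}) vec) \<Rightarrow> (real, 'n) vec \<Rightarrow> 'n cliff" where
  "e_ker x \<xi> = e_plus x \<xi> + e_minus x \<xi>"

text \<open>Paravector w + conj x = (w0 + x0) + (underline w - underline x).\<close>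
definition para_add_conj :: "real \<times> ((real, 'n::finite) vec) \<Rightarrow> real \<times> ((real, 'n) vec) \<Rightarrow> real \<times> ((real, 'n) vec)" where
  "para_add_conj w x = (fst w + fst x, snd w - snd x)"

text \<open>bergman a w x stands for B(w, conj x).\<close>
definition bergman :: "real \<Rightarrow> real \<times> ((real, 'n::{finite,linorder}) vec) \<Rightarrow> real \<times> ((real, 'n) vec) \<Rightarrow> 'n cliff" where
  "bergman a w x = (1 / (2 * pi) ^ CARD('n)) *\<^sub>R
     (\<integral>\<xi>. (2 * norm \<xi> / (exp (2 * a * norm \<xi>) - exp (- 2 * a * norm \<xi>)))
              *\<^sub>R e_ker (para_add_conj w x) \<xi> \<partial>lborel)"

end

theory Submission
  imports Defs "HOL-Probability.Characteristic_Functions"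
begin

text \<open>
  On each hyperplane \<open>x\<^sub>0 = t\<close> the Cauchy-Riemann equation becomes, after a Fourier transform, the
  differential equation \<open>\<partial>\<^sub>t g = - i \<xi> g\<close>, so a monogenic \<open>f\<close> is determined by the transform \<open>g\<close> of its
  trace at \<open>t = 0\<close>: the slice at \<open>t\<close> has transform \<open>exp (- i t \<xi>) g\<close>, which is \<open>e(x, \<xi>)\<close> without the phase.
  Since \<open>i \<xi> / |\<xi>|\<close> is a self-adjoint involution, integrating \<open>|exp (- i t \<xi>) g|\<^sup>2\<close> over \<open>|t| < a\<close>
  yields the weight of the theorem, and integrating \<open>exp (- i (2 t + x\<^sub>0) \<xi>)\<close> yields the same weight
  times \<open>exp (- i x\<^sub>0 \<xi>)\<close>, which is the reproducing property.

  Monogenic functions are only assumed to be differentiable, so the differential equation is derived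
  in weak form: \<open>f\<close> is paired with right monogenic test functions \<open>k\<close> of compactly supported
  spectrum; the pairing over the slice at \<open>t\<close> does not depend on \<open>t\<close>, because \<open>k e\<^sub>b f\<close> is a divergence
  free field to which a Goursat type subdivision argument applies.  From Plancherel's theorem
  only the upper bound is needed, together with pointwise inversion for continuous functions.
\<close>

section \<open>The complex Clifford algebra\<close>

text \<open>Square integrability over the strip controls almost every slice only, and the slice at
  time 0, whose transform the theorem speaks of, may be an exception. Hence \<open>g\<close> is read
  off from one good slice, as exp (i t0 \<xi>) times its transform, and has to be identified with
  the transform of the trace afterwards, by an L2 limit of good slices. Since uncountably many
  exceptional null sets of times could not be united, the spectra of the test functions are
  indicators taken from a countable generator of the Borel sets, cut by balls to make them bounded.

  The upper half of Plancherel's theorem suffices because each direction of the equivalence is one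
  inequality: transforms of slices bound the weighted norm of \<open>g\<close>, inverse transforms
  bound the norm of \<open>f\<close> over the strip. The formula for \<open>f\<close> itself comes
  from inversion on good slices and continuity in t.\<close>

lemma mem_sym_diff [simp]: "x \<in> sym_diff S T \<longleftrightarrow> (x \<in> S) \<noteq> (x \<in> T)"
  by (auto simp: sym_diff_def)

lemma sym_diff_assoc: "sym_diff (sym_diff S T) U = sym_diff S (sym_diff T U)"
  by (rule set_eqI) auto

lemma sym_diff_cancel [simp]: "sym_diff S (sym_diff S T) = T"
  by (rule set_eqI) auto

lemma sym_diff_commute: "sym_diff S T = sym_diff T S"
  by (rule set_eqI) auto

lemma sym_diff_empty [simp]: "sym_diff {} T = T" "sym_diff T {} = T" "sym_diff T T = {}"
  by (rule set_eqI; auto)+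

lemma sym_diff_eq_iff: "sym_diff S T = U \<longleftrightarrow> T = sym_diff S U"
  by auto

lemma bij_sym_diff: "bij (sym_diff S)"
  by (rule o_bij[of "sym_diff S"]) (auto simp: fun_eq_iff)

text \<open>Elements common to both sets occur twice in the product on the right and cancel by
  \<phi> s * \<phi> s = 1.\<close>

lemma prod_sym_diff:
  fixes \<phi> :: "'a::finite \<Rightarrow> complex"
  assumes "\<And>s. \<phi> s * \<phi> s = 1"
  shows "prod \<phi> (sym_diff S T) = prod \<phi> S * prod \<phi> T"
proof -
  have "prod \<phi> S = prod \<phi> (S - T) * prod \<phi> (S \<inter> T)" "prod \<phi> T = prod \<phi> (T - S) * prod \<phi> (S \<inter> T)"
    by (subst prod.union_disjoint[symmetric]; auto intro: prod.cong)+
  moreover have "prod \<phi> (S \<inter> T) * prod \<phi> (S \<inter> T) = 1"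
    by (simp add: prod.distrib[symmetric] assms)
  moreover have "prod \<phi> (sym_diff S T) = prod \<phi> (S - T) * prod \<phi> (T - S)"
    unfolding sym_diff_def by (subst prod.union_disjoint) auto
  ultimately show ?thesis
    by (metis (no_types, opaque_lifting) mult.assoc mult.left_commute mult.right_neutral)
qed

text \<open>Inversions are the pairs t < s and common generators the diagonal pairs; together they
  are the pairs t \<le> s, each worth a factor -1. The product form exposes the sign as a
  bicharacter on the group of subsets under \<open>sym_diff\<close>.\<close>

lemma cl_sign_eq_prod: "cl_sign S T = (\<Prod>s\<in>S. \<Prod>t\<in>T. if t \<le> s then -1 else 1)"
proof -
  have "card (S \<inter> T) = card ((\<lambda>x. (x,x)) ` (S \<inter> T))"
    by (subst card_image) (auto simp: inj_on_def)
  moreover have "card {(s,t). s \<in> S \<and> t \<in> T \<and> t < s} + card ((\<lambda>x. (x,x)) ` (S \<inter> T))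
      = card {(s,t). s \<in> S \<and> t \<in> T \<and> t \<le> s}"
    by (subst card_Un_disjoint[symmetric]) (auto intro!: arg_cong[where f=card])
  moreover have "(\<Prod>s\<in>S. \<Prod>t\<in>T. if t \<le> s then -1 else (1::complex))
      = (\<Prod>p\<in>S\<times>T. if snd p \<le> fst p then -1 else 1)"
    by (simp add: prod.cartesian_product case_prod_beta)
  moreover have "\<dots> = (\<Prod>p\<in>{(s,t). s \<in> S \<and> t \<in> T \<and> t \<le> s}. -1)"
    by (rule prod.mono_neutral_cong_right) auto
  ultimately show ?thesis
    unfolding cl_sign_def by simp
qed

lemma cl_sign_sym_diff_left: "cl_sign (sym_diff S T) U = cl_sign S U * cl_sign T U"
  unfolding cl_sign_eq_prod
  by (rule prod_sym_diff) (auto simp: prod.distrib[symmetric] intro!: prod.neutral)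

lemma cl_sign_sym_diff_right: "cl_sign S (sym_diff T U) = cl_sign S T * cl_sign S U"
  unfolding cl_sign_eq_prod
  by (subst prod_sym_diff) (auto simp: prod.distrib)

lemma cl_sign_empty [simp]: "cl_sign {} T = 1" "cl_sign T {} = 1"
  by (simp_all add: cl_sign_eq_prod)

lemma cl_mult_nth: "(x \<odot> y) $ U = (\<Sum>S\<in>UNIV. cl_sign S (sym_diff S U) * x $ S * y $ sym_diff S U)"
  unfolding cl_mult_def by (auto simp: sym_diff_eq_iff intro!: sum.cong)

text \<open>The Clifford product is a group algebra twisted by \<open>cl_sign\<close>. A bicharacter
  is a 2-cocycle, which is exactly the condition for such a product to be associative.\<close>

lemma cl_mult_assoc: "(x \<odot> y) \<odot> z = x \<odot> (y \<odot> z)"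
proof (rule vec_eq_iff[THEN iffD2], rule allI)
  fix U
  let ?s = sym_diff
  have "((x \<odot> y) \<odot> z) $ U = (\<Sum>S\<in>UNIV. \<Sum>P\<in>UNIV. cl_sign P (?s P U) *
      (cl_sign S (?s S P) * x $ S * y $ ?s S P) * z $ ?s P U)"
    by (subst sum.swap) (simp add: cl_mult_nth sum_distrib_left sum_distrib_right)
  also have "\<dots> = (\<Sum>S\<in>UNIV. \<Sum>Q\<in>UNIV. cl_sign (?s S Q) (?s (?s S Q) U) *
      (cl_sign S Q * x $ S * y $ Q) * z $ ?s (?s S Q) U)"
  \<comment> \<open>Substitute P = \<open>sym_diff S Q\<close>, so that S, Q and the remaining index
    run over the factors of x, y and z.\<close>
  proof (rule sum.cong[OF refl])
    fix S
    show "(\<Sum>P\<in>UNIV. cl_sign P (?s P U) * (cl_sign S (?s S P) * x $ S * y $ ?s S P) * z $ ?s P U)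
      = (\<Sum>Q\<in>UNIV. cl_sign (?s S Q) (?s (?s S Q) U) * (cl_sign S Q * x $ S * y $ Q) * z $ ?s (?s S Q) U)"
      by (subst sum.reindex_bij_betw[OF bij_sym_diff[of S], symmetric]) simp
  qed
  also have "\<dots> = (\<Sum>S\<in>UNIV. \<Sum>Q\<in>UNIV. cl_sign S (?s S U) * x $ S *
      (cl_sign Q (?s Q (?s S U)) * y $ Q * z $ ?s Q (?s S U)))"
  proof (intro sum.cong refl)
    fix S Q
    have V: "?s (?s S Q) U = ?s Q (?s S U)"
      by (metis sym_diff_assoc sym_diff_commute)
    have "cl_sign S (?s Q (?s Q (?s S U))) = cl_sign S Q * cl_sign S (?s Q (?s S U))"
      by (rule cl_sign_sym_diff_right)
    then have "cl_sign S (?s S U) = cl_sign S Q * cl_sign S (?s Q (?s S U))"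
      by simp
    then show "cl_sign (?s S Q) (?s (?s S Q) U) * (cl_sign S Q * x $ S * y $ Q) * z $ ?s (?s S Q) U
      = cl_sign S (?s S U) * x $ S * (cl_sign Q (?s Q (?s S U)) * y $ Q * z $ ?s Q (?s S U))"
      unfolding V cl_sign_sym_diff_left by (simp add: mult_ac)
  qed
  also have "\<dots> = (x \<odot> (y \<odot> z)) $ U"
    by (simp add: cl_mult_nth sum_distrib_left)
  finally show "((x \<odot> y) \<odot> z) $ U = (x \<odot> (y \<odot> z)) $ U" .
qed

lemma cl_mult_one [simp]: "cl_one \<odot> x = x" "x \<odot> cl_one = x"
proof -
  show "cl_one \<odot> x = x"
    by (simp add: vec_eq_iff cl_mult_nth cl_one_def if_distrib[of "\<lambda>u. _ * u * _"] if_distrib[of "\<lambda>u. u * _"] cong: if_cong)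
  have *: "sym_diff S U = {} \<longleftrightarrow> S = U" for S U :: "'a set"
    by (auto simp: sym_diff_def)
  show "x \<odot> cl_one = x"
    by (simp add: vec_eq_iff cl_mult_nth cl_one_def * if_distrib[of "\<lambda>u. _ * u"] cong: if_cong)
qed

lemma cl_mult_scale: "(c *s x) \<odot> y = c *s (x \<odot> y)" "x \<odot> (c *s y) = c *s (x \<odot> y)"
  by (simp_all add: vec_eq_iff cl_mult_nth sum_distrib_left mult_ac)

lemma norm_vsmult [simp]: "norm (c *s x) = cmod c * norm (x :: complex ^ 'k)"
  by (simp add: norm_vec_def L2_set_def norm_mult power_mult_distrib sum_distrib_left[symmetric]
      real_sqrt_mult)

lemma vsmult_of_real [simp]: "complex_of_real r *s x = r *\<^sub>R (x :: complex ^ 'k)"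
  by (simp add: vec_eq_iff scaleR_conv_of_real[where 'a=complex])

lemma bounded_bilinear_vsmult: "bounded_bilinear ((*s) :: complex \<Rightarrow> complex ^ 'k \<Rightarrow> complex ^ 'k)"
  by standard (auto simp: vec_eq_iff algebra_simps intro!: exI[of _ 1])

lemma bounded_bilinear_cl_mult: "bounded_bilinear (\<odot>)"
  unfolding bilinear_conv_bounded_bilinear[symmetric] bilinear_def
  by (intro conjI allI linearI)
    (simp_all add: vec_eq_iff cl_mult_nth algebra_simps sum.distrib scaleR_sum_right)

interpretation vsmult: bounded_bilinear "(*s) :: complex \<Rightarrow> complex ^ 'k \<Rightarrow> complex ^ 'k"
  by (rule bounded_bilinear_vsmult)

interpretation cl: bounded_bilinear "(\<odot>)"
  by (rule bounded_bilinear_cl_mult)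

section \<open>Left multiplication by generators and vectors\<close>

lemma cl_e_mult_nth: "(cl_e j \<odot> x) $ U = cl_sign {j} (sym_diff {j} U) * x $ sym_diff {j} U"
  by (simp add: cl_mult_nth cl_e_def if_distrib[of "\<lambda>u. _ * u * _"] if_distrib[of "\<lambda>u. u * _"] cong: if_cong)

text \<open>Left multiplication by a generator is a signed permutation of the coordinates that
  exchanges U with \<open>sym_diff {j} U\<close>, and the signs at the two ends are opposite because
  \<open>cl_sign {j} {j} = -1\<close>.\<close>

lemma cl_e_skew: "(cl_e j \<odot> x) \<bullet> y = - (x \<bullet> (cl_e j \<odot> y))"
proof -
  have s: "cl_sign {j} (sym_diff {j} U) = - cl_sign {j} U" for U
    by (simp add: cl_sign_sym_diff_right) (simp add: cl_sign_eq_prod)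
  have r: "cl_sign {j} U \<in> {1,-1}" for U
    by (simp add: cl_sign_def uminus_power_if)
  have c: "inner (c * u) v = inner u (c * v)" if "c \<in> {1, -1}" for c u v :: complex
    using that by auto
  have "(cl_e j \<odot> x) \<bullet> y = (\<Sum>U\<in>UNIV. inner (cl_sign {j} (sym_diff {j} U) * x $ sym_diff {j} U) (y $ U))"
    by (simp add: inner_vec_def cl_e_mult_nth)
  also have "\<dots> = (\<Sum>U\<in>UNIV. inner (cl_sign {j} U * x $ U) (y $ sym_diff {j} U))"
    by (subst sum.reindex_bij_betw[OF bij_sym_diff[of "{j}"], symmetric]) simp
  also have "\<dots> = (\<Sum>U\<in>UNIV. inner (x $ U) (cl_sign {j} U * y $ sym_diff {j} U))"
    using r by (simp only: c)
  also have "\<dots> = - (x \<bullet> (cl_e j \<odot> y))"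
    by (simp add: inner_vec_def cl_e_mult_nth s sum_negf)
  finally show ?thesis .
qed

lemma cl_e_square: "cl_e j \<odot> (cl_e j \<odot> x) = - x"
proof -
  have "cl_sign {j} (sym_diff {j} U) * cl_sign {j} U = -1" for U
  proof -
    have "cl_sign {j} U * cl_sign {j} U = 1"
      by (simp add: cl_sign_def uminus_power_if)
    moreover have "cl_sign {j} {j} = -1"
      by (simp add: cl_sign_eq_prod)
    ultimately show ?thesis
      by (simp add: cl_sign_sym_diff_right)
  qed
  then show ?thesis
    by (simp add: vec_eq_iff cl_e_mult_nth mult.assoc[symmetric])
qed

lemma cl_e_anticommute:
  assumes "i \<noteq> j"
  shows "cl_e i \<odot> (cl_e j \<odot> x) = - (cl_e j \<odot> (cl_e i \<odot> x))"
proof -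
  have c: "sym_diff {j} (sym_diff {i} U) = sym_diff {i} (sym_diff {j} U)" for U
    by (rule set_eqI) auto
  \<comment> \<open>The order is linear, so exactly one of i \<le> j and j \<le> i holds.\<close>
  have "cl_sign {i} {j} = - cl_sign {j} {i}"
    using assms by (auto simp: cl_sign_eq_prod)
  then have "cl_sign {i} (sym_diff {i} U) * cl_sign {j} (sym_diff {j} (sym_diff {i} U))
      = - (cl_sign {j} (sym_diff {j} U) * cl_sign {i} (sym_diff {i} (sym_diff {j} U)))" for U
    by (simp add: cl_sign_sym_diff_right)
  then show ?thesis
    by (simp add: vec_eq_iff cl_e_mult_nth mult.assoc[symmetric] c)
qed

lemma cl_vec_eq: "cl_vec \<xi> = (\<Sum>j\<in>UNIV. (\<xi> $ j) *\<^sub>R cl_e j)"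
  by (simp add: cl_vec_def)

lemma cl_vec_mult: "cl_vec \<xi> \<odot> x = (\<Sum>j\<in>UNIV. (\<xi> $ j) *\<^sub>R (cl_e j \<odot> x))"
  by (simp add: cl_vec_def cl.sum_left cl.scaleR_left)

lemma cl_vec_linear: "linear (cl_vec :: (real, 'n::{finite,linorder}) vec \<Rightarrow> _)"
  by (rule linearI) (simp_all add: cl_vec_eq sum.distrib scaleR_add_left scaleR_sum_right)

lemma cl_vec_axis [simp]: "cl_vec (axis j 1) = cl_e j"
  by (simp add: cl_vec_eq axis_def if_distrib[of "\<lambda>u. u *\<^sub>R _"] cong: if_cong)

lemma cl_vec_skew: "(cl_vec \<xi> \<odot> x) \<bullet> y = - (x \<bullet> (cl_vec \<xi> \<odot> y))"
  by (simp add: cl_vec_mult inner_sum_left inner_sum_right cl_e_skew sum_negf)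

text \<open>Adding the double sum to its transpose kills the off-diagonal terms by anticommutation;
  this is why twice the identity is established and then halved.\<close>

lemma cl_vec_square: "cl_vec \<xi> \<odot> (cl_vec \<xi> \<odot> x) = - ((norm \<xi>)\<^sup>2 *\<^sub>R x)"
proof -
  let ?f = "\<lambda>i j. (\<xi> $ i * \<xi> $ j) *\<^sub>R (cl_e i \<odot> (cl_e j \<odot> x))"
  have "cl_vec \<xi> \<odot> (cl_vec \<xi> \<odot> x) = (\<Sum>i\<in>UNIV. \<Sum>j\<in>UNIV. ?f i j)"
    by (subst sum.swap) (simp add: cl_vec_mult cl.sum_right cl.scaleR_right scaleR_sum_right mult.commute)
  moreover have "(\<Sum>i\<in>UNIV. \<Sum>j\<in>UNIV. ?f i j) = (\<Sum>i\<in>UNIV. \<Sum>j\<in>UNIV. ?f j i)"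
    by (rule sum.swap)
  moreover have "?f i j + ?f j i = (if i = j then - (2 * (\<xi> $ i)\<^sup>2) *\<^sub>R x else 0)" for i j
    using cl_e_anticommute[of i j x]
    by (auto simp: cl_e_square power2_eq_square vec_eq_iff scaleR_conv_of_real[where 'a=complex])
  then have "(\<Sum>i\<in>UNIV. \<Sum>j\<in>UNIV. ?f i j) + (\<Sum>i\<in>UNIV. \<Sum>j\<in>UNIV. ?f j i)
      = (\<Sum>i\<in>UNIV. - (2 * (\<xi> $ i)\<^sup>2) *\<^sub>R x)"
    by (simp add: sum.distrib[symmetric] del: scaleR_minus_left)
  moreover have "(norm \<xi>)\<^sup>2 = (\<Sum>i\<in>UNIV. (\<xi> $ i)\<^sup>2)"
    by (simp add: norm_vec_def L2_set_def sum_nonneg)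
  ultimately have "2 *\<^sub>R (cl_vec \<xi> \<odot> (cl_vec \<xi> \<odot> x)) = 2 *\<^sub>R (- ((norm \<xi>)\<^sup>2 *\<^sub>R x))"
    by (simp add: scaleR_2[symmetric] scaleR_sum_left[symmetric] sum_negf sum_distrib_left[symmetric])
  then show ?thesis
    by (rule scaleR_left_imp_eq[rotated]) simp
qed

text \<open>Skew-adjointness turns the squared norm into minus the pairing of x with \<xi> \<xi> x =
  - |\<xi>|^2 x. The Clifford norm is not multiplicative in general; vectors are the exception that
  keeps the estimates for the exponential sharp.\<close>

lemma norm_cl_vec_mult [simp]: "norm (cl_vec \<xi> \<odot> x) = norm \<xi> * norm x"
proof -
  have "(norm (cl_vec \<xi> \<odot> x))\<^sup>2 = (norm \<xi> * norm x)\<^sup>2"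
    by (simp add: power2_norm_eq_inner[of "_ \<odot> _"] cl_vec_skew cl_vec_square power_mult_distrib
        power2_norm_eq_inner[of x])
  then show ?thesis by (simp add: power2_eq_iff_nonneg)
qed

lemma norm_cl_one [simp]: "norm (cl_one :: 'n::{finite,linorder} cliff) = 1"
  by (simp add: norm_vec_def L2_set_def cl_one_def if_distrib[of norm] if_distrib[of "\<lambda>u. u^2"] cong: if_cong)

lemma cl_conj_linear: "linear cl_conj"
  by (rule linearI) (simp_all add: cl_conj_def vec_eq_iff algebra_simps scaleR_conv_of_real[where 'a=complex])

lemma cl_conj_one [simp]: "cl_conj cl_one = cl_one"
  by (simp add: cl_conj_def cl_one_def vec_eq_iff)

lemma cl_conj_scale: "cl_conj (c *s x) = cnj c *s cl_conj x"
  by (simp add: cl_conj_def vec_eq_iff mult_ac)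

lemma cl_conj_vec [simp]: "cl_conj (cl_vec \<xi>) = - cl_vec \<xi>"
proof -
  have "cl_conj (cl_e j) = - cl_e j" for j :: 'a
    by (auto simp: cl_conj_def cl_e_def vec_eq_iff)
  then show ?thesis
    unfolding cl_vec_def
    by (simp add: linear_sum[OF cl_conj_linear] linear_scale[OF cl_conj_linear] sum_negf)
qed

section \<open>The exponential of a Clifford vector\<close>

text \<open>This is exp (- i t \<xi>), which acts on the ranges of chi_+ and chi_- by exp (- t |\<xi>|) and
  exp (t |\<xi>|).  For \<xi> = 0 the junk value x/0 = 0 gives the right answer 1.\<close>
definition cl_exp :: "real \<Rightarrow> (real, 'n::{finite,linorder}) vec \<Rightarrow> 'n cliff" where
  "cl_exp t \<xi> = cosh (t * norm \<xi>) *\<^sub>R cl_one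
     - (\<i> * of_real (sinh (t * norm \<xi>) / norm \<xi>)) *s cl_vec \<xi>"

lemma e_ker_eq:
  assumes "\<xi> \<noteq> 0"
  shows "e_ker x \<xi> = exp (\<i> * of_real (snd x \<bullet> \<xi>)) *s cl_exp (fst x) \<xi>"
proof -
  have "e_ker x \<xi> = exp (\<i> * of_real (snd x \<bullet> \<xi>)) *s
     (of_real (exp (- fst x * norm \<xi>)) *s chi_pm 1 \<xi> + of_real (exp (fst x * norm \<xi>)) *s chi_pm (-1) \<xi>)"
    unfolding e_ker_def e_plus_def e_minus_def if_not_P[OF assms]
    by (simp only: vector_add_ldistrib vector_smult_assoc)
  also have "of_real (exp (- fst x * norm \<xi>)) *s chi_pm 1 \<xi> + of_real (exp (fst x * norm \<xi>)) *s chi_pm (-1) \<xi>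
     = cl_exp (fst x) \<xi>"
  proof -
    have "norm \<xi> \<noteq> 0" using assms by simp
    then show ?thesis
      unfolding cl_exp_def chi_pm_def cosh_def sinh_def
      by (simp add: vec_eq_iff scaleR_conv_of_real[where 'a=complex] del: norm_eq_zero)
        (simp add: field_simps del: norm_eq_zero)
  qed
  finally show ?thesis .
qed

lemma cl_exp_mult: "cl_exp t \<xi> \<odot> x = cosh (t * norm \<xi>) *\<^sub>R x
     - (\<i> * of_real (sinh (t * norm \<xi>) / norm \<xi>)) *s (cl_vec \<xi> \<odot> x)"
  by (simp add: cl_exp_def cl.diff_left cl.scaleR_left cl_mult_scale)

text \<open>In the product of the two vector terms, i * i = -1 meets \<xi> \<xi> = - |\<xi>|^2 and
  leaves sinh * sinh with a plus sign, so the addition theorems of cosh and sinh give the group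
  law.\<close>

lemma cl_exp_add: "cl_exp s \<xi> \<odot> (cl_exp t \<xi> \<odot> x) = cl_exp (s + t) \<xi> \<odot> x"
proof (cases "\<xi> = 0")
  case True
  then show ?thesis by (simp add: cl_exp_mult)
next
  case False
  let ?r = "norm \<xi>"
  have "cl_exp s \<xi> \<odot> (cl_exp t \<xi> \<odot> x)
    = (cosh (t * ?r) * cosh (s * ?r)) *\<^sub>R x
      - (\<i> * of_real (cosh (t * ?r) * (sinh (s * ?r) / ?r) + sinh (t * ?r) / ?r * cosh (s * ?r))) *s (cl_vec \<xi> \<odot> x)
      - of_real (sinh (t * ?r) / ?r * (sinh (s * ?r) / ?r)) *s (cl_vec \<xi> \<odot> (cl_vec \<xi> \<odot> x))"
  proof -
    \<comment> \<open>A coordinatewise identity: u, v and w stand for the coefficients of x, \<xi> x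
      and \<xi> \<xi> x.\<close>
    have *: "of_real c * (of_real c' * u - \<i> * of_real k' * v) - \<i> * of_real k * (of_real c' * v - \<i> * of_real k' * w)
      = of_real (c * c') * u - \<i> * of_real (c * k' + k * c') * v - of_real (k * k') * w"
      for c c' k k' :: real and u v w :: complex
      by (simp add: algebra_simps)
    show ?thesis
      unfolding cl_exp_mult cl.diff_right cl.scaleR_right cl_mult_scale vec_eq_iff
      by (simp only: vector_component scaleR_conv_of_real[where 'a=complex] * simp_thms)
  qed
  also have "\<dots> = cl_exp (s + t) \<xi> \<odot> x"
  proof -
    have C: "cosh ((s + t) * ?r) = cosh (t * ?r) * cosh (s * ?r) + sinh (t * ?r) * sinh (s * ?r)"
      by (simp add: ring_distribs cosh_add)
    have S: "sinh ((s + t) * ?r) / ?r = cosh (t * ?r) * (sinh (s * ?r) / ?r) + sinh (t * ?r) / ?r * cosh (s * ?r)"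
      by (simp add: ring_distribs sinh_add add_divide_distrib mult.commute)
    have "of_real (sinh (t * ?r) / ?r * (sinh (s * ?r) / ?r)) *s (- ((norm \<xi>)\<^sup>2 *\<^sub>R x))
        = - ((sinh (t * ?r) * sinh (s * ?r)) *\<^sub>R x)"
      unfolding vsmult_of_real using False by (simp add: power2_eq_square)
    then show ?thesis
      unfolding cl_vec_square cl_exp_mult C S scaleR_add_left
      by (simp only: diff_minus_eq_add add_diff_eq diff_add_eq)
  qed
  finally show ?thesis .
qed

lemma cl_exp_0 [simp]: "cl_exp 0 \<xi> = cl_one"
  by (simp add: cl_exp_def)

text \<open>Conjugation negates both i and the vector, and the two signs cancel. Hence the
  conjugated Bergman kernel differs from the kernel only in its phases.\<close>

lemma cl_exp_conj [simp]: "cl_conj (cl_exp t \<xi>) = cl_exp t \<xi>"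
  by (simp add: cl_exp_def linear_diff[OF cl_conj_linear] linear_scale[OF cl_conj_linear] cl_conj_scale
    vec_eq_iff)

lemma inner_vsmult_left: "(c *s u) \<bullet> (v :: complex ^ 'k) = u \<bullet> (cnj c *s v)"
  by (simp add: inner_vec_def inner_complex_def algebra_simps)

text \<open>The quadratic form of the self-adjoint involution i \<xi> / |\<xi>|. For \<xi> \<noteq>
  0 it is the difference of the squared norms of the components of y in the ranges of chi_+ and
  chi_-; at \<xi> = 0 it is 0.\<close>

definition cl_unit_form :: "(real, 'n::{finite,linorder}) vec \<Rightarrow> 'n cliff \<Rightarrow> real" where
  "cl_unit_form \<xi> y = y \<bullet> ((\<i> / of_real (norm \<xi>)) *s (cl_vec \<xi> \<odot> y))"

text \<open>With J = i \<xi> / |\<xi>| the exponential is cosh - sinh J. Expanding the square and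
  using |J y| = |y| leaves the double argument formulas.\<close>

lemma norm_cl_exp_mult:
  "(norm (cl_exp t \<xi> \<odot> y))\<^sup>2 = cosh (2 * t * norm \<xi>) * (norm y)\<^sup>2 - sinh (2 * t * norm \<xi>) * cl_unit_form \<xi> y"
proof (cases "\<xi> = 0")
  case True
  then show ?thesis by (simp add: cl_exp_mult)
next
  case False
  let ?J = "\<lambda>y. (\<i> / of_real (norm \<xi>)) *s (cl_vec \<xi> \<odot> y)"
  let ?c = "cosh (t * norm \<xi>)" and ?s = "sinh (t * norm \<xi>)"
  have E: "cl_exp t \<xi> \<odot> y = ?c *\<^sub>R y - ?s *\<^sub>R ?J y"
    by (simp add: cl_exp_mult vec_eq_iff scaleR_conv_of_real[where 'a=complex] field_simps)
  have "norm (?J y) = norm y"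
    using False by (simp add: norm_divide)
  then have J: "?J y \<bullet> ?J y = y \<bullet> y"
    by (metis power2_norm_eq_inner)
  have "(norm (cl_exp t \<xi> \<odot> y))\<^sup>2 = ?c\<^sup>2 * (y \<bullet> y) + ?s\<^sup>2 * (?J y \<bullet> ?J y) - 2 * ?c * ?s * (y \<bullet> ?J y)"
    unfolding power2_norm_eq_inner E
    by (simp only: inner_diff_left inner_diff_right inner_scaleR_left inner_scaleR_right
        inner_commute[of "?J y" y] power2_eq_square) algebra
  also have "\<dots> = (?c\<^sup>2 + ?s\<^sup>2) * (y \<bullet> y) - (2 * ?s * ?c) * (y \<bullet> ?J y)"
    unfolding J by (simp add: algebra_simps)
  finally show ?thesis
    unfolding cl_unit_form_def
    using cosh_double[of "t * norm \<xi>"] sinh_double[of "t * norm \<xi>"]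
    by (simp add: power2_norm_eq_inner mult.assoc)
qed

lemma cl_unit_form_le: "\<bar>cl_unit_form \<xi> y\<bar> \<le> (norm y)\<^sup>2"
proof -
  have "\<bar>cl_unit_form \<xi> y\<bar> \<le> norm y * norm ((\<i> / of_real (norm \<xi>)) *s (cl_vec \<xi> \<odot> y))"
    unfolding cl_unit_form_def by (rule Cauchy_Schwarz_ineq2)
  also have "\<dots> \<le> norm y * norm y"
    by (intro mult_left_mono) (auto simp: norm_divide divide_simps)
  finally show ?thesis by (simp add: power2_eq_square)
qed

text \<open>Bounding the form by |y|^2 leaves cosh + |sinh|, an exponential. It belongs to the
  larger of the two eigenvalues, so no constant is lost.\<close>

lemma norm_cl_exp_le: "norm (cl_exp t \<xi> \<odot> y) \<le> exp (\<bar>t\<bar> * norm \<xi>) * norm y"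
proof (rule power2_le_imp_le)
  let ?u = "2 * t * norm \<xi>"
  have "(norm (cl_exp t \<xi> \<odot> y))\<^sup>2 \<le> cosh ?u * (norm y)\<^sup>2 + \<bar>sinh ?u\<bar> * \<bar>cl_unit_form \<xi> y\<bar>"
    using norm_cl_exp_mult[of t \<xi> y] abs_mult[of "sinh ?u" "cl_unit_form \<xi> y"] by linarith
  also have "\<dots> \<le> cosh ?u * (norm y)\<^sup>2 + \<bar>sinh ?u\<bar> * (norm y)\<^sup>2"
    using cl_unit_form_le by (intro add_left_mono mult_left_mono) auto
  also have "\<dots> = (cosh \<bar>?u\<bar> + sinh \<bar>?u\<bar>) * (norm y)\<^sup>2"
    by (simp add: sinh_real_abs algebra_simps)
  also have "cosh \<bar>?u\<bar> + sinh \<bar>?u\<bar> = (exp (\<bar>t\<bar> * norm \<xi>))\<^sup>2"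
    by (simp add: cosh_plus_sinh abs_mult power2_eq_square flip: exp_add)
  finally show "(norm (cl_exp t \<xi> \<odot> y))\<^sup>2 \<le> (exp (\<bar>t\<bar> * norm \<xi>) * norm y)\<^sup>2"
    by (simp add: power_mult_distrib)
qed simp

lemma norm_cl_exp: "norm (cl_exp t \<xi>) \<le> exp (\<bar>t\<bar> * norm \<xi>)"
  using norm_cl_exp_le[of t \<xi> cl_one] by simp

lemma cl_vec_measurable [measurable]: "cl_vec \<in> borel_measurable borel"
  by (intro borel_measurable_continuous_onI linear_continuous_on linear_conv_bounded_linear[THEN iffD1] cl_vec_linear)

lemma vsmult_measurable [measurable]:
  fixes g :: "'a \<Rightarrow> complex ^ 'k"
  assumes [measurable]: "f \<in> borel_measurable M" "g \<in> borel_measurable M"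
  shows "(\<lambda>x. f x *s g x) \<in> borel_measurable M"
  by (rule borel_measurable_continuous_Pair[OF assms])
    (rule vsmult.continuous_on[OF continuous_on_fst[OF continuous_on_id] continuous_on_snd[OF continuous_on_id]])

lemma cl_mult_measurable [measurable]:
  assumes [measurable]: "f \<in> borel_measurable M" "g \<in> borel_measurable M"
  shows "(\<lambda>x. f x \<odot> g x) \<in> borel_measurable M"
  by (rule borel_measurable_continuous_Pair[OF assms])
    (rule cl.continuous_on[OF continuous_on_fst[OF continuous_on_id] continuous_on_snd[OF continuous_on_id]])

lemma cl_exp_measurable [measurable]:
  assumes [measurable]: "f \<in> borel_measurable M" "g \<in> borel_measurable M"
  shows "(\<lambda>x. cl_exp (f x) (g x)) \<in> borel_measurable M"
proof -
  have [measurable]: "(\<lambda>x. cosh (f x * norm (g x))) \<in> borel_measurable M"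
    "(\<lambda>x. sinh (f x * norm (g x))) \<in> borel_measurable M"
    unfolding cosh_def sinh_def by measurable
  have [measurable]: "(\<lambda>x. cl_vec (g x)) \<in> borel_measurable M"
    by (rule measurable_compose[OF assms(2) cl_vec_measurable])
  show ?thesis
    unfolding cl_exp_def
    by (intro borel_measurable_diff borel_measurable_scaleR vsmult_measurable) measurable
qed

section \<open>Integration on Euclidean spaces\<close>

lemma integral_lborel_shift:
  fixes f :: "'a::euclidean_space \<Rightarrow> 'b::{banach, second_countable_topology}"
  assumes [measurable]: "f \<in> borel_measurable borel"
  shows "(\<integral>x. f (c + x) \<partial>lborel) = (\<integral>x. f x \<partial>lborel)"
    and "integrable lborel (\<lambda>x. f (c + x)) \<longleftrightarrow> integrable lborel f"
  using integral_distr[of "(+) c" lborel borel f] integrable_distr_eq[of "(+) c" lborel borel f]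
  by (simp_all add: lborel_distr_plus)

lemma lborel_distr_minus:
  "distr lborel borel (uminus :: 'a \<Rightarrow> 'a::euclidean_space) = lborel"
  using lborel_affine[of "-1" "0::'a"] by (simp add: density_1)

lemma integral_lborel_minus:
  fixes f :: "'a::euclidean_space \<Rightarrow> 'b::{banach, second_countable_topology}"
  assumes [measurable]: "f \<in> borel_measurable borel"
  shows "(\<integral>x. f (- x) \<partial>lborel) = (\<integral>x. f x \<partial>lborel)"
    and "integrable lborel (\<lambda>x. f (- x)) \<longleftrightarrow> integrable lborel f"
  using integral_distr[of uminus lborel borel f] integrable_distr_eq[of uminus lborel borel f]
  by (simp_all add: lborel_distr_minus)

lemma nn_integral_lborel_minus:
  fixes f :: "'a::euclidean_space \<Rightarrow> ennreal"
  assumes [measurable]: "f \<in> borel_measurable borel"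
  shows "(\<integral>\<^sup>+x. f (- x) \<partial>lborel) = (\<integral>\<^sup>+x. f x \<partial>lborel)"
  using nn_integral_distr[of uminus lborel borel f] by (simp add: lborel_distr_minus)

lemma lborel_prod_Basis:
  fixes f :: "'a::euclidean_space \<Rightarrow> real \<Rightarrow> 'b::{real_normed_field,banach,second_countable_topology}"
  assumes f: "\<And>b. b \<in> Basis \<Longrightarrow> integrable lborel (f b)"
  shows "integrable lborel (\<lambda>x. \<Prod>b\<in>Basis. f b (x \<bullet> b))" (is ?I)
    and "(\<integral>x. (\<Prod>b\<in>Basis. f b (x \<bullet> b)) \<partial>lborel) = (\<Prod>b\<in>Basis. \<integral>t. f b t \<partial>lborel)" (is ?E)
proof -
  interpret product_sigma_finite "\<lambda>b::'a. lborel :: real measure" ..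
  let ?T = "\<lambda>g. \<Sum>b\<in>Basis. g b *\<^sub>R (b::'a)"
  have [measurable]: "b \<in> Basis \<Longrightarrow> f b \<in> borel_measurable borel" for b
    using borel_measurable_integrable[OF f] by simp
  have T: "?T \<in> measurable (\<Pi>\<^sub>M b\<in>Basis. lborel) borel"
    by measurable
  have m: "(\<lambda>x. \<Prod>b\<in>Basis. f b (x \<bullet> b)) \<in> borel_measurable borel"
    by measurable
  have e: "(\<Prod>b\<in>Basis. f b (?T g \<bullet> b)) = (\<Prod>b\<in>Basis. f b (g b))" for g
    by (intro prod.cong refl) simp
  show ?I
    by (subst lborel_eq, subst integrable_distr_eq[OF T m], simp only: e)
       (intro product_integrable_prod f finite_Basis)
  show ?E
    by (subst lborel_eq, subst integral_distr[OF T m], simp only: e)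
       (intro product_integral_prod f finite_Basis)
qed

lemma integrable_lborel_tensor:
  fixes f :: "'a::euclidean_space \<Rightarrow> real" and g :: "'b::euclidean_space \<Rightarrow> real"
  assumes f: "integrable lborel f" and g: "integrable lborel g"
  shows "integrable (lborel \<Otimes>\<^sub>M lborel) (\<lambda>(x, y). f x * g y)"
proof -
  have [measurable]: "f \<in> borel_measurable borel" "g \<in> borel_measurable borel"
    using borel_measurable_integrable[OF f] borel_measurable_integrable[OF g] by simp_all
  show ?thesis
    using f g by (intro lborel_pair.Fubini_integrable) (auto simp: abs_mult)
qed

text \<open>Fatou's lemma, with the limit inferior of the integrals bounded by the constant.\<close>

lemma nn_integral_le_of_tendsto:
  fixes u :: "nat \<Rightarrow> 'a \<Rightarrow> ennreal"
  assumes [measurable]: "\<And>n. u n \<in> borel_measurable M"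
    and lim: "AE x in M. (\<lambda>n. u n x) \<longlonglongrightarrow> v x"
    and bd: "\<forall>\<^sub>F n in sequentially. (\<integral>\<^sup>+x. u n x \<partial>M) \<le> C"
  shows "(\<integral>\<^sup>+x. v x \<partial>M) \<le> C"
proof -
  have "(\<integral>\<^sup>+x. v x \<partial>M) = (\<integral>\<^sup>+x. liminf (\<lambda>n. u n x) \<partial>M)"
    using lim by (intro nn_integral_cong_AE) (auto elim!: eventually_mono dest: lim_imp_Liminf[OF trivial_limit_sequentially])
  also have "\<dots> \<le> liminf (\<lambda>n. \<integral>\<^sup>+x. u n x \<partial>M)"
    by (rule nn_integral_liminf) auto
  also have "\<dots> \<le> liminf (\<lambda>n. C)"
    by (rule Liminf_mono[OF bd])
  finally show ?thesis by (simp add: Liminf_const)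
qed

lemma integrable_exp_abs:
  fixes c :: real assumes "c > 0"
  shows "integrable lborel (\<lambda>t::real. exp (- c * \<bar>t\<bar>))"
proof -
  let ?d = "exponential_density c"
  have "(\<integral>\<^sup>+t. ennreal (?d t) \<partial>lborel) = 1"
    using prob_space.emeasure_space_1[OF prob_space_exponential_density[OF assms]]
    by (simp add: emeasure_density)
  then have 1: "integrable lborel ?d"
    using exponential_density_nonneg[OF assms] by (intro integrableI_nonneg) auto
  then have 2: "integrable lborel (\<lambda>t. ?d (- t))"
    by (subst integral_lborel_minus(2)) auto
  have "integrable lborel (\<lambda>t. 1 / c * (?d t + ?d (- t)))"
    using 1 2 by simp
  then show ?thesis
  proof (rule Bochner_Integration.integrable_bound)
    show "AE t in lborel. norm (exp (- c * \<bar>t\<bar>)) \<le> norm (1 / c * (?d t + ?d (- t)))"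
      using assms by (auto simp: exponential_density_def abs_if mult.commute)
  qed simp
qed

lemma integrable_exp_norm:
  fixes c :: real assumes "c > 0"
  shows "integrable lborel (\<lambda>x::'a::euclidean_space. exp (- c * norm x))"
proof -
  \<comment> \<open>Every coordinate is at most the norm, so with this share of \<open>c\<close> the
    sum over the coordinates stays below c |x|, while the exponential of the sum is a product over
    the basis.\<close>
  let ?d = "c / DIM('a)"
  have "?d > 0" using assms by simp
  then have i: "integrable lborel (\<lambda>x::'a. \<Prod>b\<in>Basis. exp (- ?d * \<bar>x \<bullet> b\<bar>))"
    by (intro lborel_prod_Basis(1) integrable_exp_abs)
  show ?thesis
  proof (rule Bochner_Integration.integrable_bound[OF i])
    show "AE x in lborel. norm (exp (- c * norm (x::'a))) \<le> norm (\<Prod>b\<in>Basis. exp (- ?d * \<bar>x \<bullet> b\<bar>))"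
    proof (rule AE_I2)
      fix x :: 'a
      have "(\<Sum>b\<in>Basis. ?d * \<bar>x \<bullet> b\<bar>) \<le> (\<Sum>b\<in>(Basis::'a set). ?d * norm x)"
        using assms by (intro sum_mono mult_left_mono) (auto simp: Basis_le_norm)
      also have "\<dots> = c * norm x" by simp
      finally have "exp (- c * norm x) \<le> exp (\<Sum>b\<in>Basis. - ?d * \<bar>x \<bullet> b\<bar>)"
        by (simp add: sum_negf)
      also have "\<dots> = (\<Prod>b\<in>Basis. exp (- ?d * \<bar>x \<bullet> b\<bar>))"
        by (simp add: exp_sum)
      finally show "norm (exp (- c * norm x)) \<le> norm (\<Prod>b\<in>Basis. exp (- ?d * \<bar>x \<bullet> b\<bar>))"
        by simp
    qed
  qed simp
qed

section \<open>The Fourier transform of a Gaussian\<close>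

text \<open>A rescaling of the characteristic function of the standard normal distribution.\<close>

lemma gauss_fourier_real:
  fixes z \<epsilon> :: real assumes "\<epsilon> > 0"
  shows "integrable lborel (\<lambda>t. exp (- \<i> * of_real (z * t)) * of_real (exp (- \<epsilon> * t\<^sup>2 / 2)))" (is ?I)
    and "(\<integral>t. exp (- \<i> * of_real (z * t)) * of_real (exp (- \<epsilon> * t\<^sup>2 / 2)) \<partial>lborel)
      = of_real (sqrt (2 * pi / \<epsilon>) * exp (- z\<^sup>2 / (2 * \<epsilon>)))" (is ?E)
proof -
  let ?s = "sqrt \<epsilon>"
  have s: "?s > 0" "?s * ?s = \<epsilon>" using assms by auto
  have "integrable lborel (\<lambda>t. std_normal_density t * t ^ (2 * 0))"
    using std_normal_moment_even[of 0] by (rule integrable.intros)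
  then have i0: "integrable lborel std_normal_density" by simp
  have "integrable lborel (\<lambda>t. std_normal_density (0 + ?s * t))"
    using lborel_integrable_real_affine[OF i0, of ?s 0] s by simp
  then have "integrable lborel (\<lambda>t. sqrt (2 * pi) * std_normal_density (0 + ?s * t))"
    by simp
  moreover have "sqrt (2 * pi) * std_normal_density (0 + ?s * t) = exp (- \<epsilon> * t\<^sup>2 / 2)" for t
    using s by (simp add: std_normal_density_def power_mult_distrib)
  ultimately have i: "integrable lborel (\<lambda>t. exp (- \<epsilon> * t\<^sup>2 / 2))" by (simp only:)
  show ?I
    by (rule Bochner_Integration.integrable_bound[OF i]) (auto simp: norm_mult)
  \<comment> \<open>After the substitution x = sqrt \<epsilon> * t the phase u * x becomes - z *
    t.\<close>
  define u where "u = - z / ?s"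
  have "of_real (exp (- (u\<^sup>2) / 2)) = (CLINT x | std_normal_distribution. iexp (u * x))"
    using char_std_normal_distribution unfolding char_def fun_eq_iff by metis
  also have "\<dots> = (\<integral>x. std_normal_density x *\<^sub>R iexp (u * x) \<partial>lborel)"
    by (subst integral_density) (auto simp: normal_density_nonneg)
  also have "\<dots> = \<bar>?s\<bar> *\<^sub>R (\<integral>t. std_normal_density (0 + ?s * t) *\<^sub>R iexp (u * (0 + ?s * t)) \<partial>lborel)"
    using s by (intro lborel_integral_real_affine) auto
  also have "\<dots> = (?s / sqrt (2 * pi)) *\<^sub>R (\<integral>t. exp (- \<i> * of_real (z * t)) * of_real (exp (- \<epsilon> * t\<^sup>2 / 2)) \<partial>lborel)"
  proof -
    have "std_normal_density (0 + ?s * t) *\<^sub>R iexp (u * (0 + ?s * t))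
      = (1 / sqrt (2 * pi)) *\<^sub>R (exp (- \<i> * of_real (z * t)) * of_real (exp (- \<epsilon> * t\<^sup>2 / 2)))" for t
    proof -
      have "\<i> * complex_of_real (u * (0 + ?s * t)) = - \<i> * of_real (z * t)"
        using s unfolding u_def by simp
      moreover have "(?s * t)\<^sup>2 = \<epsilon> * t\<^sup>2" using s by (simp add: power_mult_distrib)
      ultimately show ?thesis
        by (simp add: std_normal_density_def scaleR_conv_of_real)
    qed
    then show ?thesis using s by simp
  qed
  finally have *: "(?s / sqrt (2 * pi)) *\<^sub>R (\<integral>t. exp (- \<i> * of_real (z * t)) * of_real (exp (- \<epsilon> * t\<^sup>2 / 2)) \<partial>lborel)
     = of_real (exp (- (u\<^sup>2) / 2))" ..
  have "(\<integral>t. exp (- \<i> * of_real (z * t)) * of_real (exp (- \<epsilon> * t\<^sup>2 / 2)) \<partial>lborel)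
     = (sqrt (2 * pi) / ?s) *\<^sub>R of_real (exp (- (u\<^sup>2) / 2))"
    unfolding *[symmetric] using s by simp
  also have "u\<^sup>2 / 2 = z\<^sup>2 / (2 * \<epsilon>)"
    using s assms by (simp add: u_def power_divide)
  then have "(sqrt (2 * pi) / ?s) *\<^sub>R of_real (exp (- (u\<^sup>2) / 2)) = complex_of_real (sqrt (2 * pi / \<epsilon>) * exp (- z\<^sup>2 / (2 * \<epsilon>)))"
    by (simp add: scaleR_conv_of_real real_sqrt_divide)
  finally show ?E .
qed

lemma norm_power2_Basis: "(norm (x::'a::euclidean_space))\<^sup>2 = (\<Sum>b\<in>Basis. (x \<bullet> b)\<^sup>2)"
  unfolding power2_norm_eq_inner by (subst euclidean_inner) (simp add: power2_eq_square)

lemma gauss_fourier: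
  fixes z :: "'a::euclidean_space" and \<epsilon> :: real assumes "\<epsilon> > 0"
  shows "integrable lborel (\<lambda>\<xi>. exp (- \<i> * of_real (z \<bullet> \<xi>)) * of_real (exp (- \<epsilon> * (norm \<xi>)\<^sup>2 / 2)))" (is ?I)
    and "(\<integral>\<xi>. exp (- \<i> * of_real (z \<bullet> \<xi>)) * of_real (exp (- \<epsilon> * (norm \<xi>)\<^sup>2 / 2)) \<partial>lborel)
      = of_real (sqrt (2 * pi / \<epsilon>) ^ DIM('a) * exp (- (norm z)\<^sup>2 / (2 * \<epsilon>)))" (is ?E)
proof -
  let ?f = "\<lambda>b t. exp (- \<i> * of_real ((z \<bullet> b) * t)) * of_real (exp (- \<epsilon> * t\<^sup>2 / 2))"
  have e: "exp (- \<i> * of_real (z \<bullet> \<xi>)) * of_real (exp (- \<epsilon> * (norm \<xi>)\<^sup>2 / 2)) = (\<Prod>b\<in>Basis. ?f b (\<xi> \<bullet> b))" for \<xi>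
  proof -
    have "exp (- \<i> * of_real (z \<bullet> \<xi>)) = (\<Prod>b\<in>Basis. exp (- \<i> * of_real ((z \<bullet> b) * (\<xi> \<bullet> b))))"
      by (subst euclidean_inner) (simp add: exp_sum[symmetric] sum_distrib_left sum_negf)
    moreover have "exp (- \<epsilon> * (norm \<xi>)\<^sup>2 / 2) = (\<Prod>b\<in>Basis. exp (- \<epsilon> * (\<xi> \<bullet> b)\<^sup>2 / 2))"
      by (simp add: exp_sum[symmetric] norm_power2_Basis sum_distrib_left sum_negf sum_divide_distrib)
    ultimately show ?thesis
      by (simp add: prod.distrib)
  qed
  show ?I
    unfolding e by (intro lborel_prod_Basis(1) gauss_fourier_real(1) assms)
  have "(\<Prod>b\<in>Basis. sqrt (2 * pi / \<epsilon>) * exp (- (z \<bullet> b)\<^sup>2 / (2 * \<epsilon>)))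
     = sqrt (2 * pi / \<epsilon>) ^ DIM('a) * exp (- (norm z)\<^sup>2 / (2 * \<epsilon>))"
    by (simp add: prod.distrib exp_sum[symmetric] norm_power2_Basis sum_negf sum_divide_distrib)
  moreover have "(\<integral>\<xi>. (\<Prod>b\<in>Basis. ?f b (\<xi> \<bullet> b)) \<partial>lborel) = (\<Prod>b\<in>Basis. \<integral>t. ?f b t \<partial>lborel)"
    by (rule lborel_prod_Basis(2)) (rule gauss_fourier_real(1)[OF assms])
  ultimately show ?E
    unfolding e by (simp only: gauss_fourier_real(2)[OF assms] of_real_prod[symmetric])
qed

lemma gauss_integral:
  fixes \<epsilon> :: real assumes "\<epsilon> > 0"
  shows "integrable lborel (\<lambda>\<xi>::'a::euclidean_space. exp (- \<epsilon> * (norm \<xi>)\<^sup>2 / 2))" (is ?I)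
    and "(\<integral>\<xi>. exp (- \<epsilon> * (norm (\<xi>::'a::euclidean_space))\<^sup>2 / 2) \<partial>lborel) = sqrt (2 * pi / \<epsilon>) ^ DIM('a)" (is ?E)
proof -
  show ?I
    using integrable_norm[OF gauss_fourier(1)[OF assms, of "0::'a"]] by simp
  have "complex_of_real (\<integral>\<xi>. exp (- \<epsilon> * (norm (\<xi>::'a))\<^sup>2 / 2) \<partial>lborel) = of_real (sqrt (2 * pi / \<epsilon>) ^ DIM('a))"
    using gauss_fourier(2)[OF assms, of "0::'a"] by (simp add: integral_of_real del: of_real_power)
  then show ?E by (simp only: of_real_eq_iff)
qed

section \<open>The Fourier transform on square integrable functions\<close>

lemma integrable_phase:
  fixes h :: "(real, 'n::finite) vec \<Rightarrow> 'm::finite cliff"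
  assumes h: "integrable lborel h"
  shows "integrable lborel (\<lambda>x. exp (- \<i> * of_real (x \<bullet> \<xi>)) *s h x)"
proof -
  have [measurable]: "h \<in> borel_measurable borel"
    using borel_measurable_integrable[OF h] by simp
  show ?thesis
    by (rule Bochner_Integration.integrable_bound[OF h]) simp_all
qed

lemma measurable_fst_snd_borel [measurable]:
  "fst \<in> borel_measurable (borel :: ('a::second_countable_topology \<times> 'b::second_countable_topology) measure)"
  "snd \<in> borel_measurable (borel :: ('a::second_countable_topology \<times> 'b::second_countable_topology) measure)"
  by (auto intro!: borel_measurable_continuous_onI continuous_on_fst[OF continuous_on_id] continuous_on_snd[OF continuous_on_id])

lemma fourier1_measurable [measurable]:
  fixes h :: "(real, 'n::finite) vec \<Rightarrow> 'm::finite cliff"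
  assumes [measurable]: "h \<in> borel_measurable borel"
  shows "fourier1 h \<in> borel_measurable borel"
proof -
  have "(\<lambda>\<xi>. \<integral>x. exp (- \<i> * of_real (x \<bullet> \<xi>)) *s h x \<partial>lborel) \<in> borel_measurable borel"
    by measurable
  then show ?thesis by (simp add: fourier1_def[abs_def])
qed

lemma norm_fourier1_le:
  fixes h :: "(real, 'n::finite) vec \<Rightarrow> 'm::finite cliff"
  shows "norm (fourier1 h \<xi>) \<le> (\<integral>x. norm (h x) \<partial>lborel)"
  unfolding fourier1_def using integral_norm_bound[of lborel "\<lambda>x. exp (- \<i> * of_real (x \<bullet> \<xi>)) *s h x"] by simp

lemma fourier1_diff:
  fixes h k :: "(real, 'n::finite) vec \<Rightarrow> 'm::finite cliff"
  assumes "integrable lborel h" "integrable lborel k"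
  shows "fourier1 (\<lambda>x. h x - k x) \<xi> = fourier1 h \<xi> - fourier1 k \<xi>"
  unfolding fourier1_def vsmult.diff_right
  by (intro Bochner_Integration.integral_diff integrable_phase assms)

lemma exp_phase_mult: "exp (- \<i> * of_real a) * cnj (exp (- \<i> * of_real b)) = exp (- \<i> * of_real (a - b))"
  by (simp add: exp_cnj exp_add[symmetric] algebra_simps)

lemma inner_vsmult_vsmult: "(c *s u) \<bullet> (d *s v) = ((c * cnj d) *s u) \<bullet> (v :: complex ^ 'k)"
proof -
  have "(c *s u) \<bullet> (d *s v) = v \<bullet> (cnj d *s (c *s u))"
    by (subst inner_commute) (rule inner_vsmult_left)
  then show ?thesis
    by (simp add: vector_smult_assoc inner_commute mult.commute)
qed

text \<open>Integrating \<open>|fourier1 h|\<^sup>2\<close> against a Gaussian and exchanging the integrals produces the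
  positive kernel of total mass \<open>(2 \<pi>)\<^sup>m\<close> given by the transform of the Gaussian; only the
  upper bound is needed, and it requires no continuity of translations.\<close>
lemma fourier1_gauss_bound:
  fixes h :: "(real, 'n::finite) vec \<Rightarrow> 'm::finite cliff"
  assumes h: "integrable lborel h" and h2: "integrable lborel (\<lambda>x. (norm (h x))\<^sup>2)" and "\<epsilon> > 0"
  shows "(\<integral>\<xi>. exp (- \<epsilon> * (norm \<xi>)\<^sup>2 / 2) * (norm (fourier1 h \<xi>))\<^sup>2 \<partial>lborel)
    \<le> (2 * pi) ^ CARD('n) * (\<integral>x. (norm (h x))\<^sup>2 \<partial>lborel)"
proof -
  have [measurable]: "h \<in> borel_measurable borel"
    using borel_measurable_integrable[OF h] by simp
  let ?g = "\<lambda>\<xi>::(real, 'n) vec. exp (- \<epsilon> * (norm \<xi>)\<^sup>2 / 2)"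
  let ?e = "\<lambda>x \<xi>::(real, 'n) vec. exp (- \<i> * of_real (x \<bullet> \<xi>))"
  \<comment> \<open>The transform of the Gaussian \<open>?g\<close>, which arises below with the
    argument x - y.\<close>
  define G where "G z = sqrt (2 * pi / \<epsilon>) ^ CARD('n) * exp (- (norm z)\<^sup>2 / (2 * \<epsilon>))" for z :: "(real, 'n) vec"
  have [measurable]: "G \<in> borel_measurable borel" unfolding G_def[abs_def] by measurable
  have G0: "G z \<ge> 0" for z using \<open>\<epsilon> > 0\<close> by (simp add: G_def)
  have Gm: "G (- z) = G z" for z by (simp add: G_def)
  have G_eq: "G = (\<lambda>z. sqrt (2 * pi / \<epsilon>) ^ CARD('n) * exp (- (1 / \<epsilon>) * (norm z)\<^sup>2 / 2))"
    unfolding G_def by (intro ext) (simp add: mult.commute)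
  have Gi: "integrable lborel G"
    unfolding G_eq using gauss_integral(1)[of "1 / \<epsilon>", where 'a="(real, 'n) vec"] \<open>\<epsilon> > 0\<close> by simp
  have GI: "(\<integral>z. G z \<partial>lborel) = (2 * pi) ^ CARD('n)"
  proof -
    have "sqrt (2 * pi / \<epsilon>) * sqrt (2 * pi / (1 / \<epsilon>)) = sqrt ((2 * pi)\<^sup>2)"
      unfolding real_sqrt_mult[symmetric] using \<open>\<epsilon> > 0\<close> by (simp add: power2_eq_square)
    also have "\<dots> = 2 * pi" by (rule real_sqrt_unique) auto
    finally have "sqrt (2 * pi / \<epsilon>) ^ CARD('n) * sqrt (2 * pi / (1 / \<epsilon>)) ^ CARD('n) = (2 * pi) ^ CARD('n)"
      by (simp only: power_mult_distrib[symmetric])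
    moreover have "(\<integral>\<xi>. exp (- (1 / \<epsilon>) * (norm (\<xi>::(real, 'n) vec))\<^sup>2 / 2) \<partial>lborel) = sqrt (2 * pi / (1 / \<epsilon>)) ^ CARD('n)"
      using gauss_integral(2)[of "1 / \<epsilon>", where 'a="(real, 'n) vec"] \<open>\<epsilon> > 0\<close> by (simp only: DIM_cart DIM_real mult_1_right zero_less_divide_1_iff)
    ultimately show ?thesis
      unfolding G_eq by (simp only: integral_mult_right_zero)
  qed
  \<comment> \<open>The integrand of |fourier1 h \<xi>|^2 written as one integral over pairs p = (x,
    y), so that a single exchange of integrals brings \<xi> inside.\<close>
  let ?Q = "\<lambda>\<xi> p. ?g \<xi> * ((?e (fst p) \<xi> *s h (fst p)) \<bullet> (?e (snd p) \<xi> *s h (snd p)))"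
  have hh: "integrable lborel (\<lambda>p. norm (h (fst p)) * norm (h (snd p)))"
    using integrable_lborel_tensor[OF integrable_norm[OF h] integrable_norm[OF h]]
    by (simp add: lborel_prod case_prod_beta')
  have Qi: "integrable (lborel \<Otimes>\<^sub>M lborel) (\<lambda>(\<xi>, p). ?Q \<xi> p)"
  proof (rule Bochner_Integration.integrable_bound[OF integrable_lborel_tensor[OF gauss_integral(1)[OF \<open>\<epsilon> > 0\<close>] hh]])
    show "AE q in lborel \<Otimes>\<^sub>M lborel. norm (case q of (\<xi>, p) \<Rightarrow> ?Q \<xi> p)
       \<le> norm (case q of (\<xi>, p) \<Rightarrow> ?g \<xi> * (norm (h (fst p)) * norm (h (snd p))))"
    proof (rule AE_I2, clarify)
      fix \<xi> x y
      have "\<bar>(?e x \<xi> *s h x) \<bullet> (?e y \<xi> *s h y)\<bar> \<le> norm (h x) * norm (h y)"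
        using Cauchy_Schwarz_ineq2[of "?e x \<xi> *s h x" "?e y \<xi> *s h y"] by simp
      then show "norm (?Q \<xi> (x, y)) \<le> norm (?g \<xi> * (norm (h (fst (x, y))) * norm (h (snd (x, y)))))"
        by (simp add: abs_mult mult_left_mono)
    qed
  qed (unfold lborel_prod case_prod_beta', measurable)
  have 1: "(\<integral>p. ?Q \<xi> p \<partial>lborel) = ?g \<xi> * (norm (fourier1 h \<xi>))\<^sup>2" for \<xi>
  proof -
    let ?k = "\<lambda>x. ?e x \<xi> *s h x"
    have k: "integrable lborel ?k" by (rule integrable_phase[OF h])
    have [measurable]: "?k \<in> borel_measurable borel" by measurable
    have i: "integrable (lborel \<Otimes>\<^sub>M lborel) (\<lambda>(x, y). ?k x \<bullet> ?k y)"
      by (rule Bochner_Integration.integrable_bound[OF integrable_lborel_tensor[OF integrable_norm[OF k] integrable_norm[OF k]]])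
        (auto intro: Cauchy_Schwarz_ineq2 simp: lborel_prod case_prod_beta' simp del: norm_vsmult)
    have "(\<integral>p. ?Q \<xi> p \<partial>lborel) = ?g \<xi> * (\<integral>p. ?k (fst p) \<bullet> ?k (snd p) \<partial>lborel)"
      by simp
    also have "(\<integral>p. ?k (fst p) \<bullet> ?k (snd p) \<partial>lborel) = (\<integral>x. (\<integral>y. ?k x \<bullet> ?k y \<partial>lborel) \<partial>lborel)"
      using lborel_pair.integral_fst[OF i] by (simp add: lborel_prod case_prod_beta')
    also have "\<dots> = (\<integral>x. ?k x \<bullet> fourier1 h \<xi> \<partial>lborel)"
      unfolding fourier1_def using k by simp
    also have "\<dots> = fourier1 h \<xi> \<bullet> fourier1 h \<xi>"
      unfolding fourier1_def using k by simp
    finally show ?thesis by (simp add: power2_norm_eq_inner)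
  qed
  have 2: "(\<integral>\<xi>. ?Q \<xi> p \<partial>lborel) = G (fst p - snd p) * (h (fst p) \<bullet> h (snd p))" for p
  proof -
    obtain x y where p: "p = (x, y)" by (cases p)
    let ?c = "\<lambda>\<xi>. ?e (x - y) \<xi> * of_real (?g \<xi>)"
    have "?Q \<xi> p = (?c \<xi> *s h x) \<bullet> h y" for \<xi>
    proof -
      have "(?e x \<xi> *s h x) \<bullet> (?e y \<xi> *s h y) = (?e (x - y) \<xi> *s h x) \<bullet> h y"
        unfolding inner_vsmult_vsmult inner_diff_left exp_phase_mult ..
      moreover have "?c \<xi> *s h x = ?g \<xi> *\<^sub>R (?e (x - y) \<xi> *s h x)"
        by (simp add: vec_eq_iff scaleR_conv_of_real[where 'a=complex])
      ultimately show ?thesis by (simp add: p)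
    qed
    then have "(\<integral>\<xi>. ?Q \<xi> p \<partial>lborel) = (\<integral>\<xi>. (?c \<xi> *s h x) \<bullet> h y \<partial>lborel)" by simp
    also have "\<dots> = ((\<integral>\<xi>. ?c \<xi> \<partial>lborel) *s h x) \<bullet> h y"
      using integral_bounded_linear[OF bounded_linear_compose[OF bounded_linear_inner_left vsmult.bounded_linear_left]
          gauss_fourier(1)[OF \<open>\<epsilon> > 0\<close>, of "x - y"], of "h x" "h y"] by simp
    also have "(\<integral>\<xi>. ?c \<xi> \<partial>lborel) = of_real (G (x - y))"
      using gauss_fourier(2)[OF \<open>\<epsilon> > 0\<close>, of "x - y"] by (simp add: G_def)
    finally show ?thesis by (simp add: p)
  qed
  have "(\<integral>\<xi>. ?g \<xi> * (norm (fourier1 h \<xi>))\<^sup>2 \<partial>lborel) = (\<integral>\<xi>. (\<integral>p. ?Q \<xi> p \<partial>lborel) \<partial>lborel)"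
    by (simp only: 1)
  also have "\<dots> = (\<integral>p. (\<integral>\<xi>. ?Q \<xi> p \<partial>lborel) \<partial>lborel)"
    by (rule lborel_pair.Fubini_integral[OF Qi, symmetric])
  also have "\<dots> = (\<integral>p. G (fst p - snd p) * (h (fst p) \<bullet> h (snd p)) \<partial>lborel)"
    by (simp only: 2)
  also have "\<dots> \<le> (2 * pi) ^ CARD('n) * (\<integral>x. (norm (h x))\<^sup>2 \<partial>lborel)"
  proof -
    let ?N = "\<lambda>x. (norm (h x))\<^sup>2"
    have i1: "integrable (lborel \<Otimes>\<^sub>M lborel) (\<lambda>(x, y). G (x - y) * ?N x)"
      and e1: "(\<integral>x. (\<integral>y. G (x - y) * ?N x \<partial>lborel) \<partial>lborel) = (2 * pi) ^ CARD('n) * (\<integral>x. ?N x \<partial>lborel)"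
    proof -
      have s: "integrable lborel (\<lambda>y. G (x - y))" "(\<integral>y. G (x - y) \<partial>lborel) = (2 * pi) ^ CARD('n)" for x
        using integral_lborel_shift[of G "- x"] Gi GI Gm[of "x - _"] by simp_all
      show "integrable (lborel \<Otimes>\<^sub>M lborel) (\<lambda>(x, y). G (x - y) * ?N x)"
        by (rule lborel_pair.Fubini_integrable) (auto simp: abs_mult G0 s h2)
      show "(\<integral>x. (\<integral>y. G (x - y) * ?N x \<partial>lborel) \<partial>lborel) = (2 * pi) ^ CARD('n) * (\<integral>x. ?N x \<partial>lborel)"
        by (simp add: s)
    qed
    have i2: "integrable (lborel \<Otimes>\<^sub>M lborel) (\<lambda>(x, y). G (x - y) * ?N y)"
      using lborel_pair.integrable_product_swap[OF i1] Gm
      by (simp add: case_prod_beta' flip: Gm[of "fst _ - snd _"])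
    have e2: "(\<integral>(x, y). G (x - y) * ?N y \<partial>(lborel \<Otimes>\<^sub>M lborel)) = (\<integral>(x, y). G (x - y) * ?N x \<partial>(lborel \<Otimes>\<^sub>M lborel))"
      using lborel_pair.integral_product_swap[OF borel_measurable_integrable[OF i1]]
      by (simp add: case_prod_beta' flip: Gm[of "fst _ - snd _"])
    \<comment> \<open>By h x \<bullet> h y \<le> (|h x|^2 + |h y|^2) / 2. The kernel is even, so
      both halves contribute the same amount, half of its total mass times the squared norm of
      h.\<close>
    have "(\<integral>p. G (fst p - snd p) * (h (fst p) \<bullet> h (snd p)) \<partial>lborel)
        \<le> (\<integral>p. (G (fst p - snd p) * ?N (fst p) + G (fst p - snd p) * ?N (snd p)) / 2 \<partial>lborel)"
    proof (rule integral_mono_AE')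
      show "integrable lborel (\<lambda>p. (G (fst p - snd p) * ?N (fst p) + G (fst p - snd p) * ?N (snd p)) / 2)"
        using i1 i2 by (simp add: lborel_prod case_prod_beta')
      show "AE p in lborel. G (fst p - snd p) * (h (fst p) \<bullet> h (snd p))
         \<le> (G (fst p - snd p) * ?N (fst p) + G (fst p - snd p) * ?N (snd p)) / 2"
      proof (rule AE_I2)
        fix p :: "(real, 'n) vec \<times> (real, 'n) vec"
        have "h (fst p) \<bullet> h (snd p) \<le> (?N (fst p) + ?N (snd p)) / 2"
          using inner_ge_zero[of "h (fst p) - h (snd p)"]
          by (simp add: power2_norm_eq_inner inner_diff inner_commute)
        from mult_left_mono[OF this G0[of "fst p - snd p"]]
        show "G (fst p - snd p) * (h (fst p) \<bullet> h (snd p))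
         \<le> (G (fst p - snd p) * ?N (fst p) + G (fst p - snd p) * ?N (snd p)) / 2"
          by (simp add: algebra_simps)
      qed
    qed (simp add: G0)
    also have "\<dots> = (2 * pi) ^ CARD('n) * (\<integral>x. ?N x \<partial>lborel)"
      using i1 i2 e1 e2 lborel_pair.integral_fst[OF i1] by (simp add: lborel_prod case_prod_beta')
    finally show ?thesis .
  qed
  finally show ?thesis .
qed

text \<open>The bound with a Gaussian factor does not depend on the parameter of the Gaussian;
  letting it tend to 0 and applying Fatou removes the factor.\<close>

lemma fourier1_L2_bound:
  fixes h :: "(real, 'n::finite) vec \<Rightarrow> 'm::finite cliff"
  assumes h: "integrable lborel h" and h2: "integrable lborel (\<lambda>x. (norm (h x))\<^sup>2)"
  shows "(\<integral>\<^sup>+\<xi>. ennreal ((norm (fourier1 h \<xi>))\<^sup>2) \<partial>lborel) \<le> ennreal ((2 * pi) ^ CARD('n) * (\<integral>x. (norm (h x))\<^sup>2 \<partial>lborel))"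
proof -
  have [measurable]: "h \<in> borel_measurable borel"
    using borel_measurable_integrable[OF h] by simp
  let ?g = "\<lambda>n \<xi>::(real, 'n) vec. exp (- (1 / real (Suc n)) * (norm \<xi>)\<^sup>2 / 2) * (norm (fourier1 h \<xi>))\<^sup>2"
  show ?thesis
  proof (rule nn_integral_le_of_tendsto[where u="\<lambda>n \<xi>. ennreal (?g n \<xi>)"])
    show "AE \<xi> in lborel. (\<lambda>n. ennreal (?g n \<xi>)) \<longlonglongrightarrow> ennreal ((norm (fourier1 h \<xi>))\<^sup>2)"
    proof (intro AE_I2 tendsto_ennrealI)
      fix \<xi> :: "(real, 'n) vec"
      have "(\<lambda>n. exp (- (1 / real (Suc n)) * (norm \<xi>)\<^sup>2 / 2) * (norm (fourier1 h \<xi>))\<^sup>2)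
        \<longlonglongrightarrow> exp (- 0 * (norm \<xi>)\<^sup>2 / 2) * (norm (fourier1 h \<xi>))\<^sup>2"
        by (intro tendsto_intros LIMSEQ_Suc[OF lim_1_over_n]) auto
      then show "(\<lambda>n. ?g n \<xi>) \<longlonglongrightarrow> (norm (fourier1 h \<xi>))\<^sup>2" by simp
    qed
    have "(\<integral>\<^sup>+\<xi>. ennreal (?g n \<xi>) \<partial>lborel) \<le> ennreal ((2 * pi) ^ CARD('n) * (\<integral>x. (norm (h x))\<^sup>2 \<partial>lborel))" for n
    proof -
      have "integrable lborel (\<lambda>\<xi>::(real, 'n) vec. exp (- (1 / real (Suc n)) * (norm \<xi>)\<^sup>2 / 2) * (\<integral>x. norm (h x) \<partial>lborel)\<^sup>2)"
        using gauss_integral(1)[of "1 / real (Suc n)", where 'a="(real, 'n) vec"] by (intro integrable_mult_left) simp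
      then have "integrable lborel (?g n)"
        by (rule Bochner_Integration.integrable_bound)
          (auto simp: abs_mult intro!: mult_left_mono power_mono norm_fourier1_le)
      then have "(\<integral>\<^sup>+\<xi>. ennreal (?g n \<xi>) \<partial>lborel) = ennreal (\<integral>\<xi>. ?g n \<xi> \<partial>lborel)"
        by (intro nn_integral_eq_integral) auto
      also have "\<dots> \<le> ennreal ((2 * pi) ^ CARD('n) * (\<integral>x. (norm (h x))\<^sup>2 \<partial>lborel))"
        by (intro ennreal_leI fourier1_gauss_bound h h2) simp
      finally show ?thesis .
    qed
    then show "\<forall>\<^sub>F n in sequentially. (\<integral>\<^sup>+\<xi>. ennreal (?g n \<xi>) \<partial>lborel) \<le> ennreal ((2 * pi) ^ CARD('n) * (\<integral>x. (norm (h x))\<^sup>2 \<partial>lborel))"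
      by simp
  qed simp
qed

lemma norm_add_power2_le: "(norm (a + b))\<^sup>2 \<le> 2 * (norm a)\<^sup>2 + 2 * (norm (b::'a::real_normed_vector))\<^sup>2"
proof -
  have "(norm (a + b))\<^sup>2 \<le> (norm a + norm b)\<^sup>2"
    by (intro power_mono norm_triangle_ineq) auto
  also have "\<dots> \<le> 2 * (norm a)\<^sup>2 + 2 * (norm b)\<^sup>2"
    using sum_squares_bound[of "norm a" "norm b"] by (simp add: power2_sum)
  finally show ?thesis .
qed

lemma norm_diff_power2_le: "(norm (a - b))\<^sup>2 \<le> 2 * (norm a)\<^sup>2 + 2 * (norm (b::'a::real_normed_vector))\<^sup>2"
  using norm_add_power2_le[of a "- b"] by simp

section \<open>Square integrable functions and their truncations\<close>

lemma L2_iff_nn_integral: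
  "L2 h \<longleftrightarrow> h \<in> borel_measurable borel \<and> (\<integral>\<^sup>+x. ennreal ((norm (h x))\<^sup>2) \<partial>lborel) < \<infinity>"
  by (auto simp: L2_def integrable_iff_bounded)

lemma L2_measurable: "L2 h \<Longrightarrow> h \<in> borel_measurable borel"
  by (simp add: L2_def)

lemma L2_integrable: "L2 h \<Longrightarrow> integrable lborel (\<lambda>x. (norm (h x))\<^sup>2)"
  by (simp add: L2_def)

lemma L2_bound:
  assumes "L2 h" and [measurable]: "k \<in> borel_measurable borel" and "\<And>x. norm (k x) \<le> norm (h x)"
  shows "L2 k"
  unfolding L2_def
proof
  show "integrable lborel (\<lambda>x. (norm (k x))\<^sup>2)"
    by (rule Bochner_Integration.integrable_bound[OF L2_integrable[OF assms(1)]])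
      (auto intro!: power_mono assms)
qed simp

lemma L2_diff:
  assumes "L2 h" "L2 k"
  shows "L2 (\<lambda>x. h x - k x)"
proof -
  note [measurable] = L2_measurable[OF assms(1)] L2_measurable[OF assms(2)]
  have "integrable lborel (\<lambda>x. 2 * (norm (h x))\<^sup>2 + 2 * (norm (k x))\<^sup>2)"
    using assms[THEN L2_integrable] by simp
  then have "integrable lborel (\<lambda>x. (norm (h x - k x))\<^sup>2)"
    by (rule Bochner_Integration.integrable_bound) (auto simp: norm_diff_power2_le)
  then show ?thesis by (simp add: L2_def)
qed

lemma ball_measurable [measurable]: "ball (x :: 'a::metric_space) r \<in> sets borel"
  by simp

text \<open>A ball has finite measure and |h| \<le> 1 + |h|^2, so a truncation lies in both L1 and
  L2, where \<open>fourier1\<close> is an absolutely convergent integral.\<close>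

lemma L2_truncate:
  fixes h :: "(real, 'n::finite) vec \<Rightarrow> 'm::finite cliff"
  assumes "L2 h"
  shows "integrable lborel (\<lambda>x. indicator (ball 0 R) x *\<^sub>R h x)" and "L2 (\<lambda>x. indicator (ball 0 R) x *\<^sub>R h x)"
proof -
  note [measurable] = L2_measurable[OF assms]
  show "L2 (\<lambda>x. indicator (ball 0 R) x *\<^sub>R h x)"
    by (rule L2_bound[OF assms]) (auto simp: indicator_def)
  have "integrable lborel (\<lambda>x. indicator (ball 0 R) x + (norm (h x))\<^sup>2)"
    using L2_integrable[OF assms] emeasure_bounded_finite[OF bounded_ball, of "0::(real, 'n) vec" R]
    by (intro Bochner_Integration.integrable_add integrable_real_indicator) auto
  then show "integrable lborel (\<lambda>x. indicator (ball 0 R) x *\<^sub>R h x)"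
  proof (rule Bochner_Integration.integrable_bound)
    have "t \<le> 1 + t\<^sup>2" for t :: real
      using sum_squares_bound[of t 1] by (smt (verit) zero_le_power2 power2_eq_square mult_1 one_power2)
    then show "AE x in lborel. norm (indicator (ball 0 R) x *\<^sub>R h x) \<le> norm (indicator (ball 0 R) x + (norm (h x))\<^sup>2)"
      by (intro AE_I2) (auto simp: indicator_def abs_of_nonneg)
  qed simp
qed

lemma L2_tail:
  fixes h :: "(real, 'n::finite) vec \<Rightarrow> 'm::finite cliff"
  assumes "L2 h"
  shows "((\<lambda>R. \<integral>x. indicator (- ball 0 R) x * (norm (h x))\<^sup>2 \<partial>lborel) \<longlongrightarrow> 0) at_top"
proof -
  note [measurable] = L2_measurable[OF assms]
  have "((\<lambda>R. \<integral>x. indicator (- ball 0 R) x * (norm (h x))\<^sup>2 \<partial>lborel) \<longlongrightarrow> (\<integral>x. 0 \<partial>(lborel :: (real, 'n) vec measure))) at_top"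
  proof (rule integral_dominated_convergence_at_top[where w="\<lambda>x. (norm (h x))\<^sup>2"])
    show "AE x in lborel. ((\<lambda>R. indicator (- ball 0 R) x * (norm (h x))\<^sup>2) \<longlongrightarrow> 0) at_top"
    proof (rule AE_I2)
      fix x :: "(real, 'n) vec"
      have "\<forall>\<^sub>F R in at_top. indicator (- ball 0 R) x * (norm (h x))\<^sup>2 = 0"
        using eventually_gt_at_top[of "norm x"] by eventually_elim (auto simp: indicator_def)
      then show "((\<lambda>R. indicator (- ball 0 R) x * (norm (h x))\<^sup>2) \<longlongrightarrow> 0) at_top"
        by (rule tendsto_eventually)
    qed
  qed (auto simp: indicator_def L2_integrable[OF assms])
  then show ?thesis by simp
qed

text \<open>The two truncations agree on the smaller ball, so the L2 bound charges their difference
  to the tail alone. This is the Cauchy property behind the extension to L2.\<close>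

lemma fourier1_trunc_diff:
  fixes h :: "(real, 'n::finite) vec \<Rightarrow> 'm::finite cliff"
  assumes "L2 h" "R \<le> R'"
  defines "T \<equiv> \<lambda>R x. indicator (ball 0 R) x *\<^sub>R h x"
  shows "(\<integral>\<^sup>+\<xi>. ennreal ((norm (fourier1 (T R) \<xi> - fourier1 (T R') \<xi>))\<^sup>2) \<partial>lborel)
    \<le> ennreal ((2 * pi) ^ CARD('n) * (\<integral>x. indicator (- ball 0 R) x * (norm (h x))\<^sup>2 \<partial>lborel))"
proof -
  note [measurable] = L2_measurable[OF assms(1)]
  have T: "integrable lborel (T R)" "L2 (T R)" for R
    using L2_truncate[OF assms(1)] by (simp_all add: T_def)
  have "(\<integral>\<^sup>+\<xi>. ennreal ((norm (fourier1 (T R) \<xi> - fourier1 (T R') \<xi>))\<^sup>2) \<partial>lborel)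
    = (\<integral>\<^sup>+\<xi>. ennreal ((norm (fourier1 (\<lambda>x. T R x - T R' x) \<xi>))\<^sup>2) \<partial>lborel)"
    by (simp add: fourier1_diff T)
  also have "\<dots> \<le> ennreal ((2 * pi) ^ CARD('n) * (\<integral>x. (norm (T R x - T R' x))\<^sup>2 \<partial>lborel))"
    by (intro fourier1_L2_bound Bochner_Integration.integrable_diff T L2_integrable[OF L2_diff[OF T(2) T(2)]])
  also have "\<dots> \<le> ennreal ((2 * pi) ^ CARD('n) * (\<integral>x. indicator (- ball 0 R) x * (norm (h x))\<^sup>2 \<partial>lborel))"
  proof (intro ennreal_leI mult_left_mono integral_mono)
    show "integrable lborel (\<lambda>x. indicator (- ball 0 R) x * (norm (h x))\<^sup>2)"
      by (rule Bochner_Integration.integrable_bound[OF L2_integrable[OF assms(1)]]) (auto simp: indicator_def)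
    show "(norm (T R x - T R' x))\<^sup>2 \<le> indicator (- ball 0 R) x * (norm (h x))\<^sup>2" for x
      using \<open>R \<le> R'\<close> by (auto simp: T_def indicator_def)
  qed (auto intro: L2_integrable[OF L2_diff[OF T(2) T(2)]])
  finally show ?thesis .
qed

section \<open>Extension of the Fourier transform to square integrable functions\<close>

lemma ennreal_suminf_ge: "u k \<le> (\<Sum>k. u k :: ennreal)"
proof -
  have "sum u {k} \<le> (\<Sum>k. u k)"
    by (rule sum_le_suminf) auto
  then show ?thesis by simp
qed

text \<open>Each single term is at most the total S, which gives d k \<le> sqrt S * (1/2)^k: the
  weight 4^k pays for passing from squares to absolute values.\<close>

lemma summable_of_ennreal_geometric:
  fixes d :: "nat \<Rightarrow> real"
  assumes "\<And>k. d k \<ge> 0" and fin: "(\<Sum>k. ennreal (4 ^ k * (d k)\<^sup>2)) < \<infinity>"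
  shows "summable d"
proof -
  obtain S where S: "S \<ge> 0" "(\<Sum>k. ennreal (4 ^ k * (d k)\<^sup>2)) = ennreal S"
    using fin[unfolded infinity_ennreal_def less_top_ennreal] by blast
  show ?thesis
  proof (rule summable_comparison_test')
    show "summable (\<lambda>k. sqrt S * (1 / 2) ^ k)"
      by (intro summable_mult summable_geometric) auto
    fix k :: nat
    have "ennreal (4 ^ k * (d k)\<^sup>2) \<le> ennreal S"
      unfolding S(2)[symmetric] using ennreal_suminf_ge[of "\<lambda>k. ennreal (4 ^ k * (d k)\<^sup>2)" k] .
    then have "4 ^ k * (d k)\<^sup>2 \<le> S"
      using S by (simp add: ennreal_le_iff)
    moreover have "4 ^ k * (d k)\<^sup>2 = (2 ^ k * d k)\<^sup>2"
      by (simp add: power_mult_distrib power2_eq_square[of "2 ^ k"] flip: power_mult_distrib[of 2 2 k])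
    ultimately have "2 ^ k * d k \<le> sqrt S"
      by (simp add: real_le_rsqrt)
    then show "norm (d k) \<le> sqrt S * (1 / 2) ^ k"
      using assms(1)[of k] by (simp add: field_simps power_divide)
  qed
qed

text \<open>The Riesz-Fischer argument: along a fast subsequence the transforms of the truncations
  converge almost everywhere, and Fatou carries the norm bounds over to the limit. As
  \<open>fourier_L2\<close> asks for a limit over all real radii, the distance to the limit is
  bounded for every R and not only along the subsequence.\<close>

lemma fourier_L2_exists:
  fixes h :: "(real, 'n::finite) vec \<Rightarrow> 'm::finite cliff"
  assumes L2: "L2 h"
  obtains H where "fourier_L2 h H"
    "(\<integral>\<^sup>+\<xi>. ennreal ((norm (H \<xi>))\<^sup>2) \<partial>lborel) \<le> ennreal ((2 * pi) ^ CARD('n) * (\<integral>x. (norm (h x))\<^sup>2 \<partial>lborel))"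
proof -
  note [measurable] = L2_measurable[OF L2]
  define T where "T R x = indicator (ball 0 R) x *\<^sub>R h x" for R x
  have T: "integrable lborel (T R)" "L2 (T R)" for R
    using L2_truncate[OF L2] by (simp_all add: T_def[abs_def])
  have [measurable]: "T R \<in> borel_measurable borel" for R using T(2) by (rule L2_measurable)
  define t where "t R = (2 * pi) ^ CARD('n) * (\<integral>x. indicator (- ball 0 R) x * (norm (h x))\<^sup>2 \<partial>lborel)" for R :: real
  have t0: "(t \<longlongrightarrow> 0) at_top"
    unfolding t_def[abs_def] using tendsto_mult[OF tendsto_const L2_tail[OF L2]] by simp
  have D: "(\<integral>\<^sup>+\<xi>. ennreal ((norm (fourier1 (T R) \<xi> - fourier1 (T R') \<xi>))\<^sup>2) \<partial>lborel) \<le> ennreal (t R)" if "R \<le> R'" for R R'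
    using fourier1_trunc_diff[OF L2 that] by (simp add: T_def[abs_def] t_def)
  \<comment> \<open>With tails below 8^-k, the weights 4^k still leave the summable bounds
    2^-k.\<close>
  have "\<exists>N::nat. \<forall>n\<ge>N. t (real n) \<le> (1 / 8) ^ k" for k :: nat
  proof -
    have "(\<lambda>n. t (real n)) \<longlonglongrightarrow> 0"
      using t0 filterlim_real_sequentially by (rule filterlim_compose)
    then have "\<forall>\<^sub>F n in sequentially. t (real n) < (1 / 8) ^ k"
      by (rule order_tendstoD) simp
    then show ?thesis
      by (auto simp: eventually_sequentially intro: less_imp_le)
  qed
  then obtain N :: "nat \<Rightarrow> nat" where N: "\<And>k n. n \<ge> N k \<Longrightarrow> t (real n) \<le> (1 / 8) ^ k"
    by metis
  \<comment> \<open>The partial sum makes \<open>r\<close> monotone and at least \<open>N k\<close>;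
    the added k forces it to infinity.\<close>
  define r where "r k = (\<Sum>i\<le>k. N i) + k" for k
  have rN: "r k \<ge> N k" for k
    unfolding r_def by (simp add: sum.remove[of "{..k}" k])
  have r_Suc: "r k \<le> r (Suc k)" for k by (simp add: r_def)
  have r_ge: "k \<le> r k" for k by (simp add: r_def)
  define F where "F k = fourier1 (T (real (r k)))" for k
  have [measurable]: "F k \<in> borel_measurable borel" for k unfolding F_def by measurable
  define d where "d k \<xi> = norm (F (Suc k) \<xi> - F k \<xi>)" for k \<xi>
  have [measurable]: "d k \<in> borel_measurable borel" for k unfolding d_def[abs_def] by measurable
  have dk: "(\<integral>\<^sup>+\<xi>. ennreal (4 ^ k * (d k \<xi>)\<^sup>2) \<partial>lborel) \<le> ennreal ((1 / 2) ^ k)" for k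
  proof -
    have "(\<integral>\<^sup>+\<xi>. ennreal ((d k \<xi>)\<^sup>2) \<partial>lborel) \<le> ennreal (t (real (r k)))"
      using D[of "real (r k)" "real (r (Suc k))"] r_Suc[of k]
      by (simp add: d_def F_def norm_minus_commute)
    also have "\<dots> \<le> ennreal ((1 / 8) ^ k)"
      by (intro ennreal_leI N rN)
    finally have "ennreal (4 ^ k) * (\<integral>\<^sup>+\<xi>. ennreal ((d k \<xi>)\<^sup>2) \<partial>lborel) \<le> ennreal (4 ^ k) * ennreal ((1 / 8) ^ k)"
      by (rule mult_left_mono) simp
    also have "\<dots> = ennreal ((1 / 2) ^ k)"
      by (simp add: ennreal_mult[symmetric] power_mult_distrib[symmetric])
    also have "ennreal (4 ^ k) * (\<integral>\<^sup>+\<xi>. ennreal ((d k \<xi>)\<^sup>2) \<partial>lborel) = (\<integral>\<^sup>+\<xi>. ennreal (4 ^ k * (d k \<xi>)\<^sup>2) \<partial>lborel)"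
      by (simp add: nn_integral_cmult[symmetric] ennreal_mult)
    finally show ?thesis .
  qed
  have "(\<integral>\<^sup>+\<xi>. (\<Sum>k. ennreal (4 ^ k * (d k \<xi>)\<^sup>2)) \<partial>lborel) = (\<Sum>k. \<integral>\<^sup>+\<xi>. ennreal (4 ^ k * (d k \<xi>)\<^sup>2) \<partial>lborel)"
    by (rule nn_integral_suminf) simp
  also have "\<dots> \<le> (\<Sum>k. ennreal ((1 / 2) ^ k))"
    by (intro suminf_le dk) auto
  also have "\<dots> < \<infinity>"
    by (subst suminf_ennreal2) (auto intro!: summable_geometric)
  finally have "AE \<xi> in lborel. (\<Sum>k. ennreal (4 ^ k * (d k \<xi>)\<^sup>2)) \<noteq> \<infinity>"
    by (intro nn_integral_PInf_AE) auto
  then have conv: "AE \<xi> in lborel. convergent (\<lambda>k. F k \<xi>)"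
  proof eventually_elim
    case (elim \<xi>)
    then have "summable (\<lambda>k. d k \<xi>)"
      by (intro summable_of_ennreal_geometric) (auto simp: d_def less_top[symmetric])
    then have "summable (\<lambda>k. F (Suc k) \<xi> - F k \<xi>)"
      unfolding d_def by (rule summable_norm_cancel)
    then have "convergent (\<lambda>n. \<Sum>k<n. F (Suc k) \<xi> - F k \<xi>)"
      by (simp add: summable_iff_convergent)
    then have "convergent (\<lambda>n. F n \<xi> - F 0 \<xi>)"
      by (simp only: sum_lessThan_telescope[of "\<lambda>k. F k \<xi>"])
    then show ?case
      using convergent_add[OF _ convergent_const[of "F 0 \<xi>"], of "\<lambda>n. F n \<xi> - F 0 \<xi>"] by simp
  qed
  \<comment> \<open>The default 0 is taken on a null set; the set of convergence is measurable
    because it is the set where the sequence is Cauchy.\<close>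
  define H where "H \<xi> = (if convergent (\<lambda>k. F k \<xi>) then lim (\<lambda>k. F k \<xi>) else 0)" for \<xi>
  have [measurable]: "H \<in> borel_measurable borel"
  proof -
    have "Measurable.pred borel (\<lambda>\<xi>. Cauchy (\<lambda>k. F k \<xi>))" by measurable
    then have [measurable]: "Measurable.pred borel (\<lambda>\<xi>. convergent (\<lambda>k. F k \<xi>))"
      by (simp add: Cauchy_convergent_iff)
    show ?thesis unfolding H_def[abs_def] by measurable
  qed
  have lim: "AE \<xi> in lborel. (\<lambda>k. F k \<xi>) \<longlonglongrightarrow> H \<xi>"
    using conv by eventually_elim (simp add: H_def convergent_LIMSEQ_iff)
  have Hb: "(\<integral>\<^sup>+\<xi>. ennreal ((norm (H \<xi>))\<^sup>2) \<partial>lborel) \<le> ennreal ((2 * pi) ^ CARD('n) * (\<integral>x. (norm (h x))\<^sup>2 \<partial>lborel))"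
  proof (rule nn_integral_le_of_tendsto[where u="\<lambda>k \<xi>. ennreal ((norm (F k \<xi>))\<^sup>2)"])
    show "AE \<xi> in lborel. (\<lambda>k. ennreal ((norm (F k \<xi>))\<^sup>2)) \<longlonglongrightarrow> ennreal ((norm (H \<xi>))\<^sup>2)"
      using lim by eventually_elim (auto intro!: tendsto_intros tendsto_ennrealI)
    have "(\<integral>\<^sup>+\<xi>. ennreal ((norm (F k \<xi>))\<^sup>2) \<partial>lborel) \<le> ennreal ((2 * pi) ^ CARD('n) * (\<integral>x. (norm (h x))\<^sup>2 \<partial>lborel))" for k
    proof -
      have "(\<integral>\<^sup>+\<xi>. ennreal ((norm (F k \<xi>))\<^sup>2) \<partial>lborel) \<le> ennreal ((2 * pi) ^ CARD('n) * (\<integral>x. (norm (T (real (r k)) x))\<^sup>2 \<partial>lborel))"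
        unfolding F_def by (intro fourier1_L2_bound T L2_integrable)
      also have "\<dots> \<le> ennreal ((2 * pi) ^ CARD('n) * (\<integral>x. (norm (h x))\<^sup>2 \<partial>lborel))"
        by (intro ennreal_leI mult_left_mono integral_mono T(2)[THEN L2_integrable] L2_integrable[OF L2])
          (auto simp: T_def indicator_def)
      finally show ?thesis .
    qed
    then show "\<forall>\<^sub>F k in sequentially. (\<integral>\<^sup>+\<xi>. ennreal ((norm (F k \<xi>))\<^sup>2) \<partial>lborel) \<le> ennreal ((2 * pi) ^ CARD('n) * (\<integral>x. (norm (h x))\<^sup>2 \<partial>lborel))"
      by simp
  qed simp
  \<comment> \<open>Fatou in the second radius: R is compared with the radii r k, which eventually
    exceed it.\<close>
  have HR: "(\<integral>\<^sup>+\<xi>. ennreal ((norm (fourier1 (T R) \<xi> - H \<xi>))\<^sup>2) \<partial>lborel) \<le> ennreal (t R)" for R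
  proof (rule nn_integral_le_of_tendsto[where u="\<lambda>k \<xi>. ennreal ((norm (fourier1 (T R) \<xi> - F k \<xi>))\<^sup>2)"])
    show "AE \<xi> in lborel. (\<lambda>k. ennreal ((norm (fourier1 (T R) \<xi> - F k \<xi>))\<^sup>2)) \<longlonglongrightarrow> ennreal ((norm (fourier1 (T R) \<xi> - H \<xi>))\<^sup>2)"
      using lim by eventually_elim (auto intro!: tendsto_intros tendsto_ennrealI)
    obtain n :: nat where n: "R \<le> real n" using real_arch_simple by blast
    show "\<forall>\<^sub>F k in sequentially. (\<integral>\<^sup>+\<xi>. ennreal ((norm (fourier1 (T R) \<xi> - F k \<xi>))\<^sup>2) \<partial>lborel) \<le> ennreal (t R)"
      using eventually_ge_at_top[of n]
    proof eventually_elim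
      case (elim k)
      then have "R \<le> real (r k)" using n r_ge[of k] by linarith
      then show ?case unfolding F_def by (rule D)
    qed
  qed simp
  have "fourier_L2 h H"
    unfolding fourier_L2_def
  proof (intro conjI L2)
    show "L2 H"
      unfolding L2_iff_nn_integral using le_less_trans[OF Hb ennreal_less_top] by simp
    have "((\<lambda>R. ennreal (t R)) \<longlongrightarrow> ennreal 0) at_top"
      by (intro tendsto_ennrealI t0)
    then have 1: "((\<lambda>R. ennreal (t R)) \<longlongrightarrow> 0) at_top" by simp
    have 2: "\<forall>\<^sub>F R in at_top. (\<integral>\<^sup>+\<xi>. ennreal ((norm (fourier1 (T R) \<xi> - H \<xi>))\<^sup>2) \<partial>lborel) \<le> ennreal (t R)"
      by (rule always_eventually, rule allI, rule HR)
    have 3: "\<forall>\<^sub>F R in at_top. 0 \<le> (\<integral>\<^sup>+\<xi>. ennreal ((norm (fourier1 (T R) \<xi> - H \<xi>))\<^sup>2) \<partial>lborel)"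
      by (rule always_eventually) simp
    have "((\<lambda>R. \<integral>\<^sup>+\<xi>. ennreal ((norm (fourier1 (T R) \<xi> - H \<xi>))\<^sup>2) \<partial>lborel) \<longlongrightarrow> 0) at_top"
      by (rule tendsto_sandwich[OF 3 2 tendsto_const 1])
    then show "((\<lambda>R. \<integral>\<^sup>+\<xi>. ennreal ((norm (fourier1 (\<lambda>x. indicator (ball 0 R) x *\<^sub>R h x) \<xi> - H \<xi>))\<^sup>2) \<partial>lborel) \<longlongrightarrow> 0) at_top"
      unfolding T_def[abs_def] .
  qed
  with Hb that show thesis by blast
qed

lemma nn_integral_norm_diff_le:
  fixes A B :: "'a \<Rightarrow> 'b::euclidean_space"
  assumes [measurable]: "A \<in> borel_measurable M" "B \<in> borel_measurable M"
  shows "(\<integral>\<^sup>+x. ennreal ((norm (A x - B x))\<^sup>2) \<partial>M)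
    \<le> 2 * (\<integral>\<^sup>+x. ennreal ((norm (A x))\<^sup>2) \<partial>M) + 2 * (\<integral>\<^sup>+x. ennreal ((norm (B x))\<^sup>2) \<partial>M)"
proof -
  have "ennreal ((norm (A x - B x))\<^sup>2) \<le> 2 * ennreal ((norm (A x))\<^sup>2) + 2 * ennreal ((norm (B x))\<^sup>2)" for x
  proof -
    have "ennreal ((norm (A x - B x))\<^sup>2) \<le> ennreal (2 * (norm (A x))\<^sup>2 + 2 * (norm (B x))\<^sup>2)"
      by (intro ennreal_leI norm_diff_power2_le)
    then show ?thesis by (simp add: ennreal_plus ennreal_mult)
  qed
  then have "(\<integral>\<^sup>+x. ennreal ((norm (A x - B x))\<^sup>2) \<partial>M)
    \<le> (\<integral>\<^sup>+x. 2 * ennreal ((norm (A x))\<^sup>2) + 2 * ennreal ((norm (B x))\<^sup>2) \<partial>M)"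
    by (intro nn_integral_mono)
  also have "\<dots> = 2 * (\<integral>\<^sup>+x. ennreal ((norm (A x))\<^sup>2) \<partial>M) + 2 * (\<integral>\<^sup>+x. ennreal ((norm (B x))\<^sup>2) \<partial>M)"
    by (simp add: nn_integral_add nn_integral_cmult)
  finally show ?thesis .
qed

lemma tendsto_nn_integral_norm_diff:
  fixes A B :: "'i \<Rightarrow> 'a \<Rightarrow> 'b::euclidean_space"
  assumes "\<And>i. A i \<in> borel_measurable M" "\<And>i. B i \<in> borel_measurable M"
    and A: "((\<lambda>i. \<integral>\<^sup>+x. ennreal ((norm (A i x))\<^sup>2) \<partial>M) \<longlongrightarrow> 0) F"
    and B: "((\<lambda>i. \<integral>\<^sup>+x. ennreal ((norm (B i x))\<^sup>2) \<partial>M) \<longlongrightarrow> 0) F"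
  shows "((\<lambda>i. \<integral>\<^sup>+x. ennreal ((norm (A i x - B i x))\<^sup>2) \<partial>M) \<longlongrightarrow> 0) F"
proof (rule tendsto_sandwich[OF _ _ tendsto_const])
  have "((\<lambda>i. 2 * (\<integral>\<^sup>+x. ennreal ((norm (A i x))\<^sup>2) \<partial>M) + 2 * (\<integral>\<^sup>+x. ennreal ((norm (B i x))\<^sup>2) \<partial>M)) \<longlongrightarrow> 2 * 0 + 2 * 0) F"
    by (intro tendsto_add ennreal_tendsto_cmult A B) auto
  then show "((\<lambda>i. 2 * (\<integral>\<^sup>+x. ennreal ((norm (A i x))\<^sup>2) \<partial>M) + 2 * (\<integral>\<^sup>+x. ennreal ((norm (B i x))\<^sup>2) \<partial>M)) \<longlongrightarrow> 0) F"
    by simp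
  show "\<forall>\<^sub>F i in F. (\<integral>\<^sup>+x. ennreal ((norm (A i x - B i x))\<^sup>2) \<partial>M)
    \<le> 2 * (\<integral>\<^sup>+x. ennreal ((norm (A i x))\<^sup>2) \<partial>M) + 2 * (\<integral>\<^sup>+x. ennreal ((norm (B i x))\<^sup>2) \<partial>M)"
    by (intro always_eventually allI nn_integral_norm_diff_le assms)
qed simp

lemma AE_eq_of_nn_integral_0:
  fixes A B :: "'a \<Rightarrow> 'b::euclidean_space"
  assumes [measurable]: "A \<in> borel_measurable M" "B \<in> borel_measurable M"
    and 0: "(\<integral>\<^sup>+x. ennreal ((norm (A x - B x))\<^sup>2) \<partial>M) = 0"
  shows "AE x in M. A x = B x"
proof -
  have "AE x in M. ennreal ((norm (A x - B x))\<^sup>2) = 0"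
    using 0 by (subst (asm) nn_integral_0_iff_AE) auto
  then show ?thesis
    by eventually_elim (simp add: ennreal_eq_0_iff)
qed

lemma fourier_L2D:
  assumes "fourier_L2 h H"
  shows "L2 h" "L2 H"
    "((\<lambda>R. \<integral>\<^sup>+\<xi>. ennreal ((norm (fourier1 (\<lambda>x. indicator (ball 0 R) x *\<^sub>R h x) \<xi> - H \<xi>))\<^sup>2) \<partial>lborel) \<longlongrightarrow> 0) at_top"
  using assms by (simp_all add: fourier_L2_def)

lemma fourier_L2_unique:
  fixes h :: "(real, 'n::finite) vec \<Rightarrow> 'm::finite cliff"
  assumes H: "fourier_L2 h H" and K: "fourier_L2 h K"
  shows "AE \<xi> in lborel. H \<xi> = K \<xi>"
proof -
  note [measurable] = L2_measurable[OF fourier_L2D(1)[OF H]] L2_measurable[OF fourier_L2D(2)[OF H]] L2_measurable[OF fourier_L2D(2)[OF K]]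
  let ?F = "\<lambda>R. fourier1 (\<lambda>x. indicator (ball 0 R) x *\<^sub>R h x)"
  \<comment> \<open>The transform of the truncation cancels, so this is a constant in R with limit
    0.\<close>
  have "((\<lambda>R::real. \<integral>\<^sup>+\<xi>. ennreal ((norm ((?F R \<xi> - K \<xi>) - (?F R \<xi> - H \<xi>)))\<^sup>2) \<partial>lborel) \<longlongrightarrow> 0) at_top"
    by (rule tendsto_nn_integral_norm_diff) (auto intro: fourier_L2D(3)[OF K] fourier_L2D(3)[OF H])
  then have "(\<integral>\<^sup>+\<xi>. ennreal ((norm (H \<xi> - K \<xi>))\<^sup>2) \<partial>lborel) = 0"
    by (simp add: tendsto_const_iff)
  then show ?thesis
    by (intro AE_eq_of_nn_integral_0) auto
qed

lemma fourier_L2_bound: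
  fixes h :: "(real, 'n::finite) vec \<Rightarrow> 'm::finite cliff"
  assumes H: "fourier_L2 h H"
  shows "(\<integral>\<^sup>+\<xi>. ennreal ((norm (H \<xi>))\<^sup>2) \<partial>lborel) \<le> ennreal ((2 * pi) ^ CARD('n)) * (\<integral>\<^sup>+x. ennreal ((norm (h x))\<^sup>2) \<partial>lborel)"
proof -
  obtain K where K: "fourier_L2 h K"
    "(\<integral>\<^sup>+\<xi>. ennreal ((norm (K \<xi>))\<^sup>2) \<partial>lborel) \<le> ennreal ((2 * pi) ^ CARD('n) * (\<integral>x. (norm (h x))\<^sup>2 \<partial>lborel))"
    using fourier_L2_exists[OF fourier_L2D(1)[OF H]] by blast
  have "(\<integral>\<^sup>+\<xi>. ennreal ((norm (H \<xi>))\<^sup>2) \<partial>lborel) = (\<integral>\<^sup>+\<xi>. ennreal ((norm (K \<xi>))\<^sup>2) \<partial>lborel)"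
    using fourier_L2_unique[OF H K(1)] by (intro nn_integral_cong_AE) auto
  also note K(2)
  also have "ennreal ((2 * pi) ^ CARD('n) * (\<integral>x. (norm (h x))\<^sup>2 \<partial>lborel))
     = ennreal ((2 * pi) ^ CARD('n)) * (\<integral>\<^sup>+x. ennreal ((norm (h x))\<^sup>2) \<partial>lborel)"
    by (subst nn_integral_eq_integral[OF L2_integrable[OF fourier_L2D(1)[OF H]]]) (auto simp: ennreal_mult)
  finally show ?thesis .
qed

lemma fourier_L2_diff:
  fixes h k :: "(real, 'n::finite) vec \<Rightarrow> 'm::finite cliff"
  assumes H: "fourier_L2 h H" and K: "fourier_L2 k K"
  shows "fourier_L2 (\<lambda>x. h x - k x) (\<lambda>\<xi>. H \<xi> - K \<xi>)"
proof -
  note [measurable] = L2_measurable[OF fourier_L2D(1)[OF H]] L2_measurable[OF fourier_L2D(2)[OF H]]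
    L2_measurable[OF fourier_L2D(1)[OF K]] L2_measurable[OF fourier_L2D(2)[OF K]]
  let ?T = "\<lambda>h R x. indicator (ball 0 R) x *\<^sub>R h x"
  have "fourier1 (?T (\<lambda>x. h x - k x) R) \<xi> = fourier1 (?T h R) \<xi> - fourier1 (?T k R) \<xi>" for R \<xi>
    unfolding scaleR_diff_right
    by (intro fourier1_diff L2_truncate fourier_L2D(1)[OF H] fourier_L2D(1)[OF K])
  then have e: "fourier1 (?T (\<lambda>x. h x - k x) R) \<xi> - (H \<xi> - K \<xi>) = (fourier1 (?T h R) \<xi> - H \<xi>) - (fourier1 (?T k R) \<xi> - K \<xi>)" for R \<xi>
    by simp
  have "((\<lambda>R::real. \<integral>\<^sup>+\<xi>. ennreal ((norm ((fourier1 (?T h R) \<xi> - H \<xi>) - (fourier1 (?T k R) \<xi> - K \<xi>)))\<^sup>2) \<partial>lborel) \<longlongrightarrow> 0) at_top"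
    by (rule tendsto_nn_integral_norm_diff) (auto intro: fourier_L2D(3)[OF K] fourier_L2D(3)[OF H])
  then show ?thesis
    unfolding fourier_L2_def e
    by (intro conjI L2_diff fourier_L2D(1,2)[OF H] fourier_L2D(1,2)[OF K])
qed

section \<open>Parseval's formula and pointwise inversion\<close>

lemma Cauchy_Schwarz_integral:
  fixes f g :: "'a \<Rightarrow> real"
  assumes [measurable]: "f \<in> borel_measurable M" "g \<in> borel_measurable M"
    and f: "integrable M (\<lambda>x. (f x)\<^sup>2)" and g: "integrable M (\<lambda>x. (g x)\<^sup>2)"
  shows "integrable M (\<lambda>x. f x * g x)"
    and "(\<integral>x. \<bar>f x * g x\<bar> \<partial>M) \<le> sqrt (\<integral>x. (f x)\<^sup>2 \<partial>M) * sqrt (\<integral>x. (g x)\<^sup>2 \<partial>M)"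
proof -
  have "integrable M (\<lambda>x. (f x)\<^sup>2 + (g x)\<^sup>2)" using f g by simp
  then show i: "integrable M (\<lambda>x. f x * g x)"
  proof (rule Bochner_Integration.integrable_bound)
    have "\<bar>a * b\<bar> \<le> a\<^sup>2 + b\<^sup>2" for a b :: real
    proof -
      have "2 * (\<bar>a\<bar> * \<bar>b\<bar>) \<le> a\<^sup>2 + b\<^sup>2"
        using sum_squares_bound[of "\<bar>a\<bar>" "\<bar>b\<bar>"] by simp
      moreover have "0 \<le> \<bar>a\<bar> * \<bar>b\<bar>" by simp
      ultimately show ?thesis unfolding abs_mult by linarith
    qed
    then show "AE x in M. norm (f x * g x) \<le> norm ((f x)\<^sup>2 + (g x)\<^sup>2)"
      by (auto simp: abs_of_nonneg)
  qed simp
  have "(ennreal (\<integral>x. \<bar>f x * g x\<bar> \<partial>M))\<^sup>2 = (\<integral>\<^sup>+x. ennreal \<bar>f x\<bar> * ennreal \<bar>g x\<bar> \<partial>M)\<^sup>2"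
    using integrable_abs[OF i] by (subst nn_integral_eq_integral[symmetric]) (auto simp: abs_mult ennreal_mult)
  also have "\<dots> \<le> (\<integral>\<^sup>+x. (ennreal \<bar>f x\<bar>)\<^sup>2 \<partial>M) * (\<integral>\<^sup>+x. (ennreal \<bar>g x\<bar>)\<^sup>2 \<partial>M)"
    by (rule Cauchy_Schwarz_nn_integral) auto
  also have "\<dots> = ennreal (\<integral>x. (f x)\<^sup>2 \<partial>M) * ennreal (\<integral>x. (g x)\<^sup>2 \<partial>M)"
    using f g by (simp add: ennreal_power nn_integral_eq_integral)
  finally have "(\<integral>x. \<bar>f x * g x\<bar> \<partial>M)\<^sup>2 \<le> (\<integral>x. (f x)\<^sup>2 \<partial>M) * (\<integral>x. (g x)\<^sup>2 \<partial>M)"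
    by (simp add: ennreal_power ennreal_mult[symmetric] ennreal_le_iff)
  then show "(\<integral>x. \<bar>f x * g x\<bar> \<partial>M) \<le> sqrt (\<integral>x. (f x)\<^sup>2 \<partial>M) * sqrt (\<integral>x. (g x)\<^sup>2 \<partial>M)"
    unfolding real_sqrt_mult[symmetric] by (rule real_le_rsqrt)
qed

lemma norm_cl_mult_bound: obtains K where "K > 0" "\<And>a b. norm (a \<odot> b) \<le> K * (norm a * norm b)"
  using cl.pos_bounded by (metis mult.commute)

lemma L2_cl_mult:
  fixes u v :: "(real, 'n::finite) vec \<Rightarrow> 'm::{finite,linorder} cliff"
  assumes u: "L2 u" and v: "L2 v"
  shows "integrable lborel (\<lambda>x. norm (u x) * norm (v x))" and "integrable lborel (\<lambda>x. u x \<odot> v x)"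
proof -
  note [measurable] = L2_measurable[OF u] L2_measurable[OF v]
  show i: "integrable lborel (\<lambda>x. norm (u x) * norm (v x))"
    by (rule Cauchy_Schwarz_integral(1)) (auto intro: L2_integrable u v)
  obtain K where K: "K > 0" "\<And>a b. norm (a \<odot> b) \<le> K * (norm a * norm (b::'m cliff))"
    using norm_cl_mult_bound by blast
  have "integrable lborel (\<lambda>x. K * (norm (u x) * norm (v x)))"
    using i by simp
  then show "integrable lborel (\<lambda>x. u x \<odot> v x)"
    by (rule Bochner_Integration.integrable_bound) (auto intro!: AE_I2 order_trans[OF K(2) abs_ge_self])
qed

lemma L2_fourier1:
  assumes "integrable lborel b" "L2 b"
  shows "L2 (fourier1 b)"
  unfolding L2_iff_nn_integral
  using fourier1_L2_bound[OF assms(1) L2_integrable[OF assms(2)]] fourier1_measurable[OF L2_measurable[OF assms(2)]]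
  by (simp add: le_less_trans[OF _ ennreal_less_top])

text \<open>Fubini for the symmetric phase exp (- i <x, \<xi>>). No conjugate is involved, so the
  Clifford factors keep their order.\<close>

lemma fourier1_exchange:
  fixes b h :: "(real, 'n::finite) vec \<Rightarrow> 'm::{finite,linorder} cliff"
  assumes b: "integrable lborel b" and h: "integrable lborel h"
  shows "(\<integral>x. fourier1 b x \<odot> h x \<partial>lborel) = (\<integral>\<xi>. b \<xi> \<odot> fourier1 h \<xi> \<partial>lborel)"
proof -
  have [measurable]: "b \<in> borel_measurable borel" "h \<in> borel_measurable borel"
    using borel_measurable_integrable[OF b] borel_measurable_integrable[OF h] by simp_all
  let ?f = "\<lambda>\<xi> x. exp (- \<i> * of_real (x \<bullet> \<xi>)) *s (b \<xi> \<odot> h x)"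
  obtain K where K: "K > 0" "\<And>a b. norm (a \<odot> b) \<le> K * (norm a * norm (b::'m cliff))"
    using norm_cl_mult_bound by blast
  have i: "integrable (lborel \<Otimes>\<^sub>M lborel) (\<lambda>(\<xi>, x). ?f \<xi> x)"
  proof (rule Bochner_Integration.integrable_bound)
    show "integrable (lborel \<Otimes>\<^sub>M lborel) (\<lambda>(\<xi>, x). K * norm (b \<xi>) * norm (h x))"
      by (rule integrable_lborel_tensor) (use b h in auto)
    show "AE p in lborel \<Otimes>\<^sub>M lborel. norm (case p of (\<xi>, x) \<Rightarrow> ?f \<xi> x) \<le> norm (case p of (\<xi>, x) \<Rightarrow> K * norm (b \<xi>) * norm (h x))"
      using K by (auto simp: abs_mult mult.assoc)
  qed (unfold lborel_prod case_prod_beta', measurable)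
  have "(\<integral>x. fourier1 b x \<odot> h x \<partial>lborel) = (\<integral>x. (\<integral>\<xi>. ?f \<xi> x \<partial>lborel) \<partial>lborel)"
  proof (rule Bochner_Integration.integral_cong[OF refl])
    fix x
    have "fourier1 b x \<odot> h x = (\<integral>\<xi>. (exp (- \<i> * of_real (\<xi> \<bullet> x)) *s b \<xi>) \<odot> h x \<partial>lborel)"
      unfolding fourier1_def
      by (rule integral_bounded_linear[OF cl.bounded_linear_left integrable_phase[OF b], symmetric])
    then show "fourier1 b x \<odot> h x = (\<integral>\<xi>. ?f \<xi> x \<partial>lborel)"
      by (simp add: cl_mult_scale inner_commute)
  qed
  also have "\<dots> = (\<integral>\<xi>. (\<integral>x. ?f \<xi> x \<partial>lborel) \<partial>lborel)"
    by (rule lborel_pair.Fubini_integral[OF i])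
  also have "\<dots> = (\<integral>\<xi>. b \<xi> \<odot> fourier1 h \<xi> \<partial>lborel)"
  proof (rule Bochner_Integration.integral_cong[OF refl])
    fix \<xi>
    have "b \<xi> \<odot> fourier1 h \<xi> = (\<integral>x. b \<xi> \<odot> (exp (- \<i> * of_real (x \<bullet> \<xi>)) *s h x) \<partial>lborel)"
      unfolding fourier1_def
      by (rule integral_bounded_linear[OF cl.bounded_linear_right integrable_phase[OF h], symmetric])
    then show "(\<integral>x. ?f \<xi> x \<partial>lborel) = b \<xi> \<odot> fourier1 h \<xi>"
      by (simp add: cl_mult_scale)
  qed
  finally show ?thesis .
qed

text \<open>Truncating \<open>h\<close> reduces to integrable functions. In the space integral the
  truncations converge dominatedly; in the spectral integral the transforms converge only in L2, and
  Cauchy-Schwarz against \<open>b\<close> takes over.\<close>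

lemma fourier_parseval:
  fixes b h :: "(real, 'n::finite) vec \<Rightarrow> 'm::{finite,linorder} cliff"
  assumes b: "integrable lborel b" "L2 b" and H: "fourier_L2 h H"
  shows "(\<integral>x. fourier1 b x \<odot> h x \<partial>lborel) = (\<integral>\<xi>. b \<xi> \<odot> H \<xi> \<partial>lborel)"
proof -
  note hL2 = fourier_L2D(1)[OF H] and HL2 = fourier_L2D(2)[OF H]
  note [measurable] = L2_measurable[OF b(2)] L2_measurable[OF hL2] L2_measurable[OF HL2]
  define T where "T n x = indicator (ball 0 (real n)) x *\<^sub>R h x" for n x
  have T: "integrable lborel (T n)" "L2 (T n)" for n
    using L2_truncate[OF hL2] by (simp_all add: T_def[abs_def])
  note [measurable] = L2_measurable[OF T(2)]
  have FT: "L2 (fourier1 (T n))" for n by (rule L2_fourier1[OF T])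
  obtain K where K: "K > 0" "\<And>a b. norm (a \<odot> b) \<le> K * (norm a * norm (b::'m cliff))"
    using norm_cl_mult_bound by blast
  have 1: "(\<lambda>n. \<integral>x. fourier1 b x \<odot> T n x \<partial>lborel) \<longlonglongrightarrow> (\<integral>x. fourier1 b x \<odot> h x \<partial>lborel)"
  proof (rule integral_dominated_convergence[where w="\<lambda>x. K * (norm (fourier1 b x) * norm (h x))"])
    show "integrable lborel (\<lambda>x. K * (norm (fourier1 b x) * norm (h x)))"
      using L2_cl_mult(1)[OF L2_fourier1[OF b] hL2] by simp
    show "AE x in lborel. (\<lambda>n. fourier1 b x \<odot> T n x) \<longlonglongrightarrow> fourier1 b x \<odot> h x"
    proof (rule AE_I2)
      fix x :: "(real, 'n) vec"
      obtain N :: nat where "norm x < real N" using reals_Archimedean2 by blast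
      then have "\<forall>\<^sub>F n in sequentially. fourier1 b x \<odot> T n x = fourier1 b x \<odot> h x"
        by (intro eventually_sequentiallyI[of N]) (auto simp: T_def indicator_def)
      then show "(\<lambda>n. fourier1 b x \<odot> T n x) \<longlonglongrightarrow> fourier1 b x \<odot> h x"
        by (rule tendsto_eventually)
    qed
    show "AE x in lborel. norm (fourier1 b x \<odot> T n x) \<le> K * (norm (fourier1 b x) * norm (h x))" for n
      using K by (intro AE_I2 order_trans[OF K(2)]) (auto simp: T_def indicator_def intro!: mult_left_mono)
  qed measurable
  have 2: "(\<lambda>n. \<integral>\<xi>. b \<xi> \<odot> fourier1 (T n) \<xi> \<partial>lborel) \<longlonglongrightarrow> (\<integral>\<xi>. b \<xi> \<odot> H \<xi> \<partial>lborel)"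
  proof (rule Lim_transform2)
    let ?d = "\<lambda>n. \<integral>\<xi>. (norm (fourier1 (T n) \<xi> - H \<xi>))\<^sup>2 \<partial>lborel"
    have dL: "L2 (\<lambda>\<xi>. fourier1 (T n) \<xi> - H \<xi>)" for n by (rule L2_diff[OF FT HL2])
    have "(\<lambda>n. ennreal (?d n)) \<longlonglongrightarrow> 0"
    proof -
      have "(\<lambda>x. indicator (ball 0 (real n)) x *\<^sub>R h x) = T n" for n
        by (simp add: T_def[abs_def])
      moreover have "(\<integral>\<^sup>+\<xi>. ennreal ((norm (fourier1 (T n) \<xi> - H \<xi>))\<^sup>2) \<partial>lborel) = ennreal (?d n)" for n
        by (rule nn_integral_eq_integral[OF L2_integrable[OF dL]]) simp
      ultimately show ?thesis
        using filterlim_compose[OF fourier_L2D(3)[OF H] filterlim_real_sequentially] by simp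
    qed
    then have d: "?d \<longlonglongrightarrow> 0"
      by (subst (asm) ennreal_0[symmetric], subst (asm) tendsto_ennreal_iff) auto
    show "(\<lambda>n. (\<integral>\<xi>. b \<xi> \<odot> H \<xi> \<partial>lborel) - (\<integral>\<xi>. b \<xi> \<odot> fourier1 (T n) \<xi> \<partial>lborel)) \<longlonglongrightarrow> 0"
    proof (rule Lim_null_comparison)
      have "(\<lambda>n. K * (sqrt (\<integral>\<xi>. (norm (b \<xi>))\<^sup>2 \<partial>lborel) * sqrt (?d n))) \<longlonglongrightarrow> K * (sqrt (\<integral>\<xi>. (norm (b \<xi>))\<^sup>2 \<partial>lborel) * sqrt 0)"
        by (intro tendsto_intros d)
      then show "(\<lambda>n. K * (sqrt (\<integral>\<xi>. (norm (b \<xi>))\<^sup>2 \<partial>lborel) * sqrt (?d n))) \<longlonglongrightarrow> 0" by simp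
      have "norm ((\<integral>\<xi>. b \<xi> \<odot> H \<xi> \<partial>lborel) - (\<integral>\<xi>. b \<xi> \<odot> fourier1 (T n) \<xi> \<partial>lborel))
        \<le> K * (sqrt (\<integral>\<xi>. (norm (b \<xi>))\<^sup>2 \<partial>lborel) * sqrt (?d n))" for n
      proof -
        have "(\<integral>\<xi>. b \<xi> \<odot> H \<xi> \<partial>lborel) - (\<integral>\<xi>. b \<xi> \<odot> fourier1 (T n) \<xi> \<partial>lborel) = (\<integral>\<xi>. b \<xi> \<odot> (H \<xi> - fourier1 (T n) \<xi>) \<partial>lborel)"
          unfolding cl.diff_right by (intro Bochner_Integration.integral_diff[symmetric] L2_cl_mult b HL2 FT)
        also have "norm \<dots> \<le> (\<integral>\<xi>. norm (b \<xi> \<odot> (H \<xi> - fourier1 (T n) \<xi>)) \<partial>lborel)"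
          by (rule integral_norm_bound)
        also have "\<dots> \<le> (\<integral>\<xi>. K * \<bar>norm (b \<xi>) * norm (fourier1 (T n) \<xi> - H \<xi>)\<bar> \<partial>lborel)"
        proof (rule integral_mono)
          show "integrable lborel (\<lambda>\<xi>. norm (b \<xi> \<odot> (H \<xi> - fourier1 (T n) \<xi>)))"
            by (intro integrable_norm L2_cl_mult b L2_diff HL2 FT)
          show "integrable lborel (\<lambda>\<xi>. K * \<bar>norm (b \<xi>) * norm (fourier1 (T n) \<xi> - H \<xi>)\<bar>)"
            using L2_cl_mult(1)[OF b(2) dL] by simp
          show "norm (b \<xi> \<odot> (H \<xi> - fourier1 (T n) \<xi>)) \<le> K * \<bar>norm (b \<xi>) * norm (fourier1 (T n) \<xi> - H \<xi>)\<bar>" for \<xi>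
            using K(2)[of "b \<xi>" "H \<xi> - fourier1 (T n) \<xi>"] by (simp add: norm_minus_commute)
        qed
        also have "\<dots> = K * (\<integral>\<xi>. \<bar>norm (b \<xi>) * norm (fourier1 (T n) \<xi> - H \<xi>)\<bar> \<partial>lborel)"
          by (rule integral_mult_right_zero)
        also have "\<dots> \<le> K * (sqrt (\<integral>\<xi>. (norm (b \<xi>))\<^sup>2 \<partial>lborel) * sqrt (?d n))"
          using K(1) by (intro mult_left_mono Cauchy_Schwarz_integral(2) L2_integrable b dL) auto
        finally show ?thesis .
      qed
      then show "\<forall>\<^sub>F n in sequentially. norm ((\<integral>\<xi>. b \<xi> \<odot> H \<xi> \<partial>lborel) - (\<integral>\<xi>. b \<xi> \<odot> fourier1 (T n) \<xi> \<partial>lborel))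
        \<le> K * (sqrt (\<integral>\<xi>. (norm (b \<xi>))\<^sup>2 \<partial>lborel) * sqrt (?d n))" by simp
    qed
  qed simp
  show ?thesis
    using LIMSEQ_unique[OF 1[unfolded fourier1_exchange[OF b(1) T(1)]] 2] .
qed

text \<open>For continuous \<open>h\<close> the approximate identity converges pointwise, although \<open>h\<close> need not be
  bounded: away from the center the Gaussian is small in the supremum norm, which pairs with
  \<open>|h| \<le> 1 + |h|\<^sup>2\<close>.\<close>
lemma gauss_approximate_identity:
  fixes h :: "(real, 'n::finite) vec \<Rightarrow> 'm::finite cliff"
  assumes L2: "L2 h" and cont: "isCont h x"
  defines "G \<equiv> \<lambda>k z::(real, 'n) vec. (sqrt (2 * pi) * real (Suc k)) ^ CARD('n) * exp (- (real (Suc k))\<^sup>2 * (norm z)\<^sup>2 / 2)"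
  shows "(\<lambda>k. \<integral>y. G k (y - x) *\<^sub>R h y \<partial>lborel) \<longlonglongrightarrow> (2 * pi) ^ CARD('n) *\<^sub>R h x"
proof -
  note [measurable] = L2_measurable[OF L2]
  have [measurable]: "G k \<in> borel_measurable borel" for k unfolding G_def by measurable
  have G0: "G k z \<ge> 0" for k z by (simp add: G_def)
  have gi: "integrable lborel (\<lambda>y. u (y - x))" if "integrable lborel u" for u :: "(real, 'n) vec \<Rightarrow> real"
    using integral_lborel_shift(2)[of u "- x"] that borel_measurable_integrable[OF that] by simp
  have Gi: "integrable lborel (G k)" for k
    unfolding G_def using gauss_integral(1)[of "(real (Suc k))\<^sup>2", where 'a="(real, 'n) vec"] by simp
  have GI: "(\<integral>y. G k (y - x) \<partial>lborel) = (2 * pi) ^ CARD('n)" for k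
  proof -
    have "(\<integral>y. G k (y - x) \<partial>lborel) = (\<integral>z. G k z \<partial>lborel)"
      using integral_lborel_shift(1)[of "G k" "- x"] by simp
    also have "\<dots> = (sqrt (2 * pi) * real (Suc k)) ^ CARD('n) * sqrt (2 * pi / (real (Suc k))\<^sup>2) ^ CARD('n)"
      unfolding G_def using gauss_integral(2)[of "(real (Suc k))\<^sup>2", where 'a="(real, 'n) vec"] 
      by (simp only: integral_mult_right_zero DIM_cart DIM_real mult_1_right) simp
    also have "sqrt (2 * pi) * real (Suc k) * sqrt (2 * pi / (real (Suc k))\<^sup>2) = 2 * pi"
    proof -
      have "sqrt (2 * pi / (real (Suc k))\<^sup>2) = sqrt (2 * pi) / real (Suc k)"
        by (simp add: real_sqrt_divide)
      then show ?thesis by (simp del: of_nat_Suc add: real_sqrt_mult[symmetric])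
    qed
    then have "(sqrt (2 * pi) * real (Suc k)) ^ CARD('n) * sqrt (2 * pi / (real (Suc k))\<^sup>2) ^ CARD('n) = (2 * pi) ^ CARD('n)"
      by (simp only: power_mult_distrib[symmetric])
    finally show ?thesis .
  qed
  let ?s = "\<lambda>k. (sqrt (2 * pi) * real (Suc k)) ^ CARD('n)"
  have s0: "?s k \<ge> 0" for k by simp
  have le1: "t \<le> 1 + t\<^sup>2" for t :: real
    using sum_squares_bound[of t 1] by (smt (verit) zero_le_power2 power2_eq_square mult_1 one_power2)
  have Ghi: "integrable lborel (\<lambda>y. G k (y - x) *\<^sub>R h y)" for k
  proof (rule Bochner_Integration.integrable_bound)
    show "integrable lborel (\<lambda>y. G k (y - x) + ?s k * (norm (h y))\<^sup>2)"
      using gi[OF Gi] L2_integrable[OF L2] by simp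
    show "AE y in lborel. norm (G k (y - x) *\<^sub>R h y) \<le> norm (G k (y - x) + ?s k * (norm (h y))\<^sup>2)"
    proof (rule AE_I2)
      fix y
      have "G k (y - x) * norm (h y) \<le> G k (y - x) * (1 + (norm (h y))\<^sup>2)"
        by (intro mult_left_mono le1 G0)
      also have "\<dots> \<le> G k (y - x) + ?s k * (norm (h y))\<^sup>2"
      proof -
        have "G k (y - x) \<le> ?s k * 1"
          unfolding G_def by (intro mult_left_mono) auto
        then show ?thesis by (simp add: ring_distribs mult_right_mono)
      qed
      finally show "norm (G k (y - x) *\<^sub>R h y) \<le> norm (G k (y - x) + ?s k * (norm (h y))\<^sup>2)"
        using G0 by simp
    qed
  qed simp
  show ?thesis
  proof (rule tendstoI)
    fix e :: real assume "e > 0"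
    \<comment> \<open>The kernel has total mass (2 pi)^m, so the part near the center contributes at
      most e / 2.\<close>
    define \<eta> where "\<eta> = e / (2 * (2 * pi) ^ CARD('n))"
    have "\<eta> > 0" using \<open>e > 0\<close> by (simp add: \<eta>_def)
    then obtain \<delta> where \<delta>: "\<delta> > 0" "\<And>y. norm (y - x) < \<delta> \<Longrightarrow> norm (h y - h x) < \<eta>"
      using cont unfolding continuous_at_eps_delta dist_norm by metis
    \<comment> \<open>With n = Suc k and z the distance to the center, z \<ge> \<delta> gives n^2
      z^2 / 2 \<ge> n \<delta>^2 / 4 + z^2 / 4. The first summand beats the polynomial factor and
      sends \<open>q\<close> to 0; the second leaves a fixed integrable Gaussian, independent of
      k.\<close>
    define q where "q k = ?s k * exp (- (\<delta>\<^sup>2 / 4) * real (Suc k))" for k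
    define D where "D = (\<integral>y. (norm (h x) + 1) * exp (- (1 / 2) * (norm (y - x))\<^sup>2 / 2) + (norm (h y))\<^sup>2 \<partial>lborel)"
    have Di: "integrable lborel (\<lambda>y. (norm (h x) + 1) * exp (- (1 / 2) * (norm (y - x))\<^sup>2 / 2) + (norm (h y))\<^sup>2)"
      using gi[OF gauss_integral(1)[of "1/2"]] L2_integrable[OF L2] by simp
    have q0: "q \<longlonglongrightarrow> 0"
    proof -
      let ?c = "\<delta>\<^sup>2 / 4"
      have c: "?c > 0" using \<delta>(1) by simp
      have "filterlim (\<lambda>k. ?c * real (Suc k)) at_top sequentially"
        by (intro filterlim_tendsto_pos_mult_at_top[OF tendsto_const c] filterlim_compose[OF filterlim_real_sequentially] filterlim_Suc)
      from filterlim_compose[OF tendsto_power_div_exp_0[of "CARD('n)"] this]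
      have "(\<lambda>k. (sqrt (2 * pi) / ?c) ^ CARD('n) * ((?c * real (Suc k)) ^ CARD('n) / exp (?c * real (Suc k)))) \<longlonglongrightarrow> (sqrt (2 * pi) / ?c) ^ CARD('n) * 0"
        by (intro tendsto_mult tendsto_const)
      moreover have "(sqrt (2 * pi) / ?c) ^ CARD('n) * ((?c * real (Suc k)) ^ CARD('n) / exp (?c * real (Suc k))) = q k" for k
        using \<delta>(1) unfolding q_def by (simp add: exp_minus power_mult_distrib power_divide field_simps del: of_nat_Suc)
      ultimately show ?thesis by simp
    qed
    have key: "norm ((\<integral>y. G k (y - x) *\<^sub>R h y \<partial>lborel) - (2 * pi) ^ CARD('n) *\<^sub>R h x) \<le> e / 2 + q k * D" for k
    proof -
      have hx: "integrable lborel (\<lambda>y. G k (y - x) *\<^sub>R h x)"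
        by (intro integrable_scaleR_left gi Gi)
      have "(\<integral>y. G k (y - x) *\<^sub>R h y \<partial>lborel) - (2 * pi) ^ CARD('n) *\<^sub>R h x = (\<integral>y. G k (y - x) *\<^sub>R (h y - h x) \<partial>lborel)"
        unfolding scaleR_diff_right
        by (subst Bochner_Integration.integral_diff[OF Ghi hx]) (simp only: integral_scaleR_left[OF gi[OF Gi[of k]]] GI)
      also have "norm \<dots> \<le> (\<integral>y. \<eta> * G k (y - x) + q k * ((norm (h x) + 1) * exp (- (1 / 2) * (norm (y - x))\<^sup>2 / 2) + (norm (h y))\<^sup>2) \<partial>lborel)"
      proof (rule Bochner_Integration.integral_norm_bound_integral)
        show "integrable lborel (\<lambda>y. G k (y - x) *\<^sub>R (h y - h x))"
          unfolding scaleR_diff_right by (rule Bochner_Integration.integrable_diff[OF Ghi hx])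
        show "integrable lborel (\<lambda>y. \<eta> * G k (y - x) + q k * ((norm (h x) + 1) * exp (- (1 / 2) * (norm (y - x))\<^sup>2 / 2) + (norm (h y))\<^sup>2))"
          by (intro Bochner_Integration.integrable_add integrable_mult_right gi Gi Di)
        fix y
        have r0: "0 \<le> q k * ((norm (h x) + 1) * exp (- (1 / 2) * (norm (y - x))\<^sup>2 / 2) + (norm (h y))\<^sup>2)"
          by (simp add: q_def)
        show "norm (G k (y - x) *\<^sub>R (h y - h x)) \<le> \<eta> * G k (y - x) + q k * ((norm (h x) + 1) * exp (- (1 / 2) * (norm (y - x))\<^sup>2 / 2) + (norm (h y))\<^sup>2)"
        proof (cases "norm (y - x) < \<delta>")
          case True
          have "G k (y - x) * norm (h y - h x) \<le> G k (y - x) * \<eta>"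
            using \<delta>(2)[OF True] by (intro mult_left_mono G0) simp
          then show ?thesis using r0 G0[of k "y - x"] by (simp add: mult.commute)
        next
          case False
          let ?z = "norm (y - x)" and ?n = "real (Suc k)" and ?E = "exp (- (1 / 2) * (norm (y - x))\<^sup>2 / 2)"
          have "\<delta>\<^sup>2 \<le> ?z\<^sup>2" using False \<delta>(1) by (intro power_mono) auto
          moreover have "?n \<le> ?n\<^sup>2" "1 \<le> ?n\<^sup>2"
            by (rule self_le_power, simp, simp) (rule one_le_power, simp)
          ultimately have "?n * \<delta>\<^sup>2 + 1 * ?z\<^sup>2 \<le> ?n\<^sup>2 * ?z\<^sup>2 + ?n\<^sup>2 * ?z\<^sup>2"
            by (intro add_mono mult_mono) auto
          then have "exp (- ?n\<^sup>2 * ?z\<^sup>2 / 2) \<le> exp (- (\<delta>\<^sup>2 / 4) * ?n + (- (1 / 2) * ?z\<^sup>2 / 2))"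
            unfolding exp_le_cancel_iff by (simp add: field_simps)
          then have "G k (y - x) \<le> q k * ?E"
            unfolding G_def q_def exp_add mult.assoc by (intro mult_left_mono s0)
          moreover have "norm (h y - h x) \<le> (norm (h x) + 1) + (norm (h y))\<^sup>2"
            using norm_triangle_ineq4[of "h y" "h x"] le1[of "norm (h y)"] by linarith
          ultimately have "G k (y - x) * norm (h y - h x) \<le> (q k * ?E) * ((norm (h x) + 1) + (norm (h y))\<^sup>2)"
            by (intro mult_mono) (auto simp: q_def)
          also have "\<dots> \<le> q k * ((norm (h x) + 1) * ?E + (norm (h y))\<^sup>2)"
          proof -
            have "?E * (norm (h y))\<^sup>2 \<le> 1 * (norm (h y))\<^sup>2" by (intro mult_right_mono) auto
            then have "?E * ((norm (h x) + 1) + (norm (h y))\<^sup>2) \<le> (norm (h x) + 1) * ?E + (norm (h y))\<^sup>2"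
              by (simp add: algebra_simps)
            then show ?thesis unfolding mult.assoc by (intro mult_left_mono) (auto simp: q_def)
          qed
          finally show ?thesis using G0[of k "y - x"] \<open>\<eta> > 0\<close> by (simp add: add_increasing)
        qed
      qed
      also have "\<dots> = \<eta> * (2 * pi) ^ CARD('n) + q k * D"
        unfolding D_def
        by (subst Bochner_Integration.integral_add)
          (rule integrable_mult_right[OF gi[OF Gi]], rule integrable_mult_right[OF Di],
            simp only: integral_mult_right_zero GI)
      also have "\<eta> * (2 * pi) ^ CARD('n) = e / 2" by (simp add: \<eta>_def)
      finally show ?thesis .
    qed
    have "(\<lambda>k. q k * D) \<longlonglongrightarrow> 0 * D" by (intro tendsto_intros q0)
    then have "\<forall>\<^sub>F k in sequentially. q k * D < e / 2"
      using \<open>e > 0\<close> by (intro order_tendstoD(2)) auto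
    then show "\<forall>\<^sub>F k in sequentially. dist (\<integral>y. G k (y - x) *\<^sub>R h y \<partial>lborel) ((2 * pi) ^ CARD('n) *\<^sub>R h x) < e"
    proof eventually_elim
      case (elim k)
      with key[of k] show ?case unfolding dist_norm by linarith
    qed
  qed
qed

text \<open>Parseval against a Gaussian modulated by exp (i <x, \<xi>>) has the approximate identity
  at x on one side and the damped inversion integral on the other. As the damping disappears,
  continuity of \<open>h\<close> at x settles the first limit and integrability of \<open>H\<close>
  the second.\<close>

lemma fourier_inversion:
  fixes h :: "(real, 'n::finite) vec \<Rightarrow> 'm::{finite,linorder} cliff"
  assumes H: "fourier_L2 h H" and Hi: "integrable lborel H" and cont: "isCont h x"
  shows "(2 * pi) ^ CARD('n) *\<^sub>R h x = (\<integral>\<xi>. exp (\<i> * of_real (x \<bullet> \<xi>)) *s H \<xi> \<partial>lborel)"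
proof -
  note [measurable] = L2_measurable[OF fourier_L2D(2)[OF H]]
  \<comment> \<open>The parameter 1 / (Suc k)^2 is the one whose transform is the kernel of
    \<open>gauss_approximate_identity\<close>.\<close>
  let ?g = "\<lambda>k \<xi>::(real, 'n) vec. exp (- (1 / (real (Suc k))\<^sup>2) * (norm \<xi>)\<^sup>2 / 2)"
  let ?b = "\<lambda>k \<xi>. (exp (\<i> * of_real (x \<bullet> \<xi>)) * of_real (?g k \<xi>)) *s (cl_one :: 'm cliff)"
  have gi: "integrable lborel (?g k)" for k
    using gauss_integral(1)[of "1 / (real (Suc k))\<^sup>2", where 'a="(real, 'n) vec"] by simp
  have bi: "integrable lborel (?b k)" for k
    by (rule Bochner_Integration.integrable_bound[OF gi[of k]]) (auto simp: norm_mult)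
  have bL2: "L2 (?b k)" for k
  proof -
    have "integrable lborel (\<lambda>\<xi>. (norm (?b k \<xi>))\<^sup>2)"
    proof (rule Bochner_Integration.integrable_bound[OF gi[of k]])
      show "AE \<xi> in lborel. norm ((norm (?b k \<xi>))\<^sup>2) \<le> norm (?g k \<xi>)"
      proof (rule AE_I2)
        fix \<xi>
        have "norm (?b k \<xi>) = ?g k \<xi>" by (simp add: norm_mult)
        moreover have "?g k \<xi> * ?g k \<xi> \<le> ?g k \<xi>" by (rule mult_left_le) auto
        ultimately show "norm ((norm (?b k \<xi>))\<^sup>2) \<le> norm (?g k \<xi>)"
          by (simp only: power2_eq_square real_norm_def abs_mult abs_norm_cancel abs_exp_cancel)
      qed
    qed simp
    then show ?thesis by (simp add: L2_def)
  qed
  have fb: "fourier1 (?b k) y = ((sqrt (2 * pi) * real (Suc k)) ^ CARD('n) * exp (- (real (Suc k))\<^sup>2 * (norm (y - x))\<^sup>2 / 2)) *\<^sub>R cl_one" for k y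
  proof -
    have "exp (- \<i> * of_real (\<xi> \<bullet> y)) *s ?b k \<xi> = (exp (- \<i> * of_real ((y - x) \<bullet> \<xi>)) * of_real (?g k \<xi>)) *s cl_one" for \<xi>
    proof -
      have "exp (- \<i> * of_real (\<xi> \<bullet> y)) * exp (\<i> * of_real (x \<bullet> \<xi>)) = exp (- \<i> * of_real ((y - x) \<bullet> \<xi>))"
        unfolding exp_add[symmetric] by (simp add: inner_diff_left inner_commute algebra_simps)
      then show ?thesis unfolding vector_smult_assoc mult.assoc[symmetric] by simp
    qed
    then have "fourier1 (?b k) y = (\<integral>\<xi>. (exp (- \<i> * of_real ((y - x) \<bullet> \<xi>)) * of_real (?g k \<xi>)) *s cl_one \<partial>lborel)"
      unfolding fourier1_def by (simp only:)
    also have "\<dots> = (\<integral>\<xi>. exp (- \<i> * of_real ((y - x) \<bullet> \<xi>)) * of_real (?g k \<xi>) \<partial>lborel) *s cl_one"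
      by (rule integral_bounded_linear[OF vsmult.bounded_linear_left gauss_fourier(1)]) simp
    also have "(\<integral>\<xi>. exp (- \<i> * of_real ((y - x) \<bullet> \<xi>)) * of_real (?g k \<xi>) \<partial>lborel)
      = of_real (sqrt (2 * pi / (1 / (real (Suc k))\<^sup>2)) ^ DIM((real, 'n) vec) * exp (- (norm (y - x))\<^sup>2 / (2 * (1 / (real (Suc k))\<^sup>2))))"
      by (rule gauss_fourier(2)) simp
    also have "sqrt (2 * pi / (1 / (real (Suc k))\<^sup>2)) = sqrt (2 * pi) * real (Suc k)"
      by (simp add: real_sqrt_mult del: of_nat_Suc)
    also have "- (norm (y - x))\<^sup>2 / (2 * (1 / (real (Suc k))\<^sup>2)) = - (real (Suc k))\<^sup>2 * (norm (y - x))\<^sup>2 / 2"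
      by (simp del: of_nat_Suc)
    finally show ?thesis by (simp only: vsmult_of_real DIM_cart DIM_real mult_1_right)
  qed
  have e: "(\<integral>y. ((sqrt (2 * pi) * real (Suc k)) ^ CARD('n) * exp (- (real (Suc k))\<^sup>2 * (norm (y - x))\<^sup>2 / 2)) *\<^sub>R h y \<partial>lborel)
     = (\<integral>\<xi>. ?b k \<xi> \<odot> H \<xi> \<partial>lborel)" for k
    using fourier_parseval[OF bi bL2 H, of k] unfolding fb cl.scaleR_left cl_mult_one .
  have "(\<lambda>k. \<integral>\<xi>. ?b k \<xi> \<odot> H \<xi> \<partial>lborel) \<longlonglongrightarrow> (2 * pi) ^ CARD('n) *\<^sub>R h x"
    using gauss_approximate_identity[OF fourier_L2D(1)[OF H] cont] unfolding e .
  moreover have "(\<lambda>k. \<integral>\<xi>. ?b k \<xi> \<odot> H \<xi> \<partial>lborel) \<longlonglongrightarrow> (\<integral>\<xi>. exp (\<i> * of_real (x \<bullet> \<xi>)) *s H \<xi> \<partial>lborel)"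
  proof (rule integral_dominated_convergence[where w="\<lambda>\<xi>. norm (H \<xi>)"])
    show "AE \<xi> in lborel. (\<lambda>k. ?b k \<xi> \<odot> H \<xi>) \<longlonglongrightarrow> exp (\<i> * of_real (x \<bullet> \<xi>)) *s H \<xi>"
    proof (rule AE_I2)
      fix \<xi> :: "(real, 'n) vec"
      have "(\<lambda>k. 1 / real (Suc k) * (1 / real (Suc k))) \<longlonglongrightarrow> 0 * 0"
        by (intro tendsto_intros LIMSEQ_Suc[OF lim_1_over_n])
      then have "(\<lambda>k. 1 / (real (Suc k))\<^sup>2) \<longlonglongrightarrow> 0" by (simp add: power2_eq_square)
      then have "(\<lambda>k. ?g k \<xi>) \<longlonglongrightarrow> exp (- 0 * (norm \<xi>)\<^sup>2 / 2)" by (intro tendsto_intros) auto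
      then have "(\<lambda>k. ?g k \<xi> *\<^sub>R (exp (\<i> * of_real (x \<bullet> \<xi>)) *s H \<xi>)) \<longlonglongrightarrow> 1 *\<^sub>R (exp (\<i> * of_real (x \<bullet> \<xi>)) *s H \<xi>)"
        by (intro tendsto_scaleR tendsto_const) simp
      moreover have "?g k \<xi> *\<^sub>R (exp (\<i> * of_real (x \<bullet> \<xi>)) *s H \<xi>) = ?b k \<xi> \<odot> H \<xi>" for k
        unfolding cl_mult_scale cl_mult_one by (simp add: vec_eq_iff scaleR_conv_of_real[where 'a=complex])
      ultimately show "(\<lambda>k. ?b k \<xi> \<odot> H \<xi>) \<longlonglongrightarrow> exp (\<i> * of_real (x \<bullet> \<xi>)) *s H \<xi>" by simp
    qed
    show "AE \<xi> in lborel. norm (?b k \<xi> \<odot> H \<xi>) \<le> norm (H \<xi>)" for k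
      by (rule AE_I2) (simp add: cl_mult_scale norm_mult mult_left_le_one_le)
  qed (use Hi in auto)
  ultimately show ?thesis by (rule LIMSEQ_unique)
qed

section \<open>Functions with vanishing integrals over a generating class\<close>

text \<open>The positive and the negative part of w are densities of two finite measures that agree
  on an intersection-stable generator, hence everywhere; densities are unique almost everywhere, so
  the two parts coincide, and then both vanish.\<close>

lemma AE_zero_of_integral_zero_real:
  fixes w :: "'a::euclidean_space \<Rightarrow> real"
  assumes w: "integrable lborel w"
    and E: "Int_stable E" "sets borel = sigma_sets UNIV E"
    and A: "range A \<subseteq> E" "(\<Union>i::nat. A i) = UNIV"
    and zero: "\<And>X. X \<in> E \<Longrightarrow> (\<integral>x. indicator X x *\<^sub>R w x \<partial>lborel) = 0"
  shows "AE x in lborel. w x = 0"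
proof -
  have [measurable]: "w \<in> borel_measurable borel"
    using borel_measurable_integrable[OF w] by simp
  have EB: "X \<in> sets borel" if "X \<in> E" for X
    using that unfolding E(2) by blast
  let ?p = "\<lambda>x. max 0 (w x)" and ?n = "\<lambda>x. max 0 (- w x)"
  have pi: "integrable lborel ?p" "integrable lborel ?n" using w by auto
  have ip: "integrable lborel (\<lambda>x. indicator X x *\<^sub>R u x)" if "X \<in> sets borel" "integrable lborel u" for X and u :: "'a \<Rightarrow> real"
    using that by (intro integrable_mult_indicator) auto
  have em: "emeasure (density lborel (\<lambda>x. ennreal (u x))) X = ennreal (\<integral>x. indicator X x *\<^sub>R u x \<partial>lborel)"
    if X: "X \<in> sets borel" and u: "integrable lborel u" "\<And>x. u x \<ge> 0" for X and u :: "'a \<Rightarrow> real"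
  proof -
    have [measurable]: "u \<in> borel_measurable borel" using borel_measurable_integrable[OF u(1)] by simp
    have "emeasure (density lborel (\<lambda>x. ennreal (u x))) X = (\<integral>\<^sup>+x. ennreal (indicator X x *\<^sub>R u x) \<partial>lborel)"
      using X by (subst emeasure_density) (auto intro!: nn_integral_cong simp: indicator_def)
    also have "\<dots> = ennreal (\<integral>x. indicator X x *\<^sub>R u x \<partial>lborel)"
      using u(2) by (intro nn_integral_eq_integral ip X u(1)) (auto simp: indicator_def)
    finally show ?thesis .
  qed
  have "density lborel (\<lambda>x. ennreal (?p x)) = density lborel (\<lambda>x. ennreal (?n x))"
  proof (rule measure_eqI_generator_eq[OF E(1) _ _ _ _ A])
    fix X assume "X \<in> E"
    then have X: "X \<in> sets borel" by (rule EB)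
    have "(\<integral>x. indicator X x *\<^sub>R ?p x \<partial>lborel) - (\<integral>x. indicator X x *\<^sub>R ?n x \<partial>lborel) = (\<integral>x. indicator X x *\<^sub>R w x \<partial>lborel)"
      by (subst Bochner_Integration.integral_diff[symmetric, OF ip[OF X pi(1)] ip[OF X pi(2)]])
        (auto intro!: Bochner_Integration.integral_cong simp: max_def)
    with zero[OF \<open>X \<in> E\<close>]
    show "emeasure (density lborel (\<lambda>x. ennreal (?p x))) X = emeasure (density lborel (\<lambda>x. ennreal (?n x))) X"
      using em[OF X pi(1)] em[OF X pi(2)] by simp
  next
    show "emeasure (density lborel (\<lambda>x. ennreal (?p x))) (A i) \<noteq> \<infinity>" for i
      using A(1) by (subst em[OF EB pi(1)]) auto
  qed (use E(2) in auto)
  then have "AE x in lborel. ennreal (?p x) = ennreal (?n x)"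
  proof (subst (asm) finite_density_unique)
    have "(\<integral>\<^sup>+x. ennreal (?p x) \<partial>lborel) = ennreal (\<integral>x. ?p x \<partial>lborel)"
      by (rule nn_integral_eq_integral[OF pi(1)]) simp
    then show "(\<integral>\<^sup>+x. ennreal (?p x) \<partial>lborel) \<noteq> \<infinity>" by simp
  qed auto
  then show ?thesis
    by eventually_elim (auto simp: max_def split: if_splits)
qed

lemma AE_zero_of_integral_zero:
  fixes w :: "'a::euclidean_space \<Rightarrow> 'b::euclidean_space"
  assumes w: "integrable lborel w"
    and E: "Int_stable E" "sets borel = sigma_sets UNIV E"
    and A: "range A \<subseteq> E" "(\<Union>i::nat. A i) = UNIV"
    and zero: "\<And>X. X \<in> E \<Longrightarrow> (\<integral>x. indicator X x *\<^sub>R w x \<partial>lborel) = 0"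
  shows "AE x in lborel. w x = 0"
proof -
  have "AE x in lborel. w x \<bullet> b = 0" if "b \<in> Basis" for b
  proof (rule AE_zero_of_integral_zero_real[OF _ E A])
    show "integrable lborel (\<lambda>x. w x \<bullet> b)" using w by simp
    fix X assume "X \<in> E"
    then have "X \<in> sets borel" unfolding E(2) by blast
    then have "integrable lborel (\<lambda>x. indicator X x *\<^sub>R w x)"
      using w by (intro integrable_mult_indicator) auto
    from integral_inner_left[OF this, of b]
    show "(\<integral>x. indicator X x *\<^sub>R (w x \<bullet> b) \<partial>lborel) = 0"
      using zero[OF \<open>X \<in> E\<close>] by simp
  qed
  then have "AE x in lborel. \<forall>b\<in>Basis. w x \<bullet> b = 0"
    by (intro AE_finite_allI) auto
  then show ?thesis
    by eventually_elim (simp add: euclidean_eq_iff[where 'a='b])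
qed

text \<open>Finite intersections of a countable basis are again countable in number, and the empty
  intersection supplies \<open>UNIV\<close>, which serves as the exhausting sequence for
  \<open>AE_zero_of_integral_zero\<close>.\<close>

lemma countable_Int_stable_generator:
  obtains E :: "'a::second_countable_topology set set"
  where "countable E" "Int_stable E" "UNIV \<in> E" "sets borel = sigma_sets UNIV E"
proof -
  obtain B :: "'a set set" where B: "countable B" "topological_basis B"
    using ex_countable_basis by blast
  define E where "E = Inter ` {F. F \<subseteq> B \<and> finite F}"
  have "countable E"
    unfolding E_def using countable_Collect_finite_subset[OF B(1)] by (simp add: conj_commute)
  moreover have "Int_stable E"
    unfolding Int_stable_def E_def
  proof safe
    fix F G assume *: "F \<subseteq> B" "finite F" "G \<subseteq> B" "finite G"
    show "\<Inter> F \<inter> \<Inter> G \<in> Inter ` {F. F \<subseteq> B \<and> finite F}"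
      using * by (intro image_eqI[of _ _ "F \<union> G"]) auto
  qed
  moreover have "UNIV \<in> E"
    unfolding E_def by (intro image_eqI[of _ _ "{}"]) auto
  moreover have "sets borel = sigma_sets UNIV E"
  proof -
    have sB: "sets (borel :: 'a measure) = sigma_sets UNIV B"
      unfolding borel_eq_countable_basis[OF B] by (rule sets_measure_of) simp
    moreover have "sigma_sets UNIV B = sigma_sets UNIV E"
    proof (rule sigma_sets_eqI)
      fix b assume "b \<in> B"
      then have "b \<in> E" unfolding E_def by (intro image_eqI[of _ _ "{b}"]) auto
      then show "b \<in> sigma_sets UNIV E" by blast
    next
      fix b assume "b \<in> E"
      then obtain F where "F \<subseteq> B" "finite F" "b = \<Inter>F" unfolding E_def by blast
      then have "open b"
        using topological_basis_open[OF B(2)] by (auto intro!: open_Inter)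
      then have "b \<in> sets borel" by simp
      then show "b \<in> sigma_sets UNIV B"
        unfolding sB .
    qed
    ultimately show ?thesis by simp
  qed
  ultimately show thesis using that by blast
qed

text \<open>A continuous midpoint-affine function is affine: subtract the chord and look at a point
  where the norm of the difference is maximal; reflecting the nearer endpoint in it would double
  that norm.\<close>
lemma midpoint_affine:
  fixes P :: "real \<Rightarrow> 'b::real_normed_vector"
  assumes "a > 0" and cont: "continuous_on {-a..a} P"
    and mid: "\<And>y h. h > 0 \<Longrightarrow> -a < y \<Longrightarrow> y + 2 * h < a \<Longrightarrow> P (y + 2 * h) + P y = 2 *\<^sub>R P (y + h)"
    and t: "t \<in> {-a..a}"
  shows "P t = P (-a) + ((t + a) / (2 * a)) *\<^sub>R (P a - P (-a))"
proof -
  define Q where "Q t = P t - P (-a) - ((t + a) / (2 * a)) *\<^sub>R (P a - P (-a))" for t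
  have contQ: "continuous_on {-a..a} Q"
    unfolding Q_def[abs_def] using \<open>a > 0\<close> by (intro continuous_intros cont) auto
  have midQ: "Q (y + 2 * h) + Q y = 2 *\<^sub>R Q (y + h)" if "h > 0" "-a \<le> y" "y + 2 * h \<le> a" for y h
  proof -
    \<comment> \<open>The hypothesis covers only triples inside the open interval. Moving both ends
      inwards by \<delta> and letting \<delta> tend to 0 extends it to triples that touch the
      endpoints.\<close>
    let ?\<phi> = "\<lambda>\<delta>. Q (y + 2 * h - \<delta>) + Q (y + \<delta>) - 2 *\<^sub>R Q (y + h)"
    have "?\<phi> 0 = 0"
    proof (rule continuous_constant_on_closure[of "{0<..<h}" ?\<phi>])
      have sub: "(\<lambda>\<delta>. y + 2 * h - \<delta>) ` {0..h} \<subseteq> {-a..a}" "(\<lambda>\<delta>. y + \<delta>) ` {0..h} \<subseteq> {-a..a}"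
        using that by auto
      show "continuous_on (closure {0<..<h}) ?\<phi>"
        unfolding closure_greaterThanLessThan[OF \<open>h > 0\<close>]
        by (intro continuous_on_diff continuous_on_add continuous_on_const
            continuous_on_compose2[OF contQ _ sub(1)] continuous_on_compose2[OF contQ _ sub(2)] continuous_intros)
      fix \<delta> assume "\<delta> \<in> {0<..<h}"
      then have "P ((y + \<delta>) + 2 * (h - \<delta>)) + P (y + \<delta>) = 2 *\<^sub>R P ((y + \<delta>) + (h - \<delta>))"
        using that by (intro mid) auto
      then have m: "P (y + 2 * h - \<delta>) + P (y + \<delta>) = 2 *\<^sub>R P (y + h)" by (simp add: algebra_simps)
      have "((y + 2 * h - \<delta> + a) / (2 * a)) *\<^sub>R D + ((y + \<delta> + a) / (2 * a)) *\<^sub>R D = 2 *\<^sub>R (((y + h + a) / (2 * a)) *\<^sub>R D)" for D :: 'b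
        using \<open>a > 0\<close> unfolding scaleR_add_left[symmetric] scaleR_scaleR by (simp add: field_simps)
      with m show "?\<phi> \<delta> = 0"
        unfolding Q_def by (simp add: algebra_simps scaleR_2)
    qed (use that in \<open>simp add: closure_greaterThanLessThan\<close>)
    then show ?thesis by simp
  qed
  have Q0: "Q (-a) = 0" "Q a = 0" using \<open>a > 0\<close> by (simp_all add: Q_def)
  obtain u where u: "u \<in> {-a..a}" "\<And>t. t \<in> {-a..a} \<Longrightarrow> norm (Q t) \<le> norm (Q u)"
    using continuous_attains_sup[OF compact_Icc _ continuous_on_norm[OF contQ]] \<open>a > 0\<close> by force
  have "Q u = 0"
  proof (cases "u = -a \<or> u = a")
    case False
    with u(1) have uu: "-a < u" "u < a" by auto
    have "\<exists>v\<in>{-a..a}. Q v = 2 *\<^sub>R Q u"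
    proof (cases "u \<le> 0")
      case True
      then show ?thesis using midQ[of "u + a" "-a"] uu Q0 by (intro bexI[of _ "-a + 2 * (u + a)"]) auto
    next
      case False
      then show ?thesis using midQ[of "a - u" "2 * u - a"] uu Q0 by (intro bexI[of _ "2 * u - a"]) auto
    qed
    then show ?thesis using u(2) by fastforce
  qed (use Q0 in auto)
  then have "Q t = 0" using u(2)[OF t] by simp
  then show ?thesis by (simp add: Q_def algebra_simps)
qed

text \<open>Equal integrals over adjacent intervals of equal length make the primitive
  midpoint-affine, hence affine, and a function whose primitive is affine agrees almost everywhere
  with the slope. The hypothesis is what a tent function tests: its derivative is 1/h and then -1/h
  on two such intervals.\<close>

lemma AE_constant_of_midpoint:
  fixes k :: "real \<Rightarrow> 'b::euclidean_space"
  assumes "a > 0" and k: "integrable lborel k" and k0: "\<And>t. t \<notin> {-a<..<a} \<Longrightarrow> k t = 0"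
    and mid: "\<And>y h. h > 0 \<Longrightarrow> -a < y \<Longrightarrow> y + 2 * h < a \<Longrightarrow> integral {y..y+h} k = integral {y+h..y+2*h} k"
  shows "\<exists>c. AE t in lborel. t \<in> {-a<..<a} \<longrightarrow> k t = c"
proof -
  have [measurable]: "k \<in> borel_measurable borel" using borel_measurable_integrable[OF k] by simp
  have ion: "k integrable_on {u..v}" and ieq: "integral {u..v} k = (\<integral>t. indicator {u..v} t *\<^sub>R k t \<partial>lborel)" for u v
  proof -
    have "set_integrable lborel {u..v} k"
      unfolding set_integrable_def by (intro integrable_mult_indicator k) auto
    from set_borel_integral_eq_integral[OF this]
    show "k integrable_on {u..v}" "integral {u..v} k = (\<integral>t. indicator {u..v} t *\<^sub>R k t \<partial>lborel)"
      by (auto simp: set_lebesgue_integral_def)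
  qed
  define P where "P t = integral {-a..t} k" for t
  have P: "P v - P u = integral {u..v} k" if "-a \<le> u" "u \<le> v" for u v
    using Henstock_Kurzweil_Integration.integral_combine[OF that ion[of "-a" v]] by (simp add: P_def algebra_simps)
  have contP: "continuous_on {-a..a} P"
    unfolding P_def[abs_def] by (rule indefinite_integral_continuous_1[OF ion])
  define c where "c = (1 / (2 * a)) *\<^sub>R P a"
  have Pt: "P t = (t + a) *\<^sub>R c" if "t \<in> {-a..a}" for t
  proof -
    have "P t = P (-a) + ((t + a) / (2 * a)) *\<^sub>R (P a - P (-a))"
    proof (rule midpoint_affine[OF \<open>a > 0\<close> contP _ that])
      fix y h :: real assume "h > 0" "-a < y" "y + 2 * h < a"
      then show "P (y + 2 * h) + P y = 2 *\<^sub>R P (y + h)"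
        using mid[of h y] P[of y "y + h"] P[of "y + h" "y + 2 * h"] by (simp add: scaleR_2 algebra_simps)
    qed
    moreover have "P (-a) = 0" by (simp add: P_def)
    ultimately show ?thesis by (simp add: c_def)
  qed
  \<comment> \<open>The constant is cut off at the interval to stay integrable on the line;
    half-lines then serve as the generator.\<close>
  let ?w = "\<lambda>t. k t - indicator {-a..a} t *\<^sub>R c"
  have "AE t in lborel. ?w t = 0"
  proof (rule AE_zero_of_integral_zero[where E="range atMost" and A="\<lambda>n. {..real n}"])
    show "integrable lborel ?w"
      using k by (intro Bochner_Integration.integrable_diff integrable_scaleR_left integrable_real_indicator) (auto simp: emeasure_lborel_Icc_eq)
    show "Int_stable (range atMost :: real set set)"
      by (auto simp: Int_stable_def intro!: image_eqI[of _ atMost "min _ _"])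
    show "sets borel = sigma_sets UNIV (range atMost :: real set set)"
      by (subst borel_eq_atMost) simp
    show "(\<Union>n. {..real n}) = UNIV"
      using real_arch_simple by auto
    fix X :: "real set" assume "X \<in> range atMost"
    then obtain t where X: "X = {..t}" by auto
    have "indicator X s *\<^sub>R ?w s = indicator {-a..min t a} s *\<^sub>R k s - indicator {-a..min t a} s *\<^sub>R c" for s
      using k0[of s] by (auto simp: X indicator_def)
    then have "(\<integral>s. indicator X s *\<^sub>R ?w s \<partial>lborel) = (\<integral>s. indicator {-a..min t a} s *\<^sub>R k s \<partial>lborel) - (\<integral>s. indicator {-a..min t a} s *\<^sub>R c \<partial>lborel)"
      using k by (simp only:, subst Bochner_Integration.integral_diff)
        (auto intro!: integrable_mult_indicator integrable_scaleR_left integrable_real_indicator simp: emeasure_lborel_Icc_eq)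
    also have "\<dots> = 0"
    proof (cases "min t a \<ge> -a")
      case True
      have "(\<integral>s. indicator {-a..min t a} s *\<^sub>R c \<partial>lborel) = (min t a + a) *\<^sub>R c"
        using True by (subst integral_scaleR_left) (auto intro!: integrable_real_indicator simp: emeasure_lborel_Icc_eq)
      moreover have "(\<integral>s. indicator {-a..min t a} s *\<^sub>R k s \<partial>lborel) = (min t a + a) *\<^sub>R c"
        using Pt[of "min t a"] True by (simp add: P_def ieq)
      ultimately show ?thesis by simp
    qed simp
    finally show "(\<integral>s. indicator X s *\<^sub>R ?w s \<partial>lborel) = 0" .
  qed auto
  then have "AE t in lborel. t \<in> {-a<..<a} \<longrightarrow> k t = c"
    by eventually_elim (auto simp: indicator_def)
  then show ?thesis by blast
qed

section \<open>Tent functions\<close>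

text \<open>With the value 0 at the kink, \<open>dhat\<close> is 1 for 0 < t \<le> 1 and -1 for 1 <
  t \<le> 2. This half-open convention makes the two-scale relation \<open>dhat_refine\<close> true
  at every point.\<close>

definition ramp_deriv :: "real \<Rightarrow> real" where
  "ramp_deriv t = (if t > 0 then 1 else 0)"

text \<open>The linear B-spline on [0, 2] with peak 1 at t = 1, written as a second difference of
  ramps so that continuity and derivative come from \<open>max 0\<close>.\<close>

definition hat :: "real \<Rightarrow> real" where
  "hat t = max 0 t - 2 * max 0 (t - 1) + max 0 (t - 2)"

definition dhat :: "real \<Rightarrow> real" where
  "dhat t = ramp_deriv t - 2 * ramp_deriv (t - 1) + ramp_deriv (t - 2)"

text \<open>The two-scale relation of the B-spline. Differentiation produces
  \<open>dhat_refine\<close>, whose additional factor 2 is absorbed in \<open>tent\<close> by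
  dividing through the halved width.\<close>

lemma hat_refine: "hat t = hat (2 * t) / 2 + hat (2 * t - 1) + hat (2 * t - 2) / 2"
  by (auto simp: hat_def max_def field_simps)

lemma dhat_refine: "dhat t = dhat (2 * t) + 2 * dhat (2 * t - 1) + dhat (2 * t - 2)"
  by (auto simp: dhat_def ramp_deriv_def)

lemma hat_eq_0: "t \<notin> {0..2} \<Longrightarrow> hat t = 0" and dhat_eq_0: "t \<notin> {0..2} \<Longrightarrow> dhat t = 0"
  by (auto simp: hat_def dhat_def ramp_deriv_def max_def)

lemma abs_hat_le: "\<bar>hat t\<bar> \<le> 1" and abs_dhat_le: "\<bar>dhat t\<bar> \<le> 1"
  by (auto simp: hat_def dhat_def ramp_deriv_def max_def)

lemma continuous_on_hat [continuous_intros]: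
  "continuous_on S f \<Longrightarrow> continuous_on S (\<lambda>x. hat (f x))"
  unfolding hat_def by (intro continuous_intros)

lemma hat_measurable [measurable]: "hat \<in> borel_measurable borel" "dhat \<in> borel_measurable borel"
  unfolding hat_def[abs_def] dhat_def[abs_def] ramp_deriv_def by measurable

lemma ramp_has_derivative:
  assumes "t \<noteq> 0"
  shows "((\<lambda>t. max 0 t) has_real_derivative ramp_deriv t) (at t)"
proof (cases "t > 0")
  case True
  have "((\<lambda>t. t) has_real_derivative 1) (at t)" by (rule DERIV_ident)
  then have "((\<lambda>t. max 0 t) has_real_derivative 1) (at t)"
    by (rule has_field_derivative_transform_within_open[of _ _ _ "{0<..}"]) (use True in auto)
  then show ?thesis using True by (simp add: ramp_deriv_def)
next
  case False
  have "((\<lambda>t. 0) has_real_derivative 0) (at t)" by (rule DERIV_const)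
  then have "((\<lambda>t. max 0 t) has_real_derivative 0) (at t)"
    by (rule has_field_derivative_transform_within_open[of _ _ _ "{..<0}"]) (use False assms in auto)
  then show ?thesis using False by (simp add: ramp_deriv_def)
qed

lemma hat_has_derivative:
  assumes "t \<notin> {0, 1, 2}"
  shows "(hat has_real_derivative dhat t) (at t)"
proof -
  have "((\<lambda>t. max 0 (t - c)) has_real_derivative ramp_deriv (t - c)) (at t)" if "t \<noteq> c" for c
  proof -
    have "((\<lambda>t. t - c) has_real_derivative 1) (at t)" by (auto intro!: derivative_eq_intros)
    with DERIV_chain2[of "max 0" "ramp_deriv (t - c)" "\<lambda>t. t - c" t 1 UNIV] ramp_has_derivative[of "t - c"] that
    show ?thesis by simp
  qed
  from this[of 0] this[of 1] this[of 2]
  have "((\<lambda>t. max 0 t - 2 * max 0 (t - 1) + max 0 (t - 2)) has_real_derivative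
      (ramp_deriv t - 2 * ramp_deriv (t - 1) + ramp_deriv (t - 2))) (at t)"
    using assms by (intro DERIV_add DERIV_diff DERIV_cmult) auto
  then show ?thesis
    unfolding hat_def[abs_def] dhat_def .
qed

text \<open>For \<open>d \<in> Basis\<close> this is the partial derivative in direction \<open>d\<close> of the tensor product tent
  function over \<open>cbox y (y + 2 H)\<close>; as \<open>0 \<notin> Basis\<close>, the tent function itself is \<open>tent 0 y H\<close>.\<close>
definition tent :: "'a \<Rightarrow> 'a \<Rightarrow> 'a \<Rightarrow> 'a::euclidean_space \<Rightarrow> real" where
  "tent d y H x = (\<Prod>b\<in>Basis. if b = d then dhat ((x - y) \<bullet> b / (H \<bullet> b)) / (H \<bullet> b) else hat ((x - y) \<bullet> b / (H \<bullet> b)))"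

lemma tent_measurable [measurable]: "tent d y H \<in> borel_measurable borel"
proof -
  have "(\<lambda>x. if b = d then dhat ((x - y) \<bullet> b / (H \<bullet> b)) / (H \<bullet> b) else hat ((x - y) \<bullet> b / (H \<bullet> b))) \<in> borel_measurable borel" for b
    by (cases "b = d") auto
  then show ?thesis unfolding tent_def[abs_def] by measurable
qed

lemma tent_eq_0:
  assumes "\<And>b. b \<in> Basis \<Longrightarrow> H \<bullet> b > 0" and "x \<notin> cbox y (y + 2 *\<^sub>R H)"
  shows "tent d y H x = 0"
proof -
  obtain b where b: "b \<in> Basis" "\<not> (y \<bullet> b \<le> x \<bullet> b \<and> x \<bullet> b \<le> y \<bullet> b + 2 * (H \<bullet> b))"
    using assms(2) by (auto simp: mem_box inner_add_left)
  then have "(x - y) \<bullet> b / (H \<bullet> b) \<notin> {0..2}"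
    using assms(1)[OF b(1)] by (auto simp: field_simps inner_diff_left)
  then show ?thesis
    unfolding tent_def using b(1) by (intro prod_zero) (auto intro!: bexI[of _ b] simp: hat_eq_0 dhat_eq_0)
qed

lemma abs_tent_le:
  assumes "\<And>b. b \<in> Basis \<Longrightarrow> H \<bullet> b > 0"
  shows "\<bar>tent 0 y H x\<bar> \<le> 1" and "d \<in> Basis \<Longrightarrow> \<bar>tent d y H x\<bar> \<le> 1 / (H \<bullet> d)"
proof -
  show "\<bar>tent 0 y H x\<bar> \<le> 1"
    unfolding tent_def abs_prod by (intro prod_le_1) (auto simp: abs_hat_le)
  assume d: "d \<in> Basis"
  let ?f = "\<lambda>b. if b = d then dhat ((x - y) \<bullet> b / (H \<bullet> b)) / (H \<bullet> b) else hat ((x - y) \<bullet> b / (H \<bullet> b))"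
  have "\<bar>tent d y H x\<bar> = \<bar>?f d\<bar> * (\<Prod>b\<in>Basis - {d}. \<bar>?f b\<bar>)"
    unfolding tent_def abs_prod using d by (intro prod.remove) auto
  also have "\<dots> \<le> (1 / (H \<bullet> d)) * 1"
    using assms[OF d] by (intro mult_mono prod_le_1) (auto simp: abs_hat_le abs_dhat_le divide_right_mono prod_nonneg)
  finally show "\<bar>tent d y H x\<bar> \<le> 1 / (H \<bullet> d)" by simp
qed

definition tent_weight :: "nat \<Rightarrow> real" where
  "tent_weight j = (if j = 1 then 1 else 1 / 2)"

text \<open>Children have half the side length and are shifted by multiples of a quarter of the
  side. They overlap: it is the tent function that is decomposed, not the box.\<close>

definition tent_child :: "'a \<Rightarrow> 'a \<Rightarrow> ('a \<Rightarrow> nat) \<Rightarrow> 'a::euclidean_space" where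
  "tent_child y H i = y + (\<Sum>b\<in>Basis. (real (i b) * (H \<bullet> b) / 2) *\<^sub>R b)"

lemma tent_child_inner: "b \<in> Basis \<Longrightarrow> tent_child y H i \<bullet> b = y \<bullet> b + real (i b) * (H \<bullet> b) / 2"
  by (simp add: tent_child_def inner_add_left)

lemma tent_refine:
  assumes H: "\<And>b. b \<in> Basis \<Longrightarrow> H \<bullet> b > 0"
  shows "tent d y H x = (\<Sum>i\<in>PiE Basis (\<lambda>_. {0,1,2}). (\<Prod>b\<in>Basis. tent_weight (i b)) * tent d (tent_child y H i) ((1/2) *\<^sub>R H) x)"
proof -
  define F where "F y H b = (if b = d then dhat ((x - y) \<bullet> b / (H \<bullet> b)) / (H \<bullet> b) else hat ((x - y) \<bullet> b / (H \<bullet> b)))" for y H b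
  define G where "G b j = (if b = d then dhat (2 * ((x - y) \<bullet> b / (H \<bullet> b)) - real j) / (H \<bullet> b / 2)
     else hat (2 * ((x - y) \<bullet> b / (H \<bullet> b)) - real j))" for b j
  have 1: "F y H b = (\<Sum>j\<in>{0,1,2}. tent_weight j * G b j)" if "b \<in> Basis" for b
  proof -
    define s c where "s = (x - y) \<bullet> b / (H \<bullet> b)" and "c = H \<bullet> b"
    have "dhat s / c = 1 / 2 * (dhat (2 * s) / (c / 2)) + (dhat (2 * s - 1) / (c / 2) + 1 / 2 * (dhat (2 * s - 2) / (c / 2)))"
      by (subst dhat_refine[of s]) (simp add: add_divide_distrib)
    moreover have "hat s = 1 / 2 * hat (2 * s) + (hat (2 * s - 1) + 1 / 2 * hat (2 * s - 2))"
      by (subst hat_refine[of s]) simp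
    moreover have "(\<Sum>j\<in>{0,1,2}. tent_weight j * G b j) = 1 / 2 * G b 0 + (G b 1 + 1 / 2 * G b 2)"
      by (simp add: tent_weight_def)
    moreover have "F y H b = (if b = d then dhat s / c else hat s)"
      by (simp add: F_def s_def c_def)
    moreover have "G b j = (if b = d then dhat (2 * s - real j) / (c / 2) else hat (2 * s - real j))" for j
      by (simp add: G_def s_def c_def)
    ultimately show ?thesis
      by (cases "b = d") (simp_all only: if_True if_False simp_thms of_nat_0 of_nat_1 of_nat_numeral diff_0_right)
  qed
  have 2: "G b (i b) = F (tent_child y H i) ((1/2) *\<^sub>R H) b" if "b \<in> Basis" for b i
  proof -
    have e: "(x - tent_child y H i) \<bullet> b / (((1/2) *\<^sub>R H) \<bullet> b) = 2 * ((x - y) \<bullet> b / (H \<bullet> b)) - real (i b)"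
      using H[OF that] by (simp add: inner_diff_left tent_child_inner[OF that] field_simps)
    show ?thesis unfolding G_def F_def e by simp
  qed
  have "tent d y H x = (\<Prod>b\<in>Basis. F y H b)" by (simp add: tent_def F_def)
  also have "\<dots> = (\<Prod>b\<in>Basis. \<Sum>j\<in>{0,1,2}. tent_weight j * G b j)" using 1 by simp
  also have "\<dots> = (\<Sum>i\<in>PiE Basis (\<lambda>_. {0,1,2}). \<Prod>b\<in>Basis. tent_weight (i b) * G b (i b))"
    by (rule prod_sum_PiE) auto
  also have "\<dots> = (\<Sum>i\<in>PiE Basis (\<lambda>_. {0,1,2}). (\<Prod>b\<in>Basis. tent_weight (i b)) * tent d (tent_child y H i) ((1/2) *\<^sub>R H) x)"
  proof (rule sum.cong[OF refl])
    fix i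
    have "(\<Prod>b\<in>Basis. tent_weight (i b) * G b (i b)) = (\<Prod>b\<in>Basis. tent_weight (i b)) * (\<Prod>b\<in>Basis. F (tent_child y H i) ((1/2) *\<^sub>R H) b)"
      using 2 by (simp add: prod.distrib)
    then show "(\<Prod>b\<in>Basis. tent_weight (i b) * G b (i b)) = (\<Prod>b\<in>Basis. tent_weight (i b)) * tent d (tent_child y H i) ((1/2) *\<^sub>R H) x"
      by (simp add: tent_def F_def)
  qed
  finally show ?thesis .
qed

text \<open>Each direction contributes 1/2 + 1 + 1/2 = 2. A child has 2^-N of the volume in
  dimension N, so refinement preserves the total weighted volume.\<close>

lemma sum_tent_weight: "(\<Sum>i\<in>PiE (Basis :: 'a::euclidean_space set) (\<lambda>_. {0,1,2}). \<Prod>b\<in>Basis. tent_weight (i b)) = 2 ^ DIM('a)"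
proof -
  have "(\<Sum>i\<in>PiE (Basis :: 'a set) (\<lambda>_. {0,1,2}). \<Prod>b\<in>Basis. tent_weight (i b)) = (\<Prod>b\<in>(Basis :: 'a set). \<Sum>j\<in>{0,1,2}. tent_weight j)"
    by (rule prod_sum_PiE[symmetric]) auto
  then show ?thesis by (simp add: tent_weight_def)
qed

lemma tent_child_cbox:
  assumes H: "\<And>b. b \<in> Basis \<Longrightarrow> H \<bullet> b > 0" and i: "i \<in> PiE Basis (\<lambda>_. {0,1,2})"
  shows "cbox (tent_child y H i) (tent_child y H i + 2 *\<^sub>R ((1/2) *\<^sub>R H)) \<subseteq> cbox y (y + 2 *\<^sub>R H)"
proof (rule subset_box_imp)
  have "real (i b) * (H \<bullet> b) / 2 \<ge> 0 \<and> real (i b) * (H \<bullet> b) / 2 \<le> H \<bullet> b" if "b \<in> Basis" for b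
    using i that H[OF that] by (auto simp: PiE_iff dest!: bspec[of _ _ b])
  then show "\<forall>b\<in>Basis. y \<bullet> b \<le> tent_child y H i \<bullet> b \<and> (tent_child y H i + 2 *\<^sub>R ((1/2) *\<^sub>R H)) \<bullet> b \<le> (y + 2 *\<^sub>R H) \<bullet> b"
    by (auto simp: inner_add_left tent_child_inner)
qed

text \<open>Averaging h' over the translates by t v, 0 \<le> t \<le> 1, leaves its integral
  unchanged. By Fubini the average also equals the integral of h (x + v) - h x, which is 0 by
  translation invariance.\<close>

lemma integral_directional_derivative_zero:
  fixes h h' :: "'a::euclidean_space \<Rightarrow> 'b::euclidean_space"
  assumes h: "integrable lborel h" and h': "integrable lborel h'"
    and ftc: "\<And>x. ((\<lambda>t. h' (x + t *\<^sub>R v)) has_integral (h (x + v) - h x)) {0..1}"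
  shows "(\<integral>x. h' x \<partial>lborel) = 0"
proof -
  have [measurable]: "h \<in> borel_measurable borel" "h' \<in> borel_measurable borel"
    using borel_measurable_integrable[OF h] borel_measurable_integrable[OF h'] by simp_all
  let ?f = "\<lambda>t x. indicator {0..1::real} t *\<^sub>R h' (t *\<^sub>R v + x)"
  have s: "integrable lborel (\<lambda>x. h' (c + x))" "(\<integral>x. h' (c + x) \<partial>lborel) = (\<integral>x. h' x \<partial>lborel)" for c
    using integral_lborel_shift[of h' c] h' by simp_all
  have sn: "(\<integral>x. norm (h' (c + x)) \<partial>lborel) = (\<integral>x. norm (h' x) \<partial>lborel)" for c
    using integral_lborel_shift(1)[of "\<lambda>x. norm (h' x)" c] by simp
  have i: "integrable (lborel \<Otimes>\<^sub>M lborel) (\<lambda>(t, x). ?f t x)"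
  proof (rule lborel_pair.Fubini_integrable)
    show "integrable lborel (\<lambda>t. \<integral>x. norm (case (t, x) of (t, x) \<Rightarrow> ?f t x) \<partial>lborel)"
      by (simp add: sn)
    show "AE t in lborel. integrable lborel (\<lambda>x. case (t, x) of (t, x) \<Rightarrow> ?f t x)"
      by (simp add: s)
  qed (unfold lborel_prod case_prod_beta', measurable)
  have "(\<integral>t. (\<integral>x. ?f t x \<partial>lborel) \<partial>lborel) = (\<integral>t. indicator {0..1::real} t *\<^sub>R (\<integral>x. h' x \<partial>lborel) \<partial>lborel)"
    by (simp add: s)
  also have "\<dots> = (\<integral>x. h' x \<partial>lborel)"
    by (subst integral_scaleR_left) (auto intro!: integrable_real_indicator)
  finally have "(\<integral>x. h' x \<partial>lborel) = (\<integral>x. (\<integral>t. ?f t x \<partial>lborel) \<partial>lborel)"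
    using lborel_pair.Fubini_integral[OF i] by simp
  also have "\<dots> = (\<integral>x. h (v + x) - h x \<partial>lborel)"
  proof (rule integral_cong_AE)
    show "AE x in lborel. (\<integral>t. ?f t x \<partial>lborel) = h (v + x) - h x"
      using lborel_pair.AE_integrable_snd[OF i]
    proof eventually_elim
      case (elim x)
      then have "set_integrable lborel {0..1} (\<lambda>t. h' (t *\<^sub>R v + x))"
        by (simp add: set_integrable_def)
      from set_borel_integral_eq_integral(2)[OF this]
      have "(\<integral>t. ?f t x \<partial>lborel) = integral {0..1} (\<lambda>t. h' (t *\<^sub>R v + x))"
        by (simp add: set_lebesgue_integral_def)
      also have "\<dots> = h (v + x) - h x"
        using integral_unique[OF ftc[of x]] by (simp add: add.commute)
      finally show ?case .
    qed
  qed measurable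
  also have "\<dots> = 0"
    using integral_lborel_shift[of h v] h by (subst Bochner_Integration.integral_diff) auto
  finally show ?thesis .
qed

lemma tent_integrable:
  fixes c :: "'a::euclidean_space \<Rightarrow> 'b::euclidean_space"
  assumes H: "\<And>b. b \<in> Basis \<Longrightarrow> H \<bullet> b > 0" and d: "d \<in> insert 0 Basis"
    and c: "continuous_on (cbox y (y + 2 *\<^sub>R H)) c"
  shows "integrable lborel (\<lambda>x. tent d y H x *\<^sub>R c x)"
proof -
  let ?K = "cbox y (y + 2 *\<^sub>R H)"
  obtain M where M: "M \<ge> 0" "\<And>x. \<bar>tent d y H x\<bar> \<le> M"
  proof (cases "d = 0")
    case True
    then show ?thesis using that[of 1] abs_tent_le(1)[of H y] H by auto
  next
    case False
    then show ?thesis using that[of "1 / (H \<bullet> d)"] abs_tent_le(2)[of H d y] H d by (auto simp: less_imp_le)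
  qed
  \<comment> \<open>Only the values of \<open>c\<close> on the box are controlled; extending by zero
    makes it measurable, and the tent hides the change.\<close>
  have i: "integrable lborel (\<lambda>x. indicator ?K x *\<^sub>R c x)"
    by (rule borel_integrable_compact[OF compact_cbox c])
  then have [measurable]: "(\<lambda>x. indicator ?K x *\<^sub>R c x) \<in> borel_measurable borel"
    using borel_measurable_integrable by force
  have "integrable lborel (\<lambda>x. tent d y H x *\<^sub>R (indicator ?K x *\<^sub>R c x))"
  proof (rule Bochner_Integration.integrable_bound[OF integrable_scaleR_right[OF i, of M]])
    show "AE x in lborel. norm (tent d y H x *\<^sub>R (indicator ?K x *\<^sub>R c x)) \<le> norm (M *\<^sub>R (indicator ?K x *\<^sub>R c x))"
      using M by (intro AE_I2) (auto simp del: scaleR_scaleR intro!: mult_right_mono)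
  qed measurable
  moreover have "tent d y H x *\<^sub>R (indicator ?K x *\<^sub>R c x) = tent d y H x *\<^sub>R c x" for x
    using tent_eq_0[OF H, of x y d] by (cases "x \<in> ?K") auto
  ultimately show ?thesis by (simp only:)
qed

lemma tent_0: "tent 0 y H x = (\<Prod>b\<in>Basis. hat ((x - y) \<bullet> b / (H \<bullet> b)))"
  unfolding tent_def by (rule prod.cong[OF refl]) (use nonzero_Basis in auto)

text \<open>Integration by parts in direction b moves the derivative from the tent to the affine
  field and leaves - tent * A b b; summed over b these add up to the divergence, which is 0.\<close>

lemma tent_affine_integral:
  fixes A :: "'a::euclidean_space \<Rightarrow> 'a \<Rightarrow> 'b::euclidean_space"
  assumes H: "\<And>b. b \<in> Basis \<Longrightarrow> H \<bullet> b > 0" and A: "\<And>b. b \<in> Basis \<Longrightarrow> bounded_linear (A b)"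
    and div: "(\<Sum>b\<in>Basis. A b b) = 0"
  shows "(\<integral>x. (\<Sum>b\<in>Basis. tent b y H x *\<^sub>R (v b + A b (x - p))) \<partial>lborel) = 0"
proof -
  have cont: "continuous_on S (\<lambda>x. v b + A b (x - p))" if "b \<in> Basis" for b S
    by (intro continuous_intros bounded_linear.continuous_on[OF A[OF that]])
  have i1: "integrable lborel (\<lambda>x. tent b y H x *\<^sub>R (v b + A b (x - p)))" if "b \<in> Basis" for b
    using that by (intro tent_integrable H cont) auto
  have i2: "integrable lborel (\<lambda>x. tent 0 y H x *\<^sub>R A b b)" for b
    by (intro tent_integrable H continuous_on_const) auto
  have z: "(\<integral>x. tent b y H x *\<^sub>R (v b + A b (x - p)) + tent 0 y H x *\<^sub>R A b b \<partial>lborel) = 0" if b: "b \<in> Basis" for b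
  proof (rule integral_directional_derivative_zero[where v=b and h="\<lambda>x. tent 0 y H x *\<^sub>R (v b + A b (x - p))"])
    show "integrable lborel (\<lambda>x. tent 0 y H x *\<^sub>R (v b + A b (x - p)))"
      using b by (intro tent_integrable H cont) auto
    show "integrable lborel (\<lambda>x. tent b y H x *\<^sub>R (v b + A b (x - p)) + tent 0 y H x *\<^sub>R A b b)"
      by (intro Bochner_Integration.integrable_add i1 i2 b)
    fix x
    interpret A: bounded_linear "A b" by (rule A[OF b])
    define C where "C = (\<Prod>b'\<in>Basis - {b}. hat ((x - y) \<bullet> b' / (H \<bullet> b')))"
    define s c w where "s = (x - y) \<bullet> b / (H \<bullet> b)" and "c = H \<bullet> b" and "w = v b + A b (x - p)"
    have c: "c > 0" using H[OF b] by (simp add: c_def)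
    have s: "(x + t *\<^sub>R b - y) \<bullet> b / (H \<bullet> b) = s + t / c" for t
      using b by (simp add: s_def c_def inner_diff_left inner_add_left add_divide_distrib diff_divide_distrib)
    have s': "(x + t *\<^sub>R b - y) \<bullet> b' / (H \<bullet> b') = (x - y) \<bullet> b' / (H \<bullet> b')" if "b' \<in> Basis - {b}" for b' t
      using b that by (auto simp: inner_diff_left inner_add_left inner_Basis)
    have t0: "tent 0 y H (x + t *\<^sub>R b) = hat (s + t / c) * C" for t
    proof -
      have "tent 0 y H (x + t *\<^sub>R b) = hat ((x + t *\<^sub>R b - y) \<bullet> b / (H \<bullet> b)) * (\<Prod>b'\<in>Basis - {b}. hat ((x + t *\<^sub>R b - y) \<bullet> b' / (H \<bullet> b')))"
        unfolding tent_0 by (rule prod.remove[OF _ b]) simp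
      then show ?thesis unfolding s C_def by (simp add: s')
    qed
    have tb: "tent b y H (x + t *\<^sub>R b) = dhat (s + t / c) / c * C" for t
    proof -
      have "tent b y H (x + t *\<^sub>R b) = dhat ((x + t *\<^sub>R b - y) \<bullet> b / (H \<bullet> b)) / (H \<bullet> b) * (\<Prod>b'\<in>Basis - {b}. hat ((x + t *\<^sub>R b - y) \<bullet> b' / (H \<bullet> b')))"
        unfolding tent_def
        by (subst prod.remove[OF _ b]) (auto intro!: arg_cong2[where f="(*)"] prod.cong)
      then show ?thesis unfolding s C_def c_def by (simp add: s')
    qed
    have wt: "v b + A b (x + t *\<^sub>R b - p) = w + t *\<^sub>R A b b" for t
    proof -
      have "A b (x + t *\<^sub>R b - p) = A b ((x - p) + t *\<^sub>R b)" by (simp add: algebra_simps)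
      then show ?thesis by (simp add: w_def A.add A.scaleR)
    qed
    let ?f = "\<lambda>t. (hat (s + t / c) * C) *\<^sub>R (w + t *\<^sub>R A b b)"
    let ?f' = "\<lambda>t. (dhat (s + t / c) / c * C) *\<^sub>R (w + t *\<^sub>R A b b) + (hat (s + t / c) * C) *\<^sub>R A b b"
    have "(?f' has_integral (?f 1 - ?f 0)) {0..1}"
    proof (rule fundamental_theorem_of_calculus_strong)
      \<comment> \<open>The parameters at which the segment crosses the three kinks of the tent; the
        fundamental theorem tolerates finitely many exceptions.\<close>
      show "finite {c * (0 - s), c * (1 - s), c * (2 - s)}" by simp
      show "continuous_on {0..1} ?f" using c by (intro continuous_intros) auto
      fix t assume "t \<in> {0..1} - {c * (0 - s), c * (1 - s), c * (2 - s)}"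
      then have "s + t / c \<notin> {0, 1, 2}" using c by (auto simp: field_simps)
      then have h: "(hat has_real_derivative dhat (s + t / c)) (at (s + t / c))" by (rule hat_has_derivative)
      have "((\<lambda>t. s + t / c) has_real_derivative 1 / c) (at t)"
        using c by (auto intro!: derivative_eq_intros)
      from DERIV_chain2[of hat _ "\<lambda>t. s + t / c", OF h this]
      have "((\<lambda>t. hat (s + t / c) * C) has_real_derivative dhat (s + t / c) / c * C) (at t)"
        by (auto intro!: derivative_eq_intros)
      moreover have "((\<lambda>t. w + t *\<^sub>R A b b) has_vector_derivative A b b) (at t)"
        by (auto intro!: derivative_eq_intros)
      ultimately have "(?f has_vector_derivative ((hat (s + t / c) * C) *\<^sub>R A b b + (dhat (s + t / c) / c * C) *\<^sub>R (w + t *\<^sub>R A b b))) (at t)"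
        by (rule has_vector_derivative_scaleR)
      then show "(?f has_vector_derivative ?f' t) (at t)" by (simp add: add.commute)
    qed simp
    moreover have "tent 0 y H (x + b) = hat (s + 1 / c) * C" "tent 0 y H x = hat s * C"
      "v b + A b (x + b - p) = w + A b b"
      using t0[of 1] t0[of 0] wt[of 1] by simp_all
    ultimately show "((\<lambda>t. tent b y H (x + t *\<^sub>R b) *\<^sub>R (v b + A b (x + t *\<^sub>R b - p)) + tent 0 y H (x + t *\<^sub>R b) *\<^sub>R A b b) has_integral
        (tent 0 y H (x + b) *\<^sub>R (v b + A b (x + b - p)) - tent 0 y H x *\<^sub>R (v b + A b (x - p)))) {0..1}"
      unfolding tb t0 wt by (simp add: w_def[symmetric])
  qed
  have "(\<integral>x. tent b y H x *\<^sub>R (v b + A b (x - p)) \<partial>lborel) = - (\<integral>x. tent 0 y H x *\<^sub>R A b b \<partial>lborel)" if "b \<in> Basis" for b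
    using z[OF that] by (subst (asm) Bochner_Integration.integral_add[OF i1[OF that] i2]) (simp add: eq_neg_iff_add_eq_0)
  then have "(\<Sum>b\<in>Basis. \<integral>x. tent b y H x *\<^sub>R (v b + A b (x - p)) \<partial>lborel) = - (\<Sum>b\<in>Basis. \<integral>x. tent 0 y H x *\<^sub>R A b b \<partial>lborel)"
    by (simp add: sum_negf)
  also have "(\<Sum>b\<in>Basis. \<integral>x. tent 0 y H x *\<^sub>R A b b \<partial>lborel) = (\<integral>x. (\<Sum>b\<in>Basis. tent 0 y H x *\<^sub>R A b b) \<partial>lborel)"
    by (rule Bochner_Integration.integral_sum[symmetric]) (rule i2)
  also have "\<dots> = 0"
    by (simp add: scaleR_sum_right[symmetric] div)
  finally show ?thesis
    by (subst Bochner_Integration.integral_sum) (auto intro: i1)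
qed

text \<open>Goursat's subdivision argument in weak form.  Tent functions refine into tent functions of half
  the size with weights of total mass \<open>2 ^ DIM('a)\<close>, so a nonzero integral persists, relative to the
  volume, along a nested sequence of boxes; at their common point the first order expansion of the
  field contradicts this, since its affine part integrates to zero.  No continuity of the
  derivatives is needed.\<close>
lemma divergence_free_tent_integral:
  fixes V :: "'a::euclidean_space \<Rightarrow> 'a \<Rightarrow> 'b::euclidean_space"
  assumes H: "\<And>b. b \<in> Basis \<Longrightarrow> H \<bullet> b > 0"
    and deriv: "\<And>b x. b \<in> Basis \<Longrightarrow> x \<in> cbox y (y + 2 *\<^sub>R H) \<Longrightarrow> (V b has_derivative V' b x) (at x)"
    and div: "\<And>x. x \<in> cbox y (y + 2 *\<^sub>R H) \<Longrightarrow> (\<Sum>b\<in>Basis. V' b x b) = 0"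
  shows "(\<integral>x. (\<Sum>b\<in>Basis. tent b y H x *\<^sub>R V b x) \<partial>lborel) = 0"
proof (rule ccontr)
  let ?N = "DIM('a)"
  define box where "box z n = cbox z (z + 2 *\<^sub>R ((1/2)^n *\<^sub>R H))" for z :: 'a and n :: nat
  define L where "L z n = (\<integral>x. (\<Sum>b\<in>Basis. tent b z ((1/2)^n *\<^sub>R H) x *\<^sub>R V b x) \<partial>lborel)" for z n
  have Hn: "((1/2)^n *\<^sub>R H) \<bullet> b > 0" if "b \<in> Basis" for b n
    using H[OF that] by simp
  have contV: "continuous_on (cbox y (y + 2 *\<^sub>R H)) (V b)" if "b \<in> Basis" for b
    using deriv[OF that] by (auto intro!: continuous_at_imp_continuous_on has_derivative_continuous)
  have int: "integrable lborel (\<lambda>x. tent b z ((1/2)^n *\<^sub>R H) x *\<^sub>R V b x)"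
    if "b \<in> Basis" "box z n \<subseteq> cbox y (y + 2 *\<^sub>R H)" for b z n
    using that continuous_on_subset[OF contV[OF that(1)]] by (intro tent_integrable Hn) (auto simp: box_def)
  assume "(\<integral>x. (\<Sum>b\<in>Basis. tent b y H x *\<^sub>R V b x) \<partial>lborel) \<noteq> 0"
  then have L0: "norm (L y 0) > 0" by (simp add: L_def)
  \<comment> \<open>A positive number strictly below the initial norm, so that the invariant is a
    strict inequality and its negation for all children can be summed to a contradiction.\<close>
  define \<epsilon> where "\<epsilon> = norm (L y 0) / 2"
  have \<epsilon>: "\<epsilon> > 0" "\<epsilon> < norm (L y 0)" using L0 by (auto simp: \<epsilon>_def)
  have step: "\<exists>z'. (box z' (Suc n) \<subseteq> cbox y (y + 2 *\<^sub>R H) \<and> norm (L z' (Suc n)) > \<epsilon> / 2 ^ (?N * Suc n)) \<and> box z' (Suc n) \<subseteq> box z n"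
    if z: "box z n \<subseteq> cbox y (y + 2 *\<^sub>R H) \<and> norm (L z n) > \<epsilon> / 2 ^ (?N * n)" for z n
  proof (rule ccontr)
    assume neg: "\<not> ?thesis"
    let ?Hn = "(1/2)^n *\<^sub>R H"
    let ?I = "PiE (Basis :: 'a set) (\<lambda>_. {0, 1, 2::nat})"
    let ?w = "\<lambda>i. \<Prod>b\<in>(Basis::'a set). tent_weight (i b)"
    have fin: "finite ?I" by (intro finite_PiE) auto
    have half: "(1/2) *\<^sub>R ?Hn = (1/2)^Suc n *\<^sub>R H" by simp
    have sub: "box (tent_child z ?Hn i) (Suc n) \<subseteq> box z n" if "i \<in> ?I" for i
    proof -
      have "cbox (tent_child z ?Hn i) (tent_child z ?Hn i + 2 *\<^sub>R ((1/2) *\<^sub>R ?Hn)) \<subseteq> cbox z (z + 2 *\<^sub>R ?Hn)"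
        by (rule tent_child_cbox[OF Hn that])
      then show ?thesis unfolding box_def half .
    qed
    have "L z n = (\<Sum>i\<in>?I. ?w i *\<^sub>R L (tent_child z ?Hn i) (Suc n))"
    proof -
      have "(\<Sum>b\<in>Basis. tent b z ?Hn x *\<^sub>R V b x) = (\<Sum>i\<in>?I. ?w i *\<^sub>R (\<Sum>b\<in>Basis. tent b (tent_child z ?Hn i) ((1/2)^Suc n *\<^sub>R H) x *\<^sub>R V b x))" for x
      proof -
        have "(\<Sum>b\<in>Basis. tent b z ?Hn x *\<^sub>R V b x) = (\<Sum>b\<in>Basis. \<Sum>i\<in>?I. ?w i *\<^sub>R (tent b (tent_child z ?Hn i) ((1/2)^Suc n *\<^sub>R H) x *\<^sub>R V b x))"
          unfolding half[symmetric]
          by (intro sum.cong refl, subst tent_refine[OF Hn]) (simp_all only: scaleR_sum_left scaleR_scaleR)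
        then show ?thesis by (subst (asm) sum.swap) (simp add: scaleR_sum_right)
      qed
      then have "L z n = (\<integral>x. (\<Sum>i\<in>?I. ?w i *\<^sub>R (\<Sum>b\<in>Basis. tent b (tent_child z ?Hn i) ((1/2)^Suc n *\<^sub>R H) x *\<^sub>R V b x)) \<partial>lborel)"
        unfolding L_def by simp
      also have "\<dots> = (\<Sum>i\<in>?I. ?w i *\<^sub>R L (tent_child z ?Hn i) (Suc n))"
        unfolding L_def
      proof (subst Bochner_Integration.integral_sum)
        show "integrable lborel (\<lambda>x. ?w i *\<^sub>R (\<Sum>b\<in>Basis. tent b (tent_child z ?Hn i) ((1/2)^Suc n *\<^sub>R H) x *\<^sub>R V b x))" if "i \<in> ?I" for i
          using sub[OF that] z by (intro integrable_scaleR_right Bochner_Integration.integrable_sum int) auto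
      qed simp
      finally show ?thesis .
    qed
    then have "norm (L z n) \<le> (\<Sum>i\<in>?I. ?w i * norm (L (tent_child z ?Hn i) (Suc n)))"
      by (auto intro!: order_trans[OF norm_sum] sum_mono simp: tent_weight_def abs_of_nonneg prod_nonneg)
    also have "\<dots> \<le> (\<Sum>i\<in>?I. ?w i * (\<epsilon> / 2 ^ (?N * Suc n)))"
    proof (intro sum_mono mult_left_mono)
      fix i assume "i \<in> ?I"
      then show "norm (L (tent_child z ?Hn i) (Suc n)) \<le> \<epsilon> / 2 ^ (?N * Suc n)"
        using neg sub z by (meson not_le order_trans)
    qed (auto simp: tent_weight_def intro!: prod_nonneg)
    \<comment> \<open>The total weight 2^N is exactly the factor by which the bound shrinks from one
      level to the next.\<close>
    also have "\<dots> = 2 ^ ?N * (\<epsilon> / 2 ^ (?N * Suc n))"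
      by (simp only: sum_distrib_right[symmetric] sum_tent_weight)
    also have "\<dots> = \<epsilon> / 2 ^ (?N * n)" by (simp add: power_add)
    finally show False using z by simp
  qed
  have "\<exists>Y. \<forall>n. (box (Y n) n \<subseteq> cbox y (y + 2 *\<^sub>R H) \<and> norm (L (Y n) n) > \<epsilon> / 2 ^ (?N * n)) \<and> box (Y (Suc n)) (Suc n) \<subseteq> box (Y n) n"
  proof (rule dependent_nat_choice)
    show "\<exists>x. box x 0 \<subseteq> cbox y (y + 2 *\<^sub>R H) \<and> \<epsilon> / 2 ^ (?N * 0) < norm (L x 0)"
      using \<epsilon> by (intro exI[of _ y]) (simp add: box_def)
  qed (use step in blast)
  then obtain Y where Y: "\<And>n. box (Y n) n \<subseteq> cbox y (y + 2 *\<^sub>R H)" "\<And>n. norm (L (Y n) n) > \<epsilon> / 2 ^ (?N * n)"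
      "\<And>n. box (Y (Suc n)) (Suc n) \<subseteq> box (Y n) n" by blast
  have "\<Inter> (range (\<lambda>n. box (Y n) n)) \<noteq> {}"
  proof (rule compact_nest)
    fix n
    have "Y n \<in> box (Y n) n"
      unfolding box_def mem_box using H by (auto simp: inner_add_left less_imp_le)
    then show "compact (box (Y n) n)" "box (Y n) n \<noteq> {}" by (auto simp: box_def)
  next
    show "box (Y n) n \<subseteq> box (Y m) m" if "m \<le> n" for m n
      using that lift_Suc_antimono_le[of "\<lambda>n. box (Y n) n", OF Y(3)] by blast
  qed
  then obtain p where p: "\<And>n. p \<in> box (Y n) n" by auto
  then have pK: "p \<in> cbox y (y + 2 *\<^sub>R H)" using Y(1) by blast
  define D where "D = (\<Sum>b\<in>(Basis::'a set). 2 * (H \<bullet> b))"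
  \<comment> \<open>The derivative bounds of the tents, the diameter bound and the volume of the
    initial box. Choosing \<eta> = \<epsilon> / C makes the final estimate reproduce \<epsilon> /
    2^(N n), against the strict invariant.\<close>
  define C where "C = (\<Sum>b\<in>(Basis::'a set). 1 / (H \<bullet> b)) * D * (\<Prod>b\<in>(Basis::'a set). 2 * (H \<bullet> b))"
  have pos: "C > 0" "D > 0"
    unfolding C_def D_def using H by (auto intro!: mult_pos_pos sum_pos prod_pos)
  define \<eta> where "\<eta> = \<epsilon> / C"
  have \<eta>: "\<eta> > 0" using \<epsilon> pos by (simp add: \<eta>_def)
  have ev: "\<forall>\<^sub>F x in nhds p. \<forall>b\<in>Basis. norm (V b x - (V b p + V' b p (x - p))) \<le> \<eta> * norm (x - p)"
  proof (rule eventually_ball_finite, simp, rule ballI)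
    fix b :: 'a assume b: "b \<in> Basis"
    from deriv[OF b pK, unfolded has_derivative_at_alt] \<eta>
    obtain d where "d > 0" "\<And>x. norm (x - p) < d \<Longrightarrow> norm (V b x - V b p - V' b p (x - p)) \<le> \<eta> * norm (x - p)" by blast
    then show "\<forall>\<^sub>F x in nhds p. norm (V b x - (V b p + V' b p (x - p))) \<le> \<eta> * norm (x - p)"
      unfolding eventually_nhds_metric by (intro exI[of _ d]) (auto simp: dist_norm algebra_simps)
  qed
  then obtain \<delta> where \<delta>: "\<delta> > 0" "\<And>x b. norm (x - p) < \<delta> \<Longrightarrow> b \<in> Basis \<Longrightarrow> norm (V b x - (V b p + V' b p (x - p))) \<le> \<eta> * norm (x - p)"
    unfolding eventually_nhds_metric dist_norm by blast
  have diam: "norm (x - p) \<le> D / 2 ^ n" if "x \<in> box (Y n) n" for x n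
  proof -
    have "norm (x - p) \<le> (\<Sum>b\<in>Basis. \<bar>(x - p) \<bullet> b\<bar>)" by (rule norm_le_l1)
    also have "\<dots> \<le> (\<Sum>b\<in>(Basis::'a set). 2 * (H \<bullet> b) / 2 ^ n)"
    proof (rule sum_mono)
      fix b :: 'a assume b: "b \<in> Basis"
      show "\<bar>(x - p) \<bullet> b\<bar> \<le> 2 * (H \<bullet> b) / 2 ^ n"
        using that p[of n] b unfolding box_def mem_box
        by (auto simp: inner_add_left inner_diff_left power_one_over abs_le_iff dest!: bspec[OF _ b])
    qed
    also have "\<dots> = D / 2 ^ n" by (simp add: D_def sum_divide_distrib)
    finally show ?thesis .
  qed
  have "(\<lambda>n. D * (1 / 2) ^ n) \<longlonglongrightarrow> D * 0"
    by (intro tendsto_intros LIMSEQ_power_zero) auto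
  then have "\<forall>\<^sub>F n in sequentially. D * (1 / 2) ^ n < \<delta>"
    using \<delta>(1) by (intro order_tendstoD(2)) auto
  then obtain n where n: "D / 2 ^ n < \<delta>"
    by (auto simp: eventually_sequentially power_one_over)
  let ?Hn = "(1/2)^n *\<^sub>R H"
  have bl: "bounded_linear (V' b p)" if "b \<in> Basis" for b
    using deriv[OF that pK] by (rule has_derivative_bounded_linear)
  let ?r = "\<lambda>b x. V b x - (V b p + V' b p (x - p))"
  have i1: "integrable lborel (\<lambda>x. \<Sum>b\<in>Basis. tent b (Y n) ?Hn x *\<^sub>R V b x)"
    by (intro Bochner_Integration.integrable_sum int Y(1))
  have i2: "integrable lborel (\<lambda>x. \<Sum>b\<in>Basis. tent b (Y n) ?Hn x *\<^sub>R (V b p + V' b p (x - p)))"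
    by (intro Bochner_Integration.integrable_sum tent_integrable Hn continuous_intros bounded_linear.continuous_on[OF bl]) auto
  have "(\<integral>x. (\<Sum>b\<in>Basis. tent b (Y n) ?Hn x *\<^sub>R (V b p + V' b p (x - p))) \<partial>lborel) = 0"
    by (rule tent_affine_integral[OF Hn bl div[OF pK]])
  then have "L (Y n) n = L (Y n) n - (\<integral>x. (\<Sum>b\<in>Basis. tent b (Y n) ?Hn x *\<^sub>R (V b p + V' b p (x - p))) \<partial>lborel)"
    by simp
  also have "\<dots> = (\<integral>x. (\<Sum>b\<in>Basis. tent b (Y n) ?Hn x *\<^sub>R ?r b x) \<partial>lborel)"
    unfolding L_def scaleR_diff_right sum_subtractf by (rule Bochner_Integration.integral_diff[OF i1 i2, symmetric])
  also have "norm \<dots> \<le> (\<integral>x. indicator (box (Y n) n) x * ((\<Sum>b\<in>(Basis::'a set). 1 / (H \<bullet> b)) * \<eta> * D) \<partial>lborel)"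
  proof (rule Bochner_Integration.integral_norm_bound_integral)
    show "integrable lborel (\<lambda>x. \<Sum>b\<in>Basis. tent b (Y n) ?Hn x *\<^sub>R ?r b x)"
      unfolding scaleR_diff_right sum_subtractf by (rule Bochner_Integration.integrable_diff[OF i1 i2])
    show "integrable lborel (\<lambda>x. indicator (box (Y n) n) x * ((\<Sum>b\<in>(Basis::'a set). 1 / (H \<bullet> b)) * \<eta> * D))"
      unfolding box_def using emeasure_bounded_finite[OF bounded_cbox, of "Y n" "Y n + 2 *\<^sub>R ?Hn"]
      by (intro integrable_mult_left integrable_real_indicator) auto
    fix x
    show "norm (\<Sum>b\<in>Basis. tent b (Y n) ?Hn x *\<^sub>R ?r b x) \<le> indicator (box (Y n) n) x * ((\<Sum>b\<in>(Basis::'a set). 1 / (H \<bullet> b)) * \<eta> * D)"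
    proof (cases "x \<in> box (Y n) n")
      case True
      have "norm (\<Sum>b\<in>Basis. tent b (Y n) ?Hn x *\<^sub>R ?r b x) \<le> (\<Sum>b\<in>(Basis::'a set). (1 / (H \<bullet> b)) * (\<eta> * D))"
      proof (rule order_trans[OF norm_sum sum_mono])
        fix b :: 'a assume b: "b \<in> Basis"
        have "norm (?r b x) \<le> \<eta> * norm (x - p)"
          using diam[OF True] n by (intro \<delta>(2) b) simp
        also have "\<dots> \<le> \<eta> * (D / 2 ^ n)"
          using diam[OF True] \<eta> by (intro mult_left_mono) auto
        finally have "norm (tent b (Y n) ?Hn x *\<^sub>R ?r b x) \<le> (1 / (?Hn \<bullet> b)) * (\<eta> * (D / 2 ^ n))"
          unfolding norm_scaleR real_norm_def using Hn[OF b, of n] by (intro mult_mono abs_tent_le(2) Hn b) auto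
        \<comment> \<open>The factor 2^n from the derivative of the small tent cancels the factor
          2^-n in the distance to p. This is why a first order expansion at the single point p is
          enough.\<close>
        also have "\<dots> = (1 / (H \<bullet> b)) * (\<eta> * D)" by (simp add: power_one_over)
        finally show "norm (tent b (Y n) ?Hn x *\<^sub>R ?r b x) \<le> (1 / (H \<bullet> b)) * (\<eta> * D)" .
      qed
      then show ?thesis using True by (simp add: sum_distrib_right mult.assoc)
    next
      case False
      then show ?thesis by (simp add: box_def tent_eq_0[OF Hn])
    qed
  qed
  also have "\<dots> = measure lborel (box (Y n) n) * ((\<Sum>b\<in>(Basis::'a set). 1 / (H \<bullet> b)) * \<eta> * D)"
    by (simp add: box_def)
  also have "measure lborel (box (Y n) n) = (\<Prod>b\<in>(Basis::'a set). 2 * (H \<bullet> b)) / 2 ^ (?N * n)"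
  proof -
    have "measure lborel (box (Y n) n) = (\<Prod>b\<in>(Basis::'a set). 2 * (?Hn \<bullet> b))"
      unfolding box_def using H
      by (subst measure_lborel_cbox_eq) (auto simp: inner_add_left less_imp_le mult.assoc)
    also have "\<dots> = (\<Prod>b\<in>(Basis::'a set). 2 * (H \<bullet> b) / 2 ^ n)" by (simp add: power_one_over)
    also have "\<dots> = (\<Prod>b\<in>(Basis::'a set). 2 * (H \<bullet> b)) / 2 ^ (?N * n)"
      by (simp only: prod_dividef prod_constant power_mult[symmetric] mult.commute)
    finally show ?thesis .
  qed
  also have "(\<Prod>b\<in>(Basis::'a set). 2 * (H \<bullet> b)) / 2 ^ (?N * n) * ((\<Sum>b\<in>(Basis::'a set). 1 / (H \<bullet> b)) * \<eta> * D) = \<eta> * C / 2 ^ (?N * n)"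
    unfolding C_def by simp
  also have "\<eta> * C = \<epsilon>" using pos by (simp add: \<eta>_def)
  finally show False using Y(2)[of n] by simp
qed

section \<open>Functions represented by the exponential kernel\<close>

text \<open>On the convex set S the derivative bound becomes, by the mean value inequality, a
  Lipschitz bound with the same w. The remainder quotients are thus dominated by 2 w, and dominated
  convergence applies along sequences.\<close>

lemma has_derivative_lborel_integral:
  fixes \<Phi> :: "'a::real_normed_vector \<Rightarrow> 'c::euclidean_space \<Rightarrow> 'b::euclidean_space"
  assumes S: "open S" "convex S" "x \<in> S"
    and deriv: "\<And>z \<xi>. z \<in> S \<Longrightarrow> ((\<lambda>z. \<Phi> z \<xi>) has_derivative \<Phi>' z \<xi>) (at z)"
    and bound: "\<And>z \<xi> v. z \<in> S \<Longrightarrow> norm (\<Phi>' z \<xi> v) \<le> w \<xi> * norm v"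
    and w: "integrable lborel w" "\<And>\<xi>. w \<xi> \<ge> 0" and int: "\<And>z. z \<in> S \<Longrightarrow> integrable lborel (\<Phi> z)"
    and meas: "\<And>v. (\<lambda>\<xi>. \<Phi>' x \<xi> v) \<in> borel_measurable borel"
  shows "integrable lborel (\<lambda>\<xi>. \<Phi>' x \<xi> v)"
    and "((\<lambda>z. \<integral>\<xi>. \<Phi> z \<xi> \<partial>lborel) has_derivative (\<lambda>v. \<integral>\<xi>. \<Phi>' x \<xi> v \<partial>lborel)) (at x)"
proof -
  have i': "integrable lborel (\<lambda>\<xi>. \<Phi>' x \<xi> v)" for v
  proof (rule Bochner_Integration.integrable_bound)
    show "integrable lborel (\<lambda>\<xi>. w \<xi> * norm v)" using w by simp
    show "AE \<xi> in lborel. norm (\<Phi>' x \<xi> v) \<le> norm (w \<xi> * norm v)"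
      using bound[OF S(3)] by (intro AE_I2) (auto intro: order_trans[OF _ abs_ge_self])
  qed (use meas in simp)
  then show "integrable lborel (\<lambda>\<xi>. \<Phi>' x \<xi> v)" .
  have lin: "linear (\<Phi>' x \<xi>)" for \<xi>
    using deriv[OF S(3)] by (rule has_derivative_linear)
  have bl: "bounded_linear (\<lambda>v. \<integral>\<xi>. \<Phi>' x \<xi> v \<partial>lborel)"
  proof (rule bounded_linear_intro)
    show "(\<integral>\<xi>. \<Phi>' x \<xi> (u + v) \<partial>lborel) = (\<integral>\<xi>. \<Phi>' x \<xi> u \<partial>lborel) + (\<integral>\<xi>. \<Phi>' x \<xi> v \<partial>lborel)" for u v
      by (simp add: linear_add[OF lin] i')
    show "(\<integral>\<xi>. \<Phi>' x \<xi> (r *\<^sub>R v) \<partial>lborel) = r *\<^sub>R (\<integral>\<xi>. \<Phi>' x \<xi> v \<partial>lborel)" for r v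
      by (simp add: linear_scale[OF lin])
    show "norm (\<integral>\<xi>. \<Phi>' x \<xi> v \<partial>lborel) \<le> norm v * (\<integral>\<xi>. w \<xi> \<partial>lborel)" for v
    proof -
      have "norm (\<integral>\<xi>. \<Phi>' x \<xi> v \<partial>lborel) \<le> (\<integral>\<xi>. w \<xi> * norm v \<partial>lborel)"
        using w bound[OF S(3)] by (intro Bochner_Integration.integral_norm_bound_integral i') auto
      then show ?thesis by (simp add: mult.commute)
    qed
  qed
  have lip: "norm (\<Phi> z \<xi> - \<Phi> x \<xi>) \<le> w \<xi> * norm (z - x)" if "z \<in> S" for z \<xi>
  proof (rule differentiable_bound[OF S(2) _ _ that S(3)])
    show "((\<lambda>z. \<Phi> z \<xi>) has_derivative \<Phi>' z \<xi>) (at z within S)" if "z \<in> S" for z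
      using deriv[OF that] by (rule has_derivative_at_withinI)
    show "onorm (\<Phi>' z \<xi>) \<le> w \<xi>" if "z \<in> S" for z
      using bound[OF that] w(2) by (intro onorm_bound) auto
  qed
  have lim: "((\<lambda>h. norm ((\<integral>\<xi>. \<Phi> (x + h) \<xi> \<partial>lborel) - (\<integral>\<xi>. \<Phi> x \<xi> \<partial>lborel) - (\<integral>\<xi>. \<Phi>' x \<xi> h \<partial>lborel)) / norm h) \<longlongrightarrow> 0) (at 0)"
    unfolding tendsto_at_iff_sequentially comp_def
  proof (intro allI impI)
    fix X :: "nat \<Rightarrow> 'a" assume X0: "\<forall>i. X i \<in> UNIV - {0}" and X: "X \<longlonglongrightarrow> 0"
    have "(\<lambda>n. x + X n) \<longlonglongrightarrow> x + 0" by (intro tendsto_intros X)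
    then have "\<forall>\<^sub>F n in sequentially. x + X n \<in> S"
      using S by (intro topological_tendstoD) auto
    then obtain N where N: "\<And>n. n \<ge> N \<Longrightarrow> x + X n \<in> S" by (auto simp: eventually_sequentially)
    \<comment> \<open>Dropping the first N terms keeps x + h n in S for all n.\<close>
    define h where "h n = X (n + N)" for n
    have h: "x + h n \<in> S" "h n \<noteq> 0" "h \<longlonglongrightarrow> 0" for n
      using N[of "n + N"] X0 LIMSEQ_ignore_initial_segment[OF X, of N] by (auto simp: h_def[abs_def])
    let ?r = "\<lambda>n \<xi>. \<Phi> (x + h n) \<xi> - \<Phi> x \<xi> - \<Phi>' x \<xi> (h n)"
    have ri: "integrable lborel (?r n)" for n
      by (intro Bochner_Integration.integrable_diff int h S i')
    have "(\<lambda>n. \<integral>\<xi>. norm (?r n \<xi>) / norm (h n) \<partial>lborel) \<longlonglongrightarrow> (\<integral>\<xi>. 0 \<partial>(lborel :: 'c measure))"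
    proof (rule integral_dominated_convergence[where w="\<lambda>\<xi>. 2 * w \<xi>"])
      show "AE \<xi> in lborel. (\<lambda>n. norm (?r n \<xi>) / norm (h n)) \<longlonglongrightarrow> 0"
      proof (rule AE_I2)
        fix \<xi>
        have "((\<lambda>h. norm (\<Phi> (x + h) \<xi> - \<Phi> x \<xi> - \<Phi>' x \<xi> h) / norm h) \<longlongrightarrow> 0) (at 0)"
          using deriv[OF S(3), of \<xi>] unfolding has_derivative_at by blast
        then show "(\<lambda>n. norm (?r n \<xi>) / norm (h n)) \<longlonglongrightarrow> 0"
          unfolding tendsto_at_iff_sequentially comp_def using h by auto
      qed
      fix n
      show "AE \<xi> in lborel. norm (norm (?r n \<xi>) / norm (h n)) \<le> 2 * w \<xi>"
      proof (rule AE_I2)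
        fix \<xi>
        have "norm (?r n \<xi>) \<le> norm (\<Phi> (x + h n) \<xi> - \<Phi> x \<xi>) + norm (\<Phi>' x \<xi> (h n))"
          by (rule norm_triangle_ineq4)
        also have "\<dots> \<le> w \<xi> * norm (h n) + w \<xi> * norm (h n)"
          using lip[OF h(1)[of n], of \<xi>] bound[OF S(3), of \<xi> "h n"] by (intro add_mono) auto
        finally show "norm (norm (?r n \<xi>) / norm (h n)) \<le> 2 * w \<xi>"
          using h(2)[of n] by (simp add: field_simps)
      qed
    qed (use w ri in \<open>auto intro: borel_measurable_integrable\<close>)
    then have "(\<lambda>n. (\<integral>\<xi>. norm (?r n \<xi>) \<partial>lborel) / norm (h n)) \<longlonglongrightarrow> 0" by simp
    moreover have "norm (norm ((\<integral>\<xi>. \<Phi> (x + h n) \<xi> \<partial>lborel) - (\<integral>\<xi>. \<Phi> x \<xi> \<partial>lborel) - (\<integral>\<xi>. \<Phi>' x \<xi> (h n) \<partial>lborel)) / norm (h n))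
       \<le> (\<integral>\<xi>. norm (?r n \<xi>) \<partial>lborel) / norm (h n)" for n
    proof -
      have "(\<integral>\<xi>. \<Phi> (x + h n) \<xi> \<partial>lborel) - (\<integral>\<xi>. \<Phi> x \<xi> \<partial>lborel) - (\<integral>\<xi>. \<Phi>' x \<xi> (h n) \<partial>lborel) = (\<integral>\<xi>. ?r n \<xi> \<partial>lborel)"
        using int[OF h(1)] int[OF S(3)] i' by simp
      also have "norm \<dots> \<le> (\<integral>\<xi>. norm (?r n \<xi>) \<partial>lborel)" by (rule integral_norm_bound)
      finally show ?thesis by (simp add: divide_right_mono)
    qed
    ultimately have "(\<lambda>n. norm ((\<integral>\<xi>. \<Phi> (x + h n) \<xi> \<partial>lborel) - (\<integral>\<xi>. \<Phi> x \<xi> \<partial>lborel) - (\<integral>\<xi>. \<Phi>' x \<xi> (h n) \<partial>lborel)) / norm (h n)) \<longlonglongrightarrow> 0"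
      by (rule Lim_null_comparison[rotated, OF _ always_eventually[OF allI]])
    then show "(\<lambda>n. norm ((\<integral>\<xi>. \<Phi> (x + X n) \<xi> \<partial>lborel) - (\<integral>\<xi>. \<Phi> x \<xi> \<partial>lborel) - (\<integral>\<xi>. \<Phi>' x \<xi> (X n) \<partial>lborel)) / norm (X n)) \<longlonglongrightarrow> 0"
      unfolding h_def by (rule LIMSEQ_offset)
  qed
  show "((\<lambda>z. \<integral>\<xi>. \<Phi> z \<xi> \<partial>lborel) has_derivative (\<lambda>v. \<integral>\<xi>. \<Phi>' x \<xi> v \<partial>lborel)) (at x)"
    unfolding has_derivative_at using bl lim by blast
qed

text \<open>The strict inequality s < a leaves some exponential room. It is spent on the factor
  |\<xi>| that differentiation produces and on passing from square integrability to
  integrability.\<close>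

definition exp_weighted :: "real \<Rightarrow> ((real, 'n::finite) vec \<Rightarrow> 'm::finite cliff) \<Rightarrow> bool" where
  "exp_weighted a g \<longleftrightarrow> g \<in> borel_measurable borel \<and>
     (\<forall>s<a. integrable lborel (\<lambda>\<xi>. exp (2 * s * norm \<xi>) * (norm (g \<xi>))\<^sup>2))"

lemma exp_weighted_measurable: "exp_weighted a g \<Longrightarrow> g \<in> borel_measurable borel"
  by (simp add: exp_weighted_def)

lemma exp_weighted_integrable:
  assumes g: "exp_weighted a g" and "s < a"
  shows "integrable lborel (\<lambda>\<xi>. (1 + norm \<xi>) * exp (s * norm \<xi>) * norm (g \<xi>))"
proof -
  note [measurable] = exp_weighted_measurable[OF g]
  \<comment> \<open>Half of the gap: s + \<delta> is still below a, and exp (- \<delta> |\<xi>|) is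
    integrable.\<close>
  define \<delta> where "\<delta> = (a - s) / 2"
  have \<delta>: "\<delta> > 0" "s + \<delta> < a" using \<open>s < a\<close> by (auto simp: \<delta>_def field_simps)
  \<comment> \<open>Chosen so that 1 + r \<le> C * (1 + \<delta> r / 2), which is at most C * exp
    (\<delta> r / 2).\<close>
  define C where "C = 1 + 2 / \<delta>"
  have C: "C > 0" using \<delta> by (simp add: C_def add_pos_pos)
  show ?thesis
  proof (rule Bochner_Integration.integrable_bound)
    show "integrable lborel (\<lambda>\<xi>. exp (2 * (s + \<delta>) * norm \<xi>) * (norm (g \<xi>))\<^sup>2 + C\<^sup>2 * exp (- \<delta> * norm \<xi>))"
      using g \<delta> by (intro Bochner_Integration.integrable_add integrable_mult_right integrable_exp_norm) (auto simp: exp_weighted_def)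
    show "AE \<xi> in lborel. norm ((1 + norm \<xi>) * exp (s * norm \<xi>) * norm (g \<xi>))
       \<le> norm (exp (2 * (s + \<delta>) * norm \<xi>) * (norm (g \<xi>))\<^sup>2 + C\<^sup>2 * exp (- \<delta> * norm \<xi>))"
    proof (rule AE_I2)
      fix \<xi> :: "(real, 'a) vec"
      define r where "r = norm \<xi>"
      have r: "r \<ge> 0" by (simp add: r_def)
      have "1 + r \<le> C * exp (\<delta> * r / 2)"
      proof -
        have "1 + r \<le> C * (1 + \<delta> * r / 2)"
          using \<delta> r by (simp add: C_def field_simps add_increasing)
        also have "\<dots> \<le> C * exp (\<delta> * r / 2)"
          using C by (intro mult_left_mono exp_ge_add_one_self) auto
        finally show ?thesis .
      qed
      then have "(1 + r) * exp (s * r) * norm (g \<xi>) \<le> (C * exp (\<delta> * r / 2)) * exp (s * r) * norm (g \<xi>)"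
        by (intro mult_right_mono) auto
      also have "\<dots> = (exp ((s + \<delta>) * r) * norm (g \<xi>)) * (C * exp (- \<delta> * r / 2))"
        by (simp add: algebra_simps flip: exp_add)
      also have "\<dots> \<le> (exp ((s + \<delta>) * r) * norm (g \<xi>))\<^sup>2 + (C * exp (- \<delta> * r / 2))\<^sup>2"
      proof -
        let ?x = "exp ((s + \<delta>) * r) * norm (g \<xi>)" and ?y = "C * exp (- \<delta> * r / 2)"
        have "?x * ?y \<ge> 0" using C by simp
        then show ?thesis using sum_squares_bound[of ?x ?y] by linarith
      qed
      also have "\<dots> = exp (2 * (s + \<delta>) * r) * (norm (g \<xi>))\<^sup>2 + C\<^sup>2 * exp (- \<delta> * r)"
        by (simp add: power_mult_distrib exp_double[symmetric] mult.assoc)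
      finally show "norm ((1 + norm \<xi>) * exp (s * norm \<xi>) * norm (g \<xi>))
         \<le> norm (exp (2 * (s + \<delta>) * norm \<xi>) * (norm (g \<xi>))\<^sup>2 + C\<^sup>2 * exp (- \<delta> * norm \<xi>))"
        using r by (simp add: r_def abs_of_nonneg)
    qed
  qed measurable
qed

lemma exp_weighted_exp:
  assumes g: "exp_weighted a g" and t: "\<bar>t\<bar> < a"
  shows "integrable lborel (\<lambda>\<xi>. cl_exp t \<xi> \<odot> g \<xi>)" and "L2 (\<lambda>\<xi>. cl_exp t \<xi> \<odot> g \<xi>)"
proof -
  note [measurable] = exp_weighted_measurable[OF g]
  show "integrable lborel (\<lambda>\<xi>. cl_exp t \<xi> \<odot> g \<xi>)"
  proof (rule Bochner_Integration.integrable_bound[OF exp_weighted_integrable[OF g t]])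
    show "AE \<xi> in lborel. norm (cl_exp t \<xi> \<odot> g \<xi>) \<le> norm ((1 + norm \<xi>) * exp (\<bar>t\<bar> * norm \<xi>) * norm (g \<xi>))"
    proof (rule AE_I2)
      fix \<xi>
      have "norm (cl_exp t \<xi> \<odot> g \<xi>) \<le> 1 * (exp (\<bar>t\<bar> * norm \<xi>) * norm (g \<xi>))"
        using norm_cl_exp_le by simp
      also have "\<dots> \<le> (1 + norm \<xi>) * (exp (\<bar>t\<bar> * norm \<xi>) * norm (g \<xi>))"
        by (intro mult_right_mono) auto
      finally show "norm (cl_exp t \<xi> \<odot> g \<xi>) \<le> norm ((1 + norm \<xi>) * exp (\<bar>t\<bar> * norm \<xi>) * norm (g \<xi>))"
        by (simp add: mult.assoc)
    qed
  qed measurable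
  have "integrable lborel (\<lambda>\<xi>. (norm (cl_exp t \<xi> \<odot> g \<xi>))\<^sup>2)"
  proof (rule Bochner_Integration.integrable_bound)
    show "integrable lborel (\<lambda>\<xi>. exp (2 * \<bar>t\<bar> * norm \<xi>) * (norm (g \<xi>))\<^sup>2)"
      using g t by (simp add: exp_weighted_def)
    show "AE \<xi> in lborel. norm ((norm (cl_exp t \<xi> \<odot> g \<xi>))\<^sup>2) \<le> norm (exp (2 * \<bar>t\<bar> * norm \<xi>) * (norm (g \<xi>))\<^sup>2)"
    proof (rule AE_I2)
      fix \<xi>
      have "(norm (cl_exp t \<xi> \<odot> g \<xi>))\<^sup>2 \<le> (exp (\<bar>t\<bar> * norm \<xi>) * norm (g \<xi>))\<^sup>2"
        by (intro power_mono norm_cl_exp_le) auto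
      then show "norm ((norm (cl_exp t \<xi> \<odot> g \<xi>))\<^sup>2) \<le> norm (exp (2 * \<bar>t\<bar> * norm \<xi>) * (norm (g \<xi>))\<^sup>2)"
        by (simp add: power_mult_distrib exp_double[symmetric] mult.assoc)
    qed
  qed measurable
  then show "L2 (\<lambda>\<xi>. cl_exp t \<xi> \<odot> g \<xi>)" unfolding L2_def by simp
qed

text \<open>The integral of the theorem without its normalising constant. Its kernel differs from
  \<open>e_ker\<close> only at the null set \<xi> = 0, where \<open>e_ker\<close> is set to
  0.\<close>

definition cl_rep :: "((real, 'n::{finite,linorder}) vec \<Rightarrow> 'n cliff) \<Rightarrow> real \<times> (real, 'n) vec \<Rightarrow> 'n cliff" where
  "cl_rep g x = (\<integral>\<xi>. exp (\<i> * of_real (snd x \<bullet> \<xi>)) *s (cl_exp (fst x) \<xi> \<odot> g \<xi>) \<partial>lborel)"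

lemma AE_lborel_nonzero: "AE x in lborel. x \<noteq> (0::'a::euclidean_space)"
  by (rule AE_lborel_singleton)

lemma e_ker_integral: 
  fixes g :: "(real, 'n::{finite,linorder}) vec \<Rightarrow> 'n cliff"
  assumes [measurable]: "g \<in> borel_measurable borel"
  shows "(\<integral>\<xi>. e_ker x \<xi> \<odot> g \<xi> \<partial>lborel) = cl_rep g x"
proof -
  have eq: "e_ker x \<xi> = (if \<xi> = 0 then 0 else exp (\<i> * of_real (snd x \<bullet> \<xi>)) *s cl_exp (fst x) \<xi>)" for \<xi>
    by (simp add: e_ker_eq) (simp add: e_ker_def e_plus_def e_minus_def)
  show ?thesis
    unfolding cl_rep_def eq
  proof (rule integral_cong_AE)
    show "AE \<xi> in lborel. (if \<xi> = 0 then 0 else exp (\<i> * of_real (snd x \<bullet> \<xi>)) *s cl_exp (fst x) \<xi>) \<odot> g \<xi>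
       = exp (\<i> * of_real (snd x \<bullet> \<xi>)) *s (cl_exp (fst x) \<xi> \<odot> g \<xi>)"
      using AE_lborel_nonzero by eventually_elim (simp add: cl_mult_scale)
  qed measurable
qed

text \<open>An inverse transform is a forward transform at - x; so the bound for
  \<open>fourier1\<close> also controls the slices of represented functions.\<close>

lemma cl_rep_fourier1: "cl_rep g (t, x) = fourier1 (\<lambda>\<xi>. cl_exp t \<xi> \<odot> g \<xi>) (- x)"
  by (simp add: cl_rep_def fourier1_def inner_commute)

lemma cl_vec_cl_exp: "cl_vec \<xi> \<odot> (cl_exp t \<xi> \<odot> y) = cl_exp t \<xi> \<odot> (cl_vec \<xi> \<odot> y)"
  by (simp add: cl_exp_mult cl.diff_right cl.scaleR_right cl_mult_scale)

lemma cl_exp_commute: "cl_exp t \<xi> \<odot> cl_vec \<xi> = cl_vec \<xi> \<odot> cl_exp t \<xi>"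
  using cl_vec_cl_exp[of \<xi> t cl_one] by simp

text \<open>The derivative of the kernel at z in direction v: the phase contributes i <v, \<xi>>,
  the exponential contributes - i v0 \<xi>.\<close>

definition cl_dker :: "real \<times> (real, 'n::{finite,linorder}) vec \<Rightarrow> (real, 'n) vec \<Rightarrow> 'n cliff \<Rightarrow> real \<times> (real, 'n) vec \<Rightarrow> 'n cliff" where
  "cl_dker z \<xi> y v = exp (\<i> * of_real (snd z \<bullet> \<xi>)) *s
     ((\<i> * of_real (snd v \<bullet> \<xi>)) *s (cl_exp (fst z) \<xi> \<odot> y) - (\<i> * of_real (fst v)) *s (cl_vec \<xi> \<odot> (cl_exp (fst z) \<xi> \<odot> y)))"

lemma kernel_has_derivative:
  "((\<lambda>z. exp (\<i> * of_real (snd z \<bullet> \<xi>)) *s (cl_exp (fst z) \<xi> \<odot> y)) has_derivative cl_dker z \<xi> y) (at z)"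
proof -
  let ?r = "norm \<xi>"
  let ?e = "\<lambda>z. exp (\<i> * complex_of_real (snd z \<bullet> \<xi>))"
  let ?c = "\<lambda>z::real \<times> (real, 'a) vec. cosh (fst z * ?r)" and ?s = "\<lambda>z::real \<times> (real, 'a) vec. sinh (fst z * ?r) / ?r"
  have e: "(?e has_derivative (\<lambda>v. ?e z * (\<i> * of_real (snd v \<bullet> \<xi>)))) (at z)"
  proof -
    have "((\<lambda>z. \<i> * complex_of_real (snd z \<bullet> \<xi>)) has_derivative (\<lambda>v. \<i> * of_real (snd v \<bullet> \<xi>))) (at z)"
      by (intro has_derivative_mult_right has_derivative_of_real has_derivative_inner_left has_derivative_snd has_derivative_ident)
    from has_derivative_compose[OF this, of exp "(*) (?e z)"] DERIV_exp[of "\<i> * complex_of_real (snd z \<bullet> \<xi>)"]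
    show ?thesis by (simp add: has_field_derivative_def)
  qed
  have 0: "((\<lambda>z::real \<times> (real, 'a) vec. fst z * ?r) has_derivative (\<lambda>v. fst v * ?r)) (at z)"
    by (auto intro!: derivative_eq_intros)
  have "(?c has_derivative (\<lambda>v. sinh (fst z * ?r) * (fst v * ?r))) (at z)"
    using has_derivative_compose[OF 0, of cosh "(*) (sinh (fst z * ?r))"] has_field_derivative_cosh[OF DERIV_ident, of "fst z * ?r" UNIV]
    by (simp add: has_field_derivative_def)
  moreover have "(?s has_derivative (\<lambda>v. cosh (fst z * ?r) * (fst v * ?r) / ?r)) (at z)"
  proof -
    have "((\<lambda>z::real \<times> (real, 'a) vec. sinh (fst z * ?r)) has_derivative (\<lambda>v. cosh (fst z * ?r) * (fst v * ?r))) (at z)"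
      using has_derivative_compose[OF 0, of sinh "(*) (cosh (fst z * ?r))"] has_field_derivative_sinh[OF DERIV_ident, of "fst z * ?r" UNIV]
      by (simp add: has_field_derivative_def)
    then show ?thesis
      by (rule bounded_linear.has_derivative[OF bounded_linear_divide])
  qed
  ultimately have "((\<lambda>z. (?c z *\<^sub>R y - (\<i> * of_real (?s z)) *s (cl_vec \<xi> \<odot> y))) has_derivative
     (\<lambda>v. (sinh (fst z * ?r) * (fst v * ?r)) *\<^sub>R y - (\<i> * of_real (cosh (fst z * ?r) * (fst v * ?r) / ?r)) *s (cl_vec \<xi> \<odot> y))) (at z)"
    by (intro has_derivative_diff has_derivative_scaleR_left bounded_linear.has_derivative[OF vsmult.bounded_linear_left]
        has_derivative_mult_right has_derivative_of_real)
  from vsmult.FDERIV[OF e this]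
  have d1: "((\<lambda>z. ?e z *s (cl_exp (fst z) \<xi> \<odot> y)) has_derivative
     (\<lambda>v. ?e z *s ((sinh (fst z * ?r) * (fst v * ?r)) *\<^sub>R y - (\<i> * of_real (cosh (fst z * ?r) * (fst v * ?r) / ?r)) *s (cl_vec \<xi> \<odot> y))
       + (?e z * (\<i> * of_real (snd v \<bullet> \<xi>))) *s (cl_exp (fst z) \<xi> \<odot> y))) (at z)"
    unfolding cl_exp_mult .
  \<comment> \<open>The time derivative of exp (- i t \<xi>) is - i \<xi> exp (- i t \<xi>). At
    \<xi> = 0, where the quotient sinh / r is a division by zero, both sides vanish.\<close>
  have d2: "(sinh (fst z * ?r) * (fst v * ?r)) *\<^sub>R y - (\<i> * of_real (cosh (fst z * ?r) * (fst v * ?r) / ?r)) *s (cl_vec \<xi> \<odot> y)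
     = - ((\<i> * of_real (fst v)) *s (cl_vec \<xi> \<odot> (cl_exp (fst z) \<xi> \<odot> y)))" for v
  proof (cases "\<xi> = 0")
    case True
    then have "cl_vec \<xi> = 0" using linear_0[OF cl_vec_linear] by simp
    then show ?thesis using True by (simp add: cl.zero_left)
  next
    case False
    have "(\<i> * of_real (fst v)) *s (cl_vec \<xi> \<odot> (cl_exp (fst z) \<xi> \<odot> y))
       = (\<i> * of_real (fst v)) *s (cosh (fst z * ?r) *\<^sub>R (cl_vec \<xi> \<odot> y) + (\<i> * of_real (sinh (fst z * ?r) / ?r)) *s (?r\<^sup>2 *\<^sub>R y))"
      unfolding cl_exp_mult cl.diff_right cl.scaleR_right cl_mult_scale cl_vec_square vsmult.minus_right diff_minus_eq_add ..
    also have "\<dots> = (\<i> * of_real (cosh (fst z * ?r) * fst v)) *s (cl_vec \<xi> \<odot> y) - (sinh (fst z * ?r) * (fst v * ?r)) *\<^sub>R y"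
    proof -
      have *: "\<i> * of_real f * (of_real c * X + \<i> * of_real (s / r) * (of_real (r\<^sup>2) * Y)) = \<i> * of_real (c * f) * X - of_real (s * (f * r)) * Y"
        if "r \<noteq> 0" for f c s r :: real and X Y :: complex
        using that by (simp add: field_simps power2_eq_square)
      show ?thesis
        unfolding vec_eq_iff using False
        by (simp only: vector_component scaleR_conv_of_real[where 'a=complex] * norm_eq_zero simp_thms not_False_eq_True)
    qed
    finally show ?thesis using False by simp
  qed
  from d1[unfolded d2] show ?thesis
    unfolding cl_dker_def[abs_def] vsmult.diff_right vector_smult_assoc vsmult.minus_right by (simp add: algebra_simps)
qed

lemma norm_cl_dker_le:
  "norm (cl_dker z \<xi> y v) \<le> 2 * ((1 + norm \<xi>) * exp (\<bar>fst z\<bar> * norm \<xi>) * norm y) * norm v"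
proof -
  let ?u = "cl_exp (fst z) \<xi> \<odot> y"
  have "norm (cl_dker z \<xi> y v) \<le> \<bar>snd v \<bullet> \<xi>\<bar> * norm ?u + \<bar>fst v\<bar> * (norm \<xi> * norm ?u)"
    unfolding cl_dker_def norm_vsmult[of "exp _"] using norm_triangle_ineq4[of "(\<i> * of_real (snd v \<bullet> \<xi>)) *s ?u" "(\<i> * of_real (fst v)) *s (cl_vec \<xi> \<odot> ?u)"]
    by (simp add: norm_mult)
  also have "\<dots> \<le> (norm v * norm \<xi>) * norm ?u + norm v * (norm \<xi> * norm ?u)"
  proof (intro add_mono mult_right_mono)
    have "\<bar>snd v \<bullet> \<xi>\<bar> \<le> norm (snd v) * norm \<xi>" by (rule Cauchy_Schwarz_ineq2)
    also have "\<dots> \<le> norm v * norm \<xi>" using norm_snd_le[of "snd v" "fst v"] by (intro mult_right_mono) auto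
    finally show "\<bar>snd v \<bullet> \<xi>\<bar> \<le> norm v * norm \<xi>" .
    show "\<bar>fst v\<bar> \<le> norm v" using norm_fst_le[of "fst v" "snd v"] by simp
  qed auto
  also have "\<dots> = 2 * norm v * (norm \<xi> * norm ?u)" by simp
  also have "\<dots> \<le> 2 * norm v * ((1 + norm \<xi>) * (exp (\<bar>fst z\<bar> * norm \<xi>) * norm y))"
    by (intro mult_left_mono mult_mono norm_cl_exp_le) auto
  finally show ?thesis by (simp add: mult_ac)
qed

lemma open_strip: "open (strip a :: (real \<times> (real, 'n::finite) vec) set)" and convex_strip: "convex (strip a :: (real \<times> (real, 'n::finite) vec) set)"
proof -
  have e: "strip a = fst -` {-a<..<a :: real}" by (auto simp: strip_def)
  show "open (strip a :: (real \<times> (real, 'n::finite) vec) set)"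
    unfolding e by (intro open_vimage_fst) auto
  show "convex (strip a :: (real \<times> (real, 'n::finite) vec) set)"
    unfolding e by (intro convex_linear_vimage linear_fst) (auto simp: convex_real_interval)
qed

lemma cl_rep_has_derivative:
  fixes g :: "(real, 'n::{finite,linorder}) vec \<Rightarrow> 'n cliff"
  assumes g: "exp_weighted a g" and x: "x \<in> strip a"
  shows "integrable lborel (\<lambda>\<xi>. cl_dker x \<xi> (g \<xi>) v)"
    and "(cl_rep g has_derivative (\<lambda>v. \<integral>\<xi>. cl_dker x \<xi> (g \<xi>) v \<partial>lborel)) (at x)"
proof -
  note [measurable] = exp_weighted_measurable[OF g]
  \<comment> \<open>The narrower strip is a convex neighbourhood of x on which one dominating
    function serves all points.\<close>
  define s where "s = (\<bar>fst x\<bar> + a) / 2"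
  have s: "\<bar>fst x\<bar> < s" "s < a" using x by (auto simp: s_def strip_def)
  let ?w = "\<lambda>\<xi>. 2 * ((1 + norm \<xi>) * exp (s * norm \<xi>) * norm (g \<xi>))"
  have wi: "integrable lborel ?w" using exp_weighted_integrable[OF g s(2)] by simp
  have xs: "x \<in> strip s" using s by (simp add: strip_def)
  have bound: "norm (cl_dker z \<xi> (g \<xi>) v) \<le> ?w \<xi> * norm v" if "z \<in> strip s" for z \<xi> v
  proof -
    have "exp (\<bar>fst z\<bar> * norm \<xi>) \<le> exp (s * norm \<xi>)"
      using that by (auto simp: strip_def intro!: mult_right_mono)
    then show ?thesis
      by (intro order_trans[OF norm_cl_dker_le] mult_right_mono mult_left_mono) auto
  qed
  have int: "integrable lborel (\<lambda>\<xi>. exp (\<i> * of_real (snd z \<bullet> \<xi>)) *s (cl_exp (fst z) \<xi> \<odot> g \<xi>))" if "z \<in> strip s" for z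
  proof -
    have "\<bar>fst z\<bar> < a" using that s by (simp add: strip_def)
    from exp_weighted_exp(1)[OF g this] show ?thesis
      by (rule Bochner_Integration.integrable_bound) auto
  qed
  have meas: "(\<lambda>\<xi>. cl_dker x \<xi> (g \<xi>) v) \<in> borel_measurable borel" for v
    unfolding cl_dker_def by measurable
  note D = has_derivative_lborel_integral[OF open_strip convex_strip xs kernel_has_derivative bound wi _ int meas]
  show "integrable lborel (\<lambda>\<xi>. cl_dker x \<xi> (g \<xi>) v)" by (rule D(1)) auto
  show "(cl_rep g has_derivative (\<lambda>v. \<integral>\<xi>. cl_dker x \<xi> (g \<xi>) v \<partial>lborel)) (at x)"
    unfolding cl_rep_def[abs_def] by (rule D(2)) auto
qed

text \<open>\<open>cl_para\<close> embeds \<open>\<real>\<^sup>m\<^sup>+\<^sup>1\<close> as paravectors, so that the Cauchy-Riemann operator applied to \<open>F\<close> is the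
  sum of \<open>cl_para b \<odot> F' b\<close> over the standard basis.\<close>
definition cl_para :: "real \<times> (real, 'n::{finite,linorder}) vec \<Rightarrow> 'n cliff" where
  "cl_para b = fst b *\<^sub>R cl_one + cl_vec (snd b)"

lemma sum_Basis_strip:
  fixes F :: "real \<times> (real, 'n::{finite,linorder}) vec \<Rightarrow> 'b::comm_monoid_add"
  shows "(\<Sum>b\<in>Basis. F b) = F (1, 0) + (\<Sum>j\<in>UNIV. F (0, axis j 1))"
proof -
  have B: "(Basis :: (real \<times> (real, 'n) vec) set) = insert (1, 0) (range (\<lambda>j. (0, axis j 1)))"
    unfolding Basis_prod_def Basis_vec_def by auto
  have "inj (\<lambda>j::'n. (0::real, axis j (1::real)))" by (auto simp: inj_def axis_eq_axis)
  then show ?thesis unfolding B by (subst sum.insert) (auto simp: sum.reindex axis_eq_0_iff)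
qed

lemma cl_para_simps [simp]: "cl_para (1, 0) = cl_one" "cl_para (0, axis j 1) = cl_e j"
  by (simp_all add: cl_para_def linear_0[OF cl_vec_linear])

text \<open>The space directions add up to multiplication by i \<xi>, the time direction contributes
  - i \<xi>.\<close>

lemma cl_dker_monogenic:
  "(\<Sum>b\<in>Basis. cl_para b \<odot> cl_dker z \<xi> y b) = 0"
proof -
  let ?u = "cl_exp (fst z) \<xi> \<odot> y"
  have "(\<Sum>j\<in>UNIV. cl_e j \<odot> cl_dker z \<xi> y (0, axis j 1)) = exp (\<i> * of_real (snd z \<bullet> \<xi>)) *s (\<i> *s (cl_vec \<xi> \<odot> ?u))"
  proof -
    have "cl_e j \<odot> cl_dker z \<xi> y (0, axis j 1) = exp (\<i> * of_real (snd z \<bullet> \<xi>)) *s (\<i> *s ((\<xi> $ j) *\<^sub>R (cl_e j \<odot> ?u)))" for j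
      unfolding cl_dker_def cl_mult_scale by (simp add: inner_axis' cl_mult_scale vec_eq_iff scaleR_conv_of_real[where 'a=complex])
    then show ?thesis by (simp add: vsmult.sum_right[symmetric] cl_vec_mult)
  qed
  then show ?thesis
    by (simp add: sum_Basis_strip) (simp add: cl_dker_def vec_eq_iff)
qed

text \<open>A scalar spectrum leaves only \<open>cl_exp\<close>, which commutes with \<xi>; so it
  does not matter on which side the operator acts.\<close>

lemma cl_dker_right_monogenic:
  "(\<Sum>b\<in>Basis. cl_dker z \<xi> (c *\<^sub>R cl_one) b \<odot> cl_para b) = 0"
proof -
  let ?u = "cl_exp (fst z) \<xi> \<odot> (c *\<^sub>R cl_one)"
  have "(\<Sum>j\<in>UNIV. cl_dker z \<xi> (c *\<^sub>R cl_one) (0, axis j 1) \<odot> cl_e j) = exp (\<i> * of_real (snd z \<bullet> \<xi>)) *s (\<i> *s (?u \<odot> cl_vec \<xi>))"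
  proof -
    have "cl_dker z \<xi> (c *\<^sub>R cl_one) (0, axis j 1) \<odot> cl_e j = exp (\<i> * of_real (snd z \<bullet> \<xi>)) *s (\<i> *s ((\<xi> $ j) *\<^sub>R (?u \<odot> cl_e j)))" for j
      unfolding cl_dker_def cl_mult_scale by (simp add: inner_axis' cl_mult_scale vec_eq_iff scaleR_conv_of_real[where 'a=complex])
    then show ?thesis by (simp add: vsmult.sum_right[symmetric] cl_vec_eq cl.sum_right cl.scaleR_right)
  qed
  moreover have "?u \<odot> cl_vec \<xi> = cl_vec \<xi> \<odot> ?u"
    by (simp add: cl.scaleR_right cl.scaleR_left cl_exp_commute)
  ultimately show ?thesis
    by (simp add: sum_Basis_strip) (simp add: cl_dker_def vec_eq_iff)
qed

lemma left_monogenic_on_iff: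
  "left_monogenic_on S F \<longleftrightarrow> open S \<and> (\<forall>x\<in>S. \<exists>F'. (F has_derivative F') (at x) \<and> (\<Sum>b\<in>Basis. cl_para b \<odot> F' b) = 0)"
  (is "?L \<longleftrightarrow> ?R")
proof
  assume ?L
  then show ?R
    unfolding left_monogenic_on_def frechet_derivative_works sum_Basis_strip cl_para_simps by blast
next
  assume R: ?R
  show ?L
    unfolding left_monogenic_on_def
  proof (intro conjI ballI)
    fix x assume "x \<in> S"
    with R obtain F' where F': "(F has_derivative F') (at x)" "(\<Sum>b\<in>Basis. cl_para b \<odot> F' b) = 0" by blast
    then show "F differentiable (at x)" unfolding differentiable_def by blast
    show "cl_one \<odot> frechet_derivative F (at x) (1, 0) + (\<Sum>j\<in>UNIV. cl_e j \<odot> frechet_derivative F (at x) (0, axis j 1)) = 0"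
      using F'(2) unfolding frechet_derivative_at[OF F'(1)] sum_Basis_strip cl_para_simps .
  qed (use R in blast)
qed

lemma cl_rep_monogenic:
  fixes g :: "(real, 'n::{finite,linorder}) vec \<Rightarrow> 'n cliff"
  assumes g: "exp_weighted a g"
  shows "left_monogenic_on (strip a) (cl_rep g)"
  unfolding left_monogenic_on_iff
proof (intro conjI open_strip ballI exI)
  fix x :: "real \<times> (real, 'n) vec" assume x: "x \<in> strip a"
  show "(cl_rep g has_derivative (\<lambda>v. \<integral>\<xi>. cl_dker x \<xi> (g \<xi>) v \<partial>lborel)) (at x)"
    by (rule cl_rep_has_derivative(2)[OF g x])
  note i = cl_rep_has_derivative(1)[OF g x]
  have "(\<Sum>b\<in>Basis. cl_para b \<odot> (\<integral>\<xi>. cl_dker x \<xi> (g \<xi>) b \<partial>lborel)) = (\<Sum>b\<in>Basis. \<integral>\<xi>. cl_para b \<odot> cl_dker x \<xi> (g \<xi>) b \<partial>lborel)"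
    by (intro sum.cong refl integral_bounded_linear[symmetric] cl.bounded_linear_right i)
  also have "\<dots> = (\<integral>\<xi>. (\<Sum>b\<in>Basis. cl_para b \<odot> cl_dker x \<xi> (g \<xi>) b) \<partial>lborel)"
    by (intro Bochner_Integration.integral_sum[symmetric] integrable_bounded_linear[OF cl.bounded_linear_right] i)
  finally show "(\<Sum>b\<in>Basis. cl_para b \<odot> (\<integral>\<xi>. cl_dker x \<xi> (g \<xi>) b \<partial>lborel)) = 0"
    by (simp add: cl_dker_monogenic)
qed

lemma cl_rep_right_monogenic:
  fixes \<phi> :: "(real, 'n::{finite,linorder}) vec \<Rightarrow> real"
  assumes g: "exp_weighted a (\<lambda>\<xi>. \<phi> \<xi> *\<^sub>R (cl_one :: 'n cliff))" and x: "x \<in> strip a"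
  shows "(\<Sum>b\<in>Basis. (\<integral>\<xi>. cl_dker x \<xi> (\<phi> \<xi> *\<^sub>R cl_one) b \<partial>lborel) \<odot> cl_para b) = 0"
proof -
  note i = cl_rep_has_derivative(1)[OF g x]
  have "(\<Sum>b\<in>Basis. (\<integral>\<xi>. cl_dker x \<xi> (\<phi> \<xi> *\<^sub>R cl_one) b \<partial>lborel) \<odot> cl_para b) = (\<Sum>b\<in>Basis. \<integral>\<xi>. cl_dker x \<xi> (\<phi> \<xi> *\<^sub>R cl_one) b \<odot> cl_para b \<partial>lborel)"
    by (intro sum.cong refl integral_bounded_linear[symmetric] cl.bounded_linear_left i)
  also have "\<dots> = (\<integral>\<xi>. (\<Sum>b\<in>Basis. cl_dker x \<xi> (\<phi> \<xi> *\<^sub>R cl_one) b \<odot> cl_para b) \<partial>lborel)"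
    by (intro Bochner_Integration.integral_sum[symmetric] integrable_bounded_linear[OF cl.bounded_linear_left] i)
  finally show ?thesis by (simp add: cl_dker_right_monogenic)
qed

section \<open>The weight of the Bergman space\<close>

text \<open>This is sinh (2 a |\<xi>|) / |\<xi>|, the integral of cosh (2 t |\<xi>|) over |t| < a.
  At \<xi> = 0 its value here is 0 instead of the limit 2 a, hence the exclusion of that point in
  the lower bounds.\<close>

definition bweight :: "real \<Rightarrow> (real, 'n::finite) vec \<Rightarrow> real" where
  "bweight a \<xi> = (exp (2 * a * norm \<xi>) - exp (- 2 * a * norm \<xi>)) / (2 * norm \<xi>)"

lemma bweight_measurable [measurable]: "bweight a \<in> borel_measurable borel"
  unfolding bweight_def[abs_def] by measurable

lemma bweight_nonneg: "a > 0 \<Longrightarrow> bweight a \<xi> \<ge> 0"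
  by (simp add: bweight_def)

lemma bweight_pos: "a > 0 \<Longrightarrow> \<xi> \<noteq> 0 \<Longrightarrow> bweight a \<xi> > 0"
  by (simp add: bweight_def)

text \<open>From 1 + u \<le> exp u with u = 2 (a - s) |\<xi>|. The linear term pays for the
  denominator |\<xi>|, so small and large \<xi> need no separate treatment.\<close>

lemma bweight_ge:
  assumes "\<xi> \<noteq> 0" "0 \<le> s" "s < a"
  shows "(a - s) * exp (2 * s * norm \<xi>) \<le> bweight a \<xi>"
proof -
  let ?r = "norm \<xi>"
  have r: "?r > 0" using assms by simp
  have "1 + 2 * (a - s) * ?r \<le> exp (2 * (a - s) * ?r)" by (rule exp_ge_add_one_self)
  then have "2 * (a - s) * ?r \<le> exp (2 * (a - s) * ?r) - 1" by linarith
  then have "exp (2 * s * ?r) * (2 * (a - s) * ?r) \<le> exp (2 * s * ?r) * (exp (2 * (a - s) * ?r) - 1)"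
    by (rule mult_left_mono) simp
  also have "\<dots> = exp (2 * a * ?r) - exp (2 * s * ?r)"
    by (simp add: algebra_simps flip: exp_add)
  also have "\<dots> \<le> exp (2 * a * ?r) - exp (- 2 * a * ?r)"
    using assms r by (intro diff_left_mono) (auto intro: order_trans[of _ 0])
  finally show ?thesis using r by (simp add: bweight_def field_simps)
qed

lemma exp_weighted_bweight:
  fixes g :: "(real, 'n::finite) vec \<Rightarrow> 'm::finite cliff"
  assumes a: "a > 0" and [measurable]: "g \<in> borel_measurable borel"
    and fin: "(\<integral>\<^sup>+\<xi>. ennreal (bweight a \<xi> * (norm (g \<xi>))\<^sup>2) \<partial>lborel) < \<infinity>"
  shows "exp_weighted a g"
  unfolding exp_weighted_def
proof (intro conjI allI impI)
  fix s assume "s < a"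
  \<comment> \<open>The lower bound of the weight requires a nonnegative exponent; raising s only
    enlarges the integrand.\<close>
  define s0 where "s0 = max s 0"
  have s0: "0 \<le> s0" "s0 < a" "s \<le> s0" using \<open>s < a\<close> a by (auto simp: s0_def)
  have i: "integrable lborel (\<lambda>\<xi>. bweight a \<xi> * (norm (g \<xi>))\<^sup>2)"
    using fin by (intro integrableI_nonneg AE_I2 mult_nonneg_nonneg bweight_nonneg[OF a]) auto
  show "integrable lborel (\<lambda>\<xi>. exp (2 * s * norm \<xi>) * (norm (g \<xi>))\<^sup>2)"
  proof (rule Bochner_Integration.integrable_bound[OF integrable_mult_right[OF i, of "1 / (a - s0)"]])
    show "AE \<xi> in lborel. norm (exp (2 * s * norm \<xi>) * (norm (g \<xi>))\<^sup>2) \<le> norm (1 / (a - s0) * (bweight a \<xi> * (norm (g \<xi>))\<^sup>2))"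
      using AE_lborel_nonzero
    proof eventually_elim
      case (elim \<xi>)
      have "exp (2 * s * norm \<xi>) \<le> exp (2 * s0 * norm \<xi>)"
        using s0 by (auto intro!: mult_right_mono)
      also have "\<dots> \<le> 1 / (a - s0) * bweight a \<xi>"
        using bweight_ge[OF elim s0(1,2)] s0 by (simp add: field_simps)
      finally have "exp (2 * s * norm \<xi>) * (norm (g \<xi>))\<^sup>2 \<le> 1 / (a - s0) * bweight a \<xi> * (norm (g \<xi>))\<^sup>2"
        by (intro mult_right_mono) auto
      then show ?case
        using s0 bweight_nonneg[OF a, of \<xi>] by (simp add: abs_mult)
    qed
  qed measurable
qed measurable

text \<open>The mixed term of \<open>norm_cl_exp_mult\<close> is odd in \<open>t\<close> and integrates to zero.\<close>
lemma nn_integral_norm_cl_exp: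
  assumes a: "a > 0" and \<xi>: "\<xi> \<noteq> 0"
  shows "(\<integral>\<^sup>+t. indicator {-a<..<a} t * ennreal ((norm (cl_exp t \<xi> \<odot> y))\<^sup>2) \<partial>lborel) = ennreal (bweight a \<xi> * (norm y)\<^sup>2)"
proof -
  let ?r = "norm \<xi>" and ?q = "cl_unit_form \<xi> y"
  have r: "?r > 0" using \<xi> by simp
  define F where "F t = sinh (2 * t * ?r) / (2 * ?r) * (norm y)\<^sup>2 - cosh (2 * t * ?r) / (2 * ?r) * ?q" for t
  have "(\<integral>\<^sup>+t. indicator {-a<..<a} t * ennreal ((norm (cl_exp t \<xi> \<odot> y))\<^sup>2) \<partial>lborel)
     = (\<integral>\<^sup>+t. ennreal ((norm (cl_exp t \<xi> \<odot> y))\<^sup>2) * indicator {-a..a} t \<partial>lborel)"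
    using AE_lborel_singleton[of a] AE_lborel_singleton[of "-a"]
    by (intro nn_integral_cong_AE) (auto elim!: eventually_elim2 simp: indicator_def)
  also have "\<dots> = ennreal (F a - F (-a))"
  proof (rule nn_integral_FTC_Icc)
    show "DERIV F t :> (norm (cl_exp t \<xi> \<odot> y))\<^sup>2" for t
      unfolding norm_cl_exp_mult F_def[abs_def] using r by (auto intro!: derivative_eq_intros)
  qed (use a in auto)
  also have "F a - F (-a) = bweight a \<xi> * (norm y)\<^sup>2"
  proof -
    have "2 * sinh (2 * a * ?r) = exp (2 * a * ?r) - exp (- 2 * a * ?r)" by (simp add: sinh_def)
    then have "bweight a \<xi> = 2 * (sinh (2 * a * ?r) / (2 * ?r))" by (simp add: bweight_def)
    then show ?thesis unfolding F_def by (simp add: algebra_simps)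
  qed
  finally show ?thesis .
qed

text \<open>Tonelli. Combined with a Plancherel inequality on every slice it compares the weighted
  norm of the spectrum with the norm over the strip, in either direction.\<close>

lemma nn_integral_bweight:
  fixes g :: "(real, 'n::{finite,linorder}) vec \<Rightarrow> 'n cliff"
  assumes a: "a > 0" and [measurable]: "g \<in> borel_measurable borel"
  shows "(\<integral>\<^sup>+\<xi>. ennreal (bweight a \<xi> * (norm (g \<xi>))\<^sup>2) \<partial>lborel)
    = (\<integral>\<^sup>+t. indicator {-a<..<a} t * (\<integral>\<^sup>+\<xi>. ennreal ((norm (cl_exp t \<xi> \<odot> g \<xi>))\<^sup>2) \<partial>lborel) \<partial>lborel)"
proof -
  let ?f = "\<lambda>t \<xi>. indicator {-a<..<a} t * ennreal ((norm (cl_exp t \<xi> \<odot> g \<xi>))\<^sup>2)"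
  have "(\<integral>\<^sup>+\<xi>. ennreal (bweight a \<xi> * (norm (g \<xi>))\<^sup>2) \<partial>lborel) = (\<integral>\<^sup>+\<xi>. (\<integral>\<^sup>+t. ?f t \<xi> \<partial>lborel) \<partial>lborel)"
    using AE_lborel_nonzero by (intro nn_integral_cong_AE) (auto elim!: eventually_mono simp: nn_integral_norm_cl_exp[OF a])
  also have "\<dots> = (\<integral>\<^sup>+t. (\<integral>\<^sup>+\<xi>. ?f t \<xi> \<partial>lborel) \<partial>lborel)"
  proof (rule lborel_pair.Fubini')
    show "(\<lambda>(t, \<xi>). ?f t \<xi>) \<in> borel_measurable (lborel \<Otimes>\<^sub>M lborel)"
      unfolding lborel_prod case_prod_beta' by measurable
  qed
  also have "\<dots> = (\<integral>\<^sup>+t. indicator {-a<..<a} t * (\<integral>\<^sup>+\<xi>. ennreal ((norm (cl_exp t \<xi> \<odot> g \<xi>))\<^sup>2) \<partial>lborel) \<partial>lborel)"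
    by (intro nn_integral_cong nn_integral_cmult) measurable
  finally show ?thesis .
qed

lemma nn_integral_strip:
  fixes f :: "real \<times> (real, 'n::{finite,linorder}) vec \<Rightarrow> ennreal"
  assumes [measurable]: "(\<lambda>x. f x * indicator (strip a) x) \<in> borel_measurable borel"
  shows "(\<integral>\<^sup>+x\<in>strip a. f x \<partial>lborel) = (\<integral>\<^sup>+t. indicator {-a<..<a} t * (\<integral>\<^sup>+v. f (t, v) \<partial>lborel) \<partial>lborel)"
proof -
  have "(\<integral>\<^sup>+x\<in>strip a. f x \<partial>lborel) = (\<integral>\<^sup>+t. (\<integral>\<^sup>+v. f (t, v) * indicator (strip a) (t, v) \<partial>lborel) \<partial>lborel)"
    unfolding lborel_prod[symmetric] by (rule lborel.nn_integral_fst[symmetric]) (simp add: lborel_prod)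
  also have "\<dots> = (\<integral>\<^sup>+t. indicator {-a<..<a} t * (\<integral>\<^sup>+v. f (t, v) \<partial>lborel) \<partial>lborel)"
  proof (rule nn_integral_cong)
    fix t :: real
    show "(\<integral>\<^sup>+v. f (t, v) * indicator (strip a) (t, v) \<partial>lborel) = indicator {-a<..<a} t * (\<integral>\<^sup>+v. f (t, v) \<partial>lborel)"
      by (cases "\<bar>t\<bar> < a") (auto simp: indicator_def strip_def abs_less_iff)
  qed
  finally show ?thesis .
qed

lemma cl_rep_measurable [measurable]:
  fixes g :: "(real, 'n::{finite,linorder}) vec \<Rightarrow> 'n cliff"
  assumes [measurable]: "g \<in> borel_measurable borel"
  shows "cl_rep g \<in> borel_measurable borel"
proof -
  have "(\<lambda>x. \<integral>\<xi>. exp (\<i> * of_real (snd x \<bullet> \<xi>)) *s (cl_exp (fst x) \<xi> \<odot> g \<xi>) \<partial>lborel) \<in> borel_measurable (borel :: (real \<times> (real, 'n) vec) measure)"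
    by measurable
  then show ?thesis by (simp add: cl_rep_def[abs_def])
qed

lemma fourier1_L2_bound_nn:
  fixes h :: "(real, 'n::finite) vec \<Rightarrow> 'm::finite cliff"
  assumes "integrable lborel h" "L2 h"
  shows "(\<integral>\<^sup>+x. ennreal ((norm (fourier1 h (- x)))\<^sup>2) \<partial>lborel) \<le> ennreal ((2 * pi) ^ CARD('n)) * (\<integral>\<^sup>+\<xi>. ennreal ((norm (h \<xi>))\<^sup>2) \<partial>lborel)"
proof -
  have [measurable]: "fourier1 h \<in> borel_measurable borel"
    using L2_measurable[OF assms(2)] by (rule fourier1_measurable)
  have "(\<integral>\<^sup>+x. ennreal ((norm (fourier1 h (- x)))\<^sup>2) \<partial>lborel) = (\<integral>\<^sup>+x. ennreal ((norm (fourier1 h x))\<^sup>2) \<partial>lborel)"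
    by (rule nn_integral_lborel_minus[of "\<lambda>x. ennreal ((norm (fourier1 h x))\<^sup>2)"]) measurable
  also have "\<dots> \<le> ennreal ((2 * pi) ^ CARD('n) * (\<integral>x. (norm (h x))\<^sup>2 \<partial>lborel))"
    by (rule fourier1_L2_bound[OF assms(1) L2_integrable[OF assms(2)]])
  also have "\<dots> = ennreal ((2 * pi) ^ CARD('n)) * (\<integral>\<^sup>+\<xi>. ennreal ((norm (h \<xi>))\<^sup>2) \<partial>lborel)"
    by (subst nn_integral_eq_integral[OF L2_integrable[OF assms(2)]]) (auto simp: ennreal_mult)
  finally show ?thesis .
qed

lemma cl_rep_in_A2:
  fixes g :: "(real, 'n::{finite,linorder}) vec \<Rightarrow> 'n cliff"
  assumes a: "a > 0" and [measurable]: "g \<in> borel_measurable borel"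
    and fin: "(\<integral>\<^sup>+\<xi>. ennreal (bweight a \<xi> * (norm (g \<xi>))\<^sup>2) \<partial>lborel) < \<infinity>"
  shows "cl_rep g \<in> A2 a"
proof -
  note g = exp_weighted_bweight[OF assms]
  have [measurable]: "strip a \<in> sets (borel :: (real \<times> (real, 'n) vec) measure)"
    by (rule borel_open[OF open_strip])
  have "(\<integral>\<^sup>+x\<in>strip a. ennreal ((norm (cl_rep g x))\<^sup>2) \<partial>lborel) = (\<integral>\<^sup>+t. indicator {-a<..<a} t * (\<integral>\<^sup>+v. ennreal ((norm (cl_rep g (t, v)))\<^sup>2) \<partial>lborel) \<partial>lborel)"
    by (rule nn_integral_strip) measurable
  also have "\<dots> \<le> (\<integral>\<^sup>+t. ennreal ((2 * pi) ^ CARD('n)) * (indicator {-a<..<a} t * (\<integral>\<^sup>+\<xi>. ennreal ((norm (cl_exp t \<xi> \<odot> g \<xi>))\<^sup>2) \<partial>lborel)) \<partial>lborel)"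
  proof (rule nn_integral_mono)
    fix t :: real
    show "indicator {-a<..<a} t * (\<integral>\<^sup>+v. ennreal ((norm (cl_rep g (t, v)))\<^sup>2) \<partial>lborel)
       \<le> ennreal ((2 * pi) ^ CARD('n)) * (indicator {-a<..<a} t * (\<integral>\<^sup>+\<xi>. ennreal ((norm (cl_exp t \<xi> \<odot> g \<xi>))\<^sup>2) \<partial>lborel))"
    proof (cases "\<bar>t\<bar> < a")
      case True
      then show ?thesis
        unfolding cl_rep_fourier1 using fourier1_L2_bound_nn[OF exp_weighted_exp[OF g True]]
        by (simp add: indicator_def abs_less_iff)
    qed (auto simp: indicator_def abs_less_iff)
  qed
  also have "\<dots> = ennreal ((2 * pi) ^ CARD('n)) * (\<integral>\<^sup>+\<xi>. ennreal (bweight a \<xi> * (norm (g \<xi>))\<^sup>2) \<partial>lborel)"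
    unfolding nn_integral_bweight[OF assms(1,2)] by (rule nn_integral_cmult) measurable
  also have "\<dots> < \<infinity>"
    using fin by (simp add: ennreal_mult_less_top)
  finally show ?thesis
    unfolding A2_def using cl_rep_monogenic[OF g] by blast
qed

lemma A2_cong:
  fixes f F :: "real \<times> (real, 'n::{finite,linorder}) vec \<Rightarrow> 'n cliff"
  assumes F: "F \<in> A2 a" and eq: "\<And>x. x \<in> strip a \<Longrightarrow> f x = F x"
  shows "f \<in> A2 a"
proof -
  have "left_monogenic_on (strip a) f"
    unfolding left_monogenic_on_iff
  proof (intro conjI open_strip ballI)
    fix x :: "real \<times> (real, 'n) vec" assume x: "x \<in> strip a"
    then obtain F' where F': "(F has_derivative F') (at x)" "(\<Sum>b\<in>Basis. cl_para b \<odot> F' b) = 0"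
      using F unfolding A2_def left_monogenic_on_iff by blast
    have "(f has_derivative F') (at x)"
      by (rule has_derivative_transform_within_open[OF F'(1) open_strip x]) (rule eq[symmetric])
    then show "\<exists>F'. (f has_derivative F') (at x) \<and> (\<Sum>b\<in>Basis. cl_para b \<odot> F' b) = 0"
      using F'(2) by blast
  qed
  moreover have "(\<integral>\<^sup>+x\<in>strip a. ennreal ((norm (f x))\<^sup>2) \<partial>lborel) = (\<integral>\<^sup>+x\<in>strip a. ennreal ((norm (F x))\<^sup>2) \<partial>lborel)"
    by (intro nn_integral_cong) (auto simp: indicator_def eq)
  ultimately show ?thesis using F by (simp add: A2_def)
qed

section \<open>The Bergman kernel as a represented function\<close>

lemma cl_rep_scaleR: "c *\<^sub>R cl_rep g x = cl_rep (\<lambda>\<xi>. c *\<^sub>R g \<xi>) x"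
  unfolding cl_rep_def cl.scaleR_right vsmult.scaleR_right by simp

lemma nn_integral_bweight_scaleR:
  fixes g :: "(real, 'n::finite) vec \<Rightarrow> 'm::finite cliff"
  assumes "a > 0" and [measurable]: "g \<in> borel_measurable borel"
    and fin: "(\<integral>\<^sup>+\<xi>. ennreal (bweight a \<xi> * (norm (g \<xi>))\<^sup>2) \<partial>lborel) < \<infinity>"
  shows "(\<integral>\<^sup>+\<xi>. ennreal (bweight a \<xi> * (norm (c *\<^sub>R g \<xi>))\<^sup>2) \<partial>lborel) < \<infinity>"
proof -
  have "(\<integral>\<^sup>+\<xi>. ennreal (bweight a \<xi> * (norm (c *\<^sub>R g \<xi>))\<^sup>2) \<partial>lborel) = (\<integral>\<^sup>+\<xi>. ennreal (c\<^sup>2) * ennreal (bweight a \<xi> * (norm (g \<xi>))\<^sup>2) \<partial>lborel)"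
    by (intro nn_integral_cong, subst ennreal_mult[symmetric])
      (simp_all add: bweight_nonneg[OF assms(1)] power_mult_distrib mult_ac)
  also have "\<dots> = ennreal (c\<^sup>2) * (\<integral>\<^sup>+\<xi>. ennreal (bweight a \<xi> * (norm (g \<xi>))\<^sup>2) \<partial>lborel)"
    by (rule nn_integral_cmult) measurable
  finally show ?thesis using fin by (simp add: ennreal_mult_less_top)
qed

text \<open>The spectrum of the kernel as a function of w for fixed x: the part of e(w + conj x,
  \<xi>) that depends on x, divided by the weight and normalised.\<close>

definition bergman_symbol :: "real \<Rightarrow> real \<times> (real, 'n::{finite,linorder}) vec \<Rightarrow> (real, 'n) vec \<Rightarrow> 'n cliff" where
  "bergman_symbol a x \<xi> = (1 / (2 * pi) ^ CARD('n)) *\<^sub>R (1 / bweight a \<xi>) *\<^sub>R (exp (- \<i> * of_real (snd x \<bullet> \<xi>)) *s cl_exp (fst x) \<xi>)"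

lemma bergman_symbol_measurable [measurable]: "bergman_symbol a x \<in> borel_measurable borel"
  unfolding bergman_symbol_def[abs_def] by measurable

text \<open>The group law splits the kernel at w + conj x into a factor in w and a factor in x.
  Membership in the Bergman space thereby becomes an instance of
  \<open>cl_rep_in_A2\<close>.\<close>

lemma bergman_eq_cl_rep:
  fixes x w :: "real \<times> (real, 'n::{finite,linorder}) vec"
  shows "bergman a w x = cl_rep (bergman_symbol a x) w"
proof -
  let ?c = "1 / (2 * pi) ^ CARD('n)"
  have eq: "e_ker (para_add_conj w x) \<xi> = (if \<xi> = 0 then 0 else exp (\<i> * of_real ((snd w - snd x) \<bullet> \<xi>)) *s cl_exp (fst w + fst x) \<xi>)" for \<xi>
    by (simp add: e_ker_eq para_add_conj_def) (simp add: e_ker_def e_plus_def e_minus_def)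
  have k: "2 * norm \<xi> / (exp (2 * a * norm \<xi>) - exp (- 2 * a * norm \<xi>)) = 1 / bweight a \<xi>" for \<xi> :: "(real, 'n) vec"
    by (simp add: bweight_def)
  have "bergman a w x = ?c *\<^sub>R (\<integral>\<xi>. exp (\<i> * of_real (snd w \<bullet> \<xi>)) *s (cl_exp (fst w) \<xi> \<odot> ((1 / bweight a \<xi>) *\<^sub>R (exp (- \<i> * of_real (snd x \<bullet> \<xi>)) *s cl_exp (fst x) \<xi>))) \<partial>lborel)"
    unfolding bergman_def k eq
  proof (rule arg_cong[where f="\<lambda>u. ?c *\<^sub>R u"], rule integral_cong_AE)
    show "AE \<xi> in lborel. (1 / bweight a \<xi>) *\<^sub>R (if \<xi> = 0 then 0 else exp (\<i> * of_real ((snd w - snd x) \<bullet> \<xi>)) *s cl_exp (fst w + fst x) \<xi>)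
      = exp (\<i> * of_real (snd w \<bullet> \<xi>)) *s (cl_exp (fst w) \<xi> \<odot> ((1 / bweight a \<xi>) *\<^sub>R (exp (- \<i> * of_real (snd x \<bullet> \<xi>)) *s cl_exp (fst x) \<xi>)))"
      using AE_lborel_nonzero
    proof eventually_elim
      case (elim \<xi>)
      have "exp (\<i> * complex_of_real ((snd w - snd x) \<bullet> \<xi>)) = exp (\<i> * of_real (snd w \<bullet> \<xi>)) * exp (- \<i> * of_real (snd x \<bullet> \<xi>))"
        unfolding exp_add[symmetric] by (simp add: inner_diff_left algebra_simps)
      moreover have "cl_exp (fst w) \<xi> \<odot> cl_exp (fst x) \<xi> = cl_exp (fst w + fst x) \<xi>"
        using cl_exp_add[of "fst w" \<xi> "fst x" cl_one] by simp
      ultimately show ?case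
        using elim by (simp only: cl.scaleR_right vsmult.scaleR_right cl_mult_scale vector_smult_assoc if_False)
    qed
  qed measurable
  also have "\<dots> = cl_rep (\<lambda>\<xi>. ?c *\<^sub>R (1 / bweight a \<xi>) *\<^sub>R (exp (- \<i> * of_real (snd x \<bullet> \<xi>)) *s cl_exp (fst x) \<xi>)) w"
    unfolding cl_rep_scaleR[symmetric] by (simp only: cl_rep_def)
  finally show ?thesis unfolding bergman_symbol_def .
qed

lemma inverse_bweight_le:
  assumes "\<xi> \<noteq> 0" "0 \<le> s" "s < a"
  shows "1 / bweight a \<xi> \<le> 1 / (a - s) * exp (- 2 * s * norm \<xi>)"
proof -
  have "1 / bweight a \<xi> \<le> 1 / ((a - s) * exp (2 * s * norm \<xi>))"
    using bweight_ge[OF assms] assms by (intro divide_left_mono mult_pos_pos) (auto intro: bweight_pos)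
  then show ?thesis by (simp add: exp_minus field_simps)
qed

lemma bergman_symbol_weight:
  fixes x :: "real \<times> (real, 'n::{finite,linorder}) vec"
  assumes a: "a > 0" and x: "x \<in> strip a"
  shows "(\<integral>\<^sup>+\<xi>. ennreal (bweight a \<xi> * (norm (bergman_symbol a x \<xi>))\<^sup>2) \<partial>lborel) < \<infinity>"
  unfolding bergman_symbol_def
proof (rule nn_integral_bweight_scaleR[OF a], measurable)
  \<comment> \<open>The weight times its inverse square leaves 1 / weight, of order exp (- 2 s
    |\<xi>|); any s strictly between |x0| and a beats the factor exp (2 |x0| |\<xi>|) of the squared
    exponential.\<close>
  define s where "s = (\<bar>fst x\<bar> + a) / 2"
  have s: "0 \<le> s" "s < a" "\<bar>fst x\<bar> < s" using x by (auto simp: s_def strip_def)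
  let ?g = "\<lambda>\<xi>. (1 / bweight a \<xi>) *\<^sub>R (exp (- \<i> * of_real (snd x \<bullet> \<xi>)) *s cl_exp (fst x) \<xi>)"
  have "(\<integral>\<^sup>+\<xi>. ennreal (bweight a \<xi> * (norm (?g \<xi>))\<^sup>2) \<partial>lborel) \<le> (\<integral>\<^sup>+\<xi>. ennreal (1 / (a - s) * exp (- (2 * (s - \<bar>fst x\<bar>)) * norm (\<xi>::(real, 'n) vec))) \<partial>lborel)"
  proof (rule nn_integral_mono_AE)
    show "AE \<xi> in lborel. ennreal (bweight a \<xi> * (norm (?g \<xi>))\<^sup>2) \<le> ennreal (1 / (a - s) * exp (- (2 * (s - \<bar>fst x\<bar>)) * norm \<xi>))"
      using AE_lborel_nonzero
    proof eventually_elim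
      case (elim \<xi>)
      let ?k = "1 / bweight a \<xi>"
      have W: "bweight a \<xi> > 0" by (rule bweight_pos[OF a elim])
      have "bweight a \<xi> * (norm (?g \<xi>))\<^sup>2 = ?k * (norm (cl_exp (fst x) \<xi>))\<^sup>2"
        using W by (simp add: power_mult_distrib power2_eq_square power_divide)
      also have "\<dots> \<le> (1 / (a - s) * exp (- 2 * s * norm \<xi>)) * (exp (\<bar>fst x\<bar> * norm \<xi>))\<^sup>2"
        using s W by (intro mult_mono inverse_bweight_le elim power_mono norm_cl_exp) auto
      also have "\<dots> = 1 / (a - s) * exp (- (2 * (s - \<bar>fst x\<bar>)) * norm \<xi>)"
        by (simp add: exp_double[symmetric] algebra_simps flip: exp_add)
      finally show ?case by (rule ennreal_leI)
    qed
  qed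
  also have "\<dots> < \<infinity>"
  proof -
    have "integrable lborel (\<lambda>\<xi>::(real, 'n) vec. 1 / (a - s) * exp (- (2 * (s - \<bar>fst x\<bar>)) * norm \<xi>))"
      using s by (intro integrable_mult_right integrable_exp_norm) auto
    then show ?thesis
      using s by (subst nn_integral_eq_integral) auto
  qed
  finally show "(\<integral>\<^sup>+\<xi>. ennreal (bweight a \<xi> * (norm (?g \<xi>))\<^sup>2) \<partial>lborel) < \<infinity>" .
qed

lemma bergman_in_A2:
  fixes x :: "real \<times> (real, 'n::{finite,linorder}) vec"
  assumes a: "a > 0" and x: "x \<in> strip a"
  shows "(\<lambda>w. bergman a w x) \<in> A2 a"
  unfolding bergman_eq_cl_rep by (intro cl_rep_in_A2 a bergman_symbol_weight x bergman_symbol_measurable)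

section \<open>Square integrable monogenic functions on a strip\<close>

lemma A2_derivative:
  assumes "f \<in> A2 a" "x \<in> strip a"
  obtains f' where "(f has_derivative f') (at x)" "(\<Sum>b\<in>Basis. cl_para b \<odot> f' b) = 0"
  using assms unfolding A2_def left_monogenic_on_iff by blast

lemma A2_isCont: "f \<in> A2 a \<Longrightarrow> x \<in> strip a \<Longrightarrow> isCont f x"
  by (metis A2_derivative has_derivative_continuous)

lemma strip_measurable [measurable]: "strip a \<in> sets (borel :: (real \<times> (real, 'n::finite) vec) measure)"
  by (rule borel_open[OF open_strip])

lemma A2_measurable:
  fixes f :: "real \<times> (real, 'n::{finite,linorder}) vec \<Rightarrow> 'n cliff"
  assumes "f \<in> A2 a"
  shows "(\<lambda>x. indicator (strip a) x *\<^sub>R f x) \<in> borel_measurable borel"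
  by (rule borel_measurable_continuous_on_indicator)
    (auto intro!: continuous_at_imp_continuous_on A2_isCont[OF assms])

lemma A2_slice_isCont:
  fixes f :: "real \<times> (real, 'n::{finite,linorder}) vec \<Rightarrow> 'n cliff"
  assumes "f \<in> A2 a" "\<bar>t\<bar> < a"
  shows "isCont (\<lambda>v. f (t, v)) v"
proof -
  have "isCont f (t, v)" by (rule A2_isCont[OF assms(1)]) (simp add: strip_def assms)
  moreover have "isCont (\<lambda>v. (t, v)) v" by (intro continuous_intros)
  ultimately show ?thesis using isCont_o2 by blast
qed

lemma A2_slice_measurable:
  fixes f :: "real \<times> (real, 'n::{finite,linorder}) vec \<Rightarrow> 'n cliff"
  assumes "f \<in> A2 a" "\<bar>t\<bar> < a"
  shows "(\<lambda>v. f (t, v)) \<in> borel_measurable borel"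
  by (intro borel_measurable_continuous_onI continuous_at_imp_continuous_on ballI A2_slice_isCont[OF assms])

lemma A2_norm2_indicator:
  "ennreal ((norm (f x))\<^sup>2) * indicator S x = ennreal ((norm (indicator S x *\<^sub>R f x))\<^sup>2)"
  by (simp add: indicator_def)

lemma A2_nn_integral:
  fixes f :: "real \<times> (real, 'n::{finite,linorder}) vec \<Rightarrow> 'n cliff"
  assumes f: "f \<in> A2 a"
  shows "(\<lambda>t. indicator {-a<..<a} t * (\<integral>\<^sup>+v. ennreal ((norm (f (t, v)))\<^sup>2) \<partial>lborel)) \<in> borel_measurable borel"
    and "(\<integral>\<^sup>+t. indicator {-a<..<a} t * (\<integral>\<^sup>+v. ennreal ((norm (f (t, v)))\<^sup>2) \<partial>lborel) \<partial>lborel) < \<infinity>"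
proof -
  note [measurable] = A2_measurable[OF f]
  have m: "(\<lambda>x. ennreal ((norm (f x))\<^sup>2) * indicator (strip a) x) \<in> borel_measurable borel"
    unfolding A2_norm2_indicator by measurable
  show "(\<integral>\<^sup>+t. indicator {-a<..<a} t * (\<integral>\<^sup>+v. ennreal ((norm (f (t, v)))\<^sup>2) \<partial>lborel) \<partial>lborel) < \<infinity>"
    using f unfolding nn_integral_strip[OF m, symmetric] A2_def by blast
  have "(\<lambda>t. \<integral>\<^sup>+v. ennreal ((norm (indicator (strip a) (t, v) *\<^sub>R f (t, v)))\<^sup>2) \<partial>lborel) \<in> borel_measurable borel"
    by measurable
  moreover have "(\<integral>\<^sup>+v. ennreal ((norm (indicator (strip a) (t, v) *\<^sub>R f (t, v)))\<^sup>2) \<partial>lborel) = indicator {-a<..<a} t * (\<integral>\<^sup>+v. ennreal ((norm (f (t, v)))\<^sup>2) \<partial>lborel)" for t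
    by (cases "\<bar>t\<bar> < a") (auto simp: indicator_def strip_def abs_less_iff)
  ultimately show "(\<lambda>t. indicator {-a<..<a} t * (\<integral>\<^sup>+v. ennreal ((norm (f (t, v)))\<^sup>2) \<partial>lborel)) \<in> borel_measurable borel"
    by simp
qed

lemma A2_slice_L2:
  fixes f :: "real \<times> (real, 'n::{finite,linorder}) vec \<Rightarrow> 'n cliff"
  assumes f: "f \<in> A2 a"
  shows "AE t in lborel. t \<in> {-a<..<a} \<longrightarrow> L2 (\<lambda>v. f (t, v))"
proof -
  have "AE t in lborel. indicator {-a<..<a} t * (\<integral>\<^sup>+v. ennreal ((norm (f (t, v)))\<^sup>2) \<partial>lborel) \<noteq> \<infinity>"
    using A2_nn_integral[OF f] by (intro nn_integral_PInf_AE) auto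
  then show ?thesis
  proof eventually_elim
    case (elim t)
    show ?case
    proof
      assume t: "t \<in> {-a<..<a}"
      then have "(\<lambda>v. f (t, v)) \<in> borel_measurable borel" by (intro A2_slice_measurable[OF f]) auto
      then show "L2 (\<lambda>v. f (t, v))" unfolding L2_iff_nn_integral using elim t by (simp add: less_top)
    qed
  qed
qed

lemma A2_mult_integrable:
  fixes f k :: "real \<times> (real, 'n::{finite,linorder}) vec \<Rightarrow> 'n cliff"
  assumes f: "f \<in> A2 a" and k: "k \<in> A2 a"
  shows "integrable lborel (\<lambda>x. indicator (strip a) x * (norm (k x) * norm (f x)))"
    and "integrable lborel (\<lambda>x. indicator (strip a) x *\<^sub>R (k x \<odot> f x))"
proof -
  let ?u = "\<lambda>f x. indicator (strip a) x *\<^sub>R f x"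
  note [measurable] = A2_measurable[OF f] A2_measurable[OF k]
  have i: "integrable lborel (\<lambda>x. (norm (?u f x))\<^sup>2)" if "f \<in> A2 a" for f :: "real \<times> (real, 'n) vec \<Rightarrow> 'n cliff"
  proof -
    note [measurable] = A2_measurable[OF that]
    have "(\<integral>\<^sup>+x. ennreal ((norm (?u f x))\<^sup>2) \<partial>lborel) < \<infinity>"
      using that unfolding A2_norm2_indicator[symmetric] A2_def by blast
    moreover have "(\<lambda>x. (norm (?u f x))\<^sup>2) \<in> borel_measurable borel" by measurable
    ultimately show ?thesis by (intro integrableI_nonneg) auto
  qed
  have "integrable lborel (\<lambda>x. norm (?u k x) * norm (?u f x))"
    by (rule Cauchy_Schwarz_integral(1)[OF _ _ i[OF k] i[OF f]]) measurable
  moreover have "norm (?u k x) * norm (?u f x) = indicator (strip a) x * (norm (k x) * norm (f x))" for x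
    by (simp add: indicator_def)
  ultimately show 1: "integrable lborel (\<lambda>x. indicator (strip a) x * (norm (k x) * norm (f x)))" by (simp only:)
  obtain K where K: "K > 0" "\<And>a b. norm (a \<odot> b) \<le> K * (norm a * norm (b::'n cliff))"
    using norm_cl_mult_bound by blast
  have "integrable lborel (\<lambda>x. ?u k x \<odot> ?u f x)"
  proof (rule Bochner_Integration.integrable_bound[OF integrable_mult_right[OF 1, of K]])
    show "AE x in lborel. norm (?u k x \<odot> ?u f x) \<le> norm (K * (indicator (strip a) x * (norm (k x) * norm (f x))))"
    proof (rule AE_I2)
      fix x :: "real \<times> (real, 'n) vec"
      show "norm (?u k x \<odot> ?u f x) \<le> norm (K * (indicator (strip a) x * (norm (k x) * norm (f x))))"
        using K(2)[of "?u k x" "?u f x"] K(1) by (auto simp: indicator_def)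
    qed
  qed measurable
  moreover have "?u k x \<odot> ?u f x = indicator (strip a) x *\<^sub>R (k x \<odot> f x)" for x
    by (simp add: indicator_def cl.zero_left)
  ultimately show "integrable lborel (\<lambda>x. indicator (strip a) x *\<^sub>R (k x \<odot> f x))" by (simp only:)
qed

text \<open>Reflection negates all partial derivatives at once, so the equation survives. The test
  functions are evaluated at - x, which makes their slices forward transforms as Parseval
  requires.\<close>

lemma A2_minus:
  fixes f :: "real \<times> (real, 'n::{finite,linorder}) vec \<Rightarrow> 'n cliff"
  assumes f: "f \<in> A2 a"
  shows "(\<lambda>x. f (- x)) \<in> A2 a"
proof -
  have s: "- x \<in> strip a \<longleftrightarrow> x \<in> strip a" for x :: "real \<times> (real, 'n) vec" by (simp add: strip_def)
  have "left_monogenic_on (strip a) (\<lambda>x. f (- x))"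
    unfolding left_monogenic_on_iff
  proof (intro conjI open_strip ballI)
    fix x :: "real \<times> (real, 'n) vec" assume x: "x \<in> strip a"
    obtain f' where f': "(f has_derivative f') (at (- x))" "(\<Sum>b\<in>Basis. cl_para b \<odot> f' b) = 0"
      using A2_derivative[OF f] x s by metis
    have "((\<lambda>x. f (- x)) has_derivative (\<lambda>v. f' (- v))) (at x)"
    proof -
      have "(uminus has_derivative uminus) (at x)"
        using has_derivative_minus[OF has_derivative_ident] .
      from has_derivative_compose[OF this, of f f'] f'(1) show ?thesis by simp
    qed
    moreover have "f' (- v) = - f' v" for v
      using linear_neg[OF has_derivative_linear[OF f'(1)]] .
    ultimately show "\<exists>F'. ((\<lambda>x. f (- x)) has_derivative F') (at x) \<and> (\<Sum>b\<in>Basis. cl_para b \<odot> F' b) = 0"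
      using f'(2) by (intro exI[of _ "\<lambda>v. f' (- v)"]) (simp add: cl.minus_right sum_negf)
  qed
  moreover have "(\<integral>\<^sup>+x\<in>strip a. ennreal ((norm (f (- x)))\<^sup>2) \<partial>lborel) = (\<integral>\<^sup>+x\<in>strip a. ennreal ((norm (f x))\<^sup>2) \<partial>lborel)"
  proof -
    note [measurable] = A2_measurable[OF f]
    have "(\<integral>\<^sup>+x\<in>strip a. ennreal ((norm (f (- x)))\<^sup>2) \<partial>lborel) = (\<integral>\<^sup>+x. ennreal ((norm (indicator (strip a) (- x) *\<^sub>R f (- x)))\<^sup>2) \<partial>lborel)"
      by (intro nn_integral_cong) (auto simp: indicator_def s)
    also have "\<dots> = (\<integral>\<^sup>+x. ennreal ((norm (indicator (strip a) x *\<^sub>R f x))\<^sup>2) \<partial>lborel)"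
      by (rule nn_integral_lborel_minus[of "\<lambda>x. ennreal ((norm (indicator (strip a) x *\<^sub>R f x))\<^sup>2)"]) measurable
    finally show ?thesis unfolding A2_norm2_indicator .
  qed
  ultimately show ?thesis using f by (simp add: A2_def)
qed

section \<open>Test functions of bounded spectrum and constancy of the pairing\<close>

lemma bweight_le:
  assumes "a > 0"
  shows "bweight a \<xi> \<le> 2 * a * exp (2 * a * norm \<xi>)"
proof (cases "\<xi> = 0")
  case False
  let ?x = "2 * a * norm \<xi>"
  have "1 + - 2 * ?x \<le> exp (- 2 * ?x)" by (rule exp_ge_add_one_self)
  then have "exp ?x * (1 - exp (- 2 * ?x)) \<le> exp ?x * (2 * ?x)"
    by (intro mult_left_mono) auto
  moreover have "exp ?x * (1 - exp (- 2 * ?x)) = exp ?x - exp (- 2 * a * norm \<xi>)"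
    by (simp add: algebra_simps flip: exp_add)
  ultimately show ?thesis using False by (simp add: bweight_def field_simps)
qed (use assms in \<open>simp add: bweight_def\<close>)

lemma indicator_exp_weighted:
  fixes B :: "(real, 'n::{finite,linorder}) vec set"
  assumes a: "a > 0" and [measurable]: "B \<in> sets borel" and B: "bounded B"
  defines "g \<equiv> \<lambda>\<xi>. indicator B \<xi> *\<^sub>R (cl_one :: 'n cliff)"
  shows "g \<in> borel_measurable borel" and "(\<integral>\<^sup>+\<xi>. ennreal (bweight a \<xi> * (norm (g \<xi>))\<^sup>2) \<partial>lborel) < \<infinity>"
proof -
  show "g \<in> borel_measurable borel" unfolding g_def by measurable
  obtain R where R: "\<And>\<xi>. \<xi> \<in> B \<Longrightarrow> norm \<xi> \<le> R" using B unfolding bounded_iff by blast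
  have "(\<integral>\<^sup>+\<xi>. ennreal (bweight a \<xi> * (norm (g \<xi>))\<^sup>2) \<partial>lborel) \<le> (\<integral>\<^sup>+\<xi>. ennreal (2 * a * exp (2 * a * R)) * indicator B \<xi> \<partial>lborel)"
  proof (rule nn_integral_mono)
    fix \<xi> :: "(real, 'n) vec"
    have "bweight a \<xi> \<le> 2 * a * exp (2 * a * R)" if "\<xi> \<in> B"
      using R[OF that] a by (intro order_trans[OF bweight_le[OF a]] mult_left_mono) auto
    then show "ennreal (bweight a \<xi> * (norm (g \<xi>))\<^sup>2) \<le> ennreal (2 * a * exp (2 * a * R)) * indicator B \<xi>"
      by (auto simp: g_def indicator_def intro: ennreal_leI)
  qed
  also have "\<dots> = ennreal (2 * a * exp (2 * a * R)) * emeasure lborel B"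
    by (rule nn_integral_cmult_indicator) simp
  also have "\<dots> < \<infinity>"
    using emeasure_bounded_finite[OF B] by (simp add: ennreal_mult_less_top)
  finally show "(\<integral>\<^sup>+\<xi>. ennreal (bweight a \<xi> * (norm (g \<xi>))\<^sup>2) \<partial>lborel) < \<infinity>" .
qed

lemma Basis_strip: "(Basis :: (real \<times> (real, 'n::finite) vec) set) = insert (1, 0) (range (\<lambda>j. (0, axis j 1)))"
  unfolding Basis_prod_def Basis_vec_def by auto

lemma prod_Basis_strip:
  fixes F :: "real \<times> (real, 'n::finite) vec \<Rightarrow> real"
  shows "(\<Prod>b\<in>Basis. F b) = F (1, 0) * (\<Prod>j\<in>UNIV. F (0, axis j 1))"
proof -
  have "inj (\<lambda>j::'n. (0::real, axis j (1::real)))" by (auto simp: inj_def axis_eq_axis)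
  then show ?thesis unfolding Basis_strip by (subst prod.insert) (auto simp: prod.reindex axis_eq_0_iff)
qed

text \<open>\<open>z \<mapsto> cl_rep g (- z)\<close> is right monogenic for scalar \<open>g\<close>, hence \<open>k D f\<close> pairs to a divergence
  free field; letting the tent functions grow in the \<open>m\<close> space directions removes the cutoff
  because both factors are square integrable.\<close>
lemma A2_tent_integral:
  fixes f :: "real \<times> (real, 'n::{finite,linorder}) vec \<Rightarrow> 'n cliff"
  assumes a: "a > 0" and f: "f \<in> A2 a" and B: "B \<in> sets borel" "bounded B"
    and h: "h > 0" "-a < y0" "y0 + 2 * h < a"
  defines "k \<equiv> \<lambda>x. cl_rep (\<lambda>\<xi>. indicator B \<xi> *\<^sub>R cl_one) (- x)"
  shows "(\<integral>x. (dhat ((fst x - y0) / h) / h) *\<^sub>R (k x \<odot> f x) \<partial>lborel) = 0"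
proof -
  let ?g = "\<lambda>\<xi>. indicator B \<xi> *\<^sub>R (cl_one :: 'n cliff)"
  note gm = indicator_exp_weighted[OF a B]
  have g: "exp_weighted a ?g" by (rule exp_weighted_bweight[OF a gm])
  have kA2: "k \<in> A2 a" unfolding k_def by (intro A2_minus cl_rep_in_A2 a gm)
  define one where "one = (\<chi> j::'n. (1::real))"
  define R where "R n = real (Suc n)" for n
  have R: "R n > 0" "R n \<ge> 1" for n by (auto simp: R_def)
  \<comment> \<open>In space the boxes are the cubes [- R n, R n]^m; the tent peaks at the origin
    with value 1 and so tends to 1 pointwise.\<close>
  define y where "y n = (y0, - R n *\<^sub>R one)" for n
  define H where "H n = (h, R n *\<^sub>R one)" for n
  have one: "one \<bullet> axis j 1 = 1" for j by (simp add: one_def inner_axis)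
  have Hb: "H n \<bullet> b > 0" if "b \<in> Basis" for b n
    using that h R[of n] unfolding Basis_strip H_def by (auto simp: one)
  have sub: "cbox (y n) (y n + 2 *\<^sub>R H n) \<subseteq> strip a" for n
  proof
    fix x assume "x \<in> cbox (y n) (y n + 2 *\<^sub>R H n)"
    then have "y n \<bullet> (1, 0) \<le> x \<bullet> (1, 0) \<and> x \<bullet> (1, 0) \<le> (y n + 2 *\<^sub>R H n) \<bullet> (1, 0)"
      unfolding mem_box by (rule bspec) (simp add: Basis_strip)
    then have "y0 \<le> fst x" "fst x \<le> y0 + 2 * h" by (simp_all add: inner_prod_def y_def H_def)
    then show "x \<in> strip a" using h by (auto simp: strip_def abs_less_iff)
  qed
  \<comment> \<open>With the basis paravector in the middle, associativity splits the divergence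
    into k times the left equation for f and the right equation for k times f.\<close>
  define V where "V b x = (k x \<odot> cl_para b) \<odot> f x" for b x
  have "\<exists>f'. \<forall>x\<in>strip a. (f has_derivative f' x) (at x) \<and> (\<Sum>b\<in>Basis. cl_para b \<odot> f' x b) = 0"
    using A2_derivative[OF f] by (intro bchoice) metis
  then obtain f' where f': "\<And>x. x \<in> strip a \<Longrightarrow> (f has_derivative f' x) (at x)"
    "\<And>x. x \<in> strip a \<Longrightarrow> (\<Sum>b\<in>Basis. cl_para b \<odot> f' x b) = 0" by blast
  define k' where "k' x v = - (\<integral>\<xi>. cl_dker (- x) \<xi> (?g \<xi>) v \<partial>lborel)" for x v
  have k': "(k has_derivative k' x) (at x)" "(\<Sum>b\<in>Basis. k' x b \<odot> cl_para b) = 0" if x: "x \<in> strip a" for x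
  proof -
    have mx: "- x \<in> strip a" using x by (simp add: strip_def)
    have D: "(cl_rep ?g has_derivative (\<lambda>v. \<integral>\<xi>. cl_dker (- x) \<xi> (?g \<xi>) v \<partial>lborel)) (at (- x))" (is "(_ has_derivative ?D) _")
      by (rule cl_rep_has_derivative(2)[OF g mx])
    have "(uminus has_derivative uminus) (at x)"
      using has_derivative_minus[OF has_derivative_ident] .
    from has_derivative_compose[OF this, of "cl_rep ?g" ?D] D
    have "(k has_derivative (\<lambda>v. ?D (- v))) (at x)" by (simp add: k_def)
    moreover have "?D (- v) = k' x v" for v
      unfolding k'_def by (rule linear_neg[OF has_derivative_linear[OF D]])
    ultimately show "(k has_derivative k' x) (at x)" by simp
    show "(\<Sum>b\<in>Basis. k' x b \<odot> cl_para b) = 0"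
      using cl_rep_right_monogenic[OF g mx] by (simp add: k'_def cl.minus_left sum_negf)
  qed
  have V0: "(\<integral>x. (\<Sum>b\<in>Basis. tent b (y n) (H n) x *\<^sub>R V b x) \<partial>lborel) = 0" for n
  proof (rule divergence_free_tent_integral[OF Hb])
    fix b x assume "x \<in> cbox (y n) (y n + 2 *\<^sub>R H n)"
    then have x: "x \<in> strip a" using sub by blast
    have "((\<lambda>x. k x \<odot> cl_para b) has_derivative (\<lambda>v. k' x v \<odot> cl_para b)) (at x)"
      using bounded_linear.has_derivative[OF cl.bounded_linear_left k'(1)[OF x]] .
    from cl.FDERIV[OF this f'(1)[OF x]]
    show "(V b has_derivative (\<lambda>v. (k x \<odot> cl_para b) \<odot> f' x v + (k' x v \<odot> cl_para b) \<odot> f x)) (at x)"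
      unfolding V_def .
  next
    fix x assume "x \<in> cbox (y n) (y n + 2 *\<^sub>R H n)"
    then have x: "x \<in> strip a" using sub by blast
    have "(\<Sum>b\<in>Basis. (k x \<odot> cl_para b) \<odot> f' x b + (k' x b \<odot> cl_para b) \<odot> f x)
      = k x \<odot> (\<Sum>b\<in>Basis. cl_para b \<odot> f' x b) + (\<Sum>b\<in>Basis. k' x b \<odot> cl_para b) \<odot> f x"
      by (simp add: sum.distrib cl.sum_left cl.sum_right cl_mult_assoc)
    then show "(\<Sum>b\<in>Basis. (k x \<odot> cl_para b) \<odot> f' x b + (k' x b \<odot> cl_para b) \<odot> f x) = 0"
      using f'(2)[OF x] k'(2)[OF x] by (simp add: cl.zero_left cl.zero_right)
  qed
  obtain K where K: "K > 0" "\<And>a b. norm (a \<odot> b) \<le> K * (norm a * norm (b::'n cliff))"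
    using norm_cl_mult_bound by blast
  define C where "C = (\<Sum>b\<in>(Basis :: (real \<times> (real, 'n) vec) set). max (1 / h) 1 * (K * (K * norm (cl_para b :: 'n cliff))))"
  note i = A2_mult_integrable[OF f kA2]
  note [measurable] = A2_measurable[OF f] A2_measurable[OF kA2]
  \<comment> \<open>The bound is uniform in n since R n \<ge> 1.\<close>
  have tent_le: "\<bar>tent b (y n) (H n) x\<bar> \<le> max (1 / h) 1" if "b \<in> Basis" for b n x
  proof -
    have "\<bar>tent b (y n) (H n) x\<bar> \<le> 1 / (H n \<bullet> b)" by (rule abs_tent_le(2)[OF Hb that])
    also have "\<dots> \<le> max (1 / h) 1"
      using that R[of n] unfolding Basis_strip H_def by (auto simp: one le_max_iff_disj)
    finally show ?thesis .
  qed
  have V_le: "norm (V b x) \<le> K * (K * norm (cl_para b)) * (norm (k x) * norm (f x))" for b x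
  proof -
    have "norm (V b x) \<le> K * (norm (k x \<odot> cl_para b) * norm (f x))" unfolding V_def by (rule K(2))
    also have "\<dots> \<le> K * ((K * (norm (k x) * norm (cl_para b))) * norm (f x))"
      using K by (intro mult_left_mono mult_right_mono) auto
    finally show ?thesis by (simp add: mult_ac)
  qed
  \<comment> \<open>Outside the strip nothing is known about \<open>f\<close>, not even
    measurability; the tents vanish there, so indicators can be inserted.\<close>
  have tV: "tent b (y n) (H n) x *\<^sub>R V b x = tent b (y n) (H n) x *\<^sub>R (((indicator (strip a) x *\<^sub>R k x) \<odot> cl_para b) \<odot> (indicator (strip a) x *\<^sub>R f x))" for b n x
    using tent_eq_0[OF Hb, of x "y n" n b] sub[of n] by (cases "x \<in> strip a") (auto simp: V_def)
  have dV: "(dhat ((fst x - y0) / h) / h) *\<^sub>R (k x \<odot> f x) = (dhat ((fst x - y0) / h) / h) *\<^sub>R (indicator (strip a) x *\<^sub>R (k x \<odot> f x))" for x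
  proof (cases "x \<in> strip a")
    case False
    then have "(fst x - y0) / h \<notin> {0..2}" using h by (auto simp: strip_def abs_less_iff field_simps)
    then show ?thesis by (simp add: dhat_eq_0)
  qed simp
  have "(\<lambda>n. \<integral>x. (\<Sum>b\<in>Basis. tent b (y n) (H n) x *\<^sub>R V b x) \<partial>lborel) \<longlonglongrightarrow> (\<integral>x. (dhat ((fst x - y0) / h) / h) *\<^sub>R (k x \<odot> f x) \<partial>lborel)"
  proof (rule integral_dominated_convergence[where w="\<lambda>x. C * (indicator (strip a) x * (norm (k x) * norm (f x)))"])
    show "(\<lambda>x. (dhat ((fst x - y0) / h) / h) *\<^sub>R (k x \<odot> f x)) \<in> borel_measurable lborel"
      using borel_measurable_integrable[OF i(2)] unfolding dV by measurable
    show "(\<lambda>x. \<Sum>b\<in>Basis. tent b (y n) (H n) x *\<^sub>R V b x) \<in> borel_measurable lborel" for n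
      unfolding tV by measurable
    show "integrable lborel (\<lambda>x. C * (indicator (strip a) x * (norm (k x) * norm (f x))))"
      by (rule integrable_mult_right[OF i(1)])
    show "AE x in lborel. norm (\<Sum>b\<in>Basis. tent b (y n) (H n) x *\<^sub>R V b x) \<le> C * (indicator (strip a) x * (norm (k x) * norm (f x)))" for n
    proof (rule AE_I2)
      fix x :: "real \<times> (real, 'n) vec"
      show "norm (\<Sum>b\<in>Basis. tent b (y n) (H n) x *\<^sub>R V b x) \<le> C * (indicator (strip a) x * (norm (k x) * norm (f x)))"
      proof (cases "x \<in> strip a")
        case True
        have "norm (\<Sum>b\<in>Basis. tent b (y n) (H n) x *\<^sub>R V b x) \<le> (\<Sum>b\<in>(Basis :: (real \<times> (real, 'n) vec) set). max (1 / h) 1 * (K * (K * norm (cl_para b)) * (norm (k x) * norm (f x))))"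
          by (intro order_trans[OF norm_sum] sum_mono) (auto intro!: mult_mono tent_le V_le)
        also have "\<dots> = C * (norm (k x) * norm (f x))" by (simp add: C_def sum_distrib_right mult.assoc)
        finally show ?thesis using True by simp
      next
        case False
        then have "tent b (y n) (H n) x = 0" for b using sub[of n] by (intro tent_eq_0[OF Hb]) auto
        then show ?thesis using False by simp
      qed
    qed
    show "AE x in lborel. (\<lambda>n. \<Sum>b\<in>Basis. tent b (y n) (H n) x *\<^sub>R V b x) \<longlonglongrightarrow> (dhat ((fst x - y0) / h) / h) *\<^sub>R (k x \<odot> f x)"
    proof (rule AE_I2)
      fix x :: "real \<times> (real, 'n) vec"
      obtain t v where x: "x = (t, v)" by (cases x)
      have Rinf: "(\<lambda>n. 1 / R n) \<longlonglongrightarrow> 0" unfolding R_def by (rule LIMSEQ_Suc[OF lim_1_over_n])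
      have t1: "(\<lambda>n. tent (1, 0) (y n) (H n) x) \<longlonglongrightarrow> dhat ((t - y0) / h) / h"
      proof -
        have e: "tent (1, 0) (y n) (H n) x = dhat ((t - y0) / h) / h * (\<Prod>j\<in>UNIV. hat (1 + v $ j * (1 / R n)))" for n
        proof -
          have "(v + R n *\<^sub>R one) \<bullet> axis j 1 / R n = 1 + v $ j * (1 / R n)" for j
            using R[of n] by (simp add: inner_add_left one_def inner_axis field_simps)
          then show ?thesis
            unfolding tent_def prod_Basis_strip x y_def H_def by (simp add: one)
        qed
        have "(\<lambda>n. hat (1 + v $ j * (1 / R n))) \<longlonglongrightarrow> hat (1 + v $ j * 0)" for j
        proof (rule isCont_tendsto_compose[of _ hat])
          show "isCont hat (1 + v $ j * 0)"
            using continuous_on_hat[OF continuous_on_id, of UNIV] continuous_on_eq_continuous_at[OF open_UNIV] by blast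
        qed (intro tendsto_intros Rinf)
        then have "(\<lambda>n. dhat ((t - y0) / h) / h * (\<Prod>j\<in>UNIV. hat (1 + v $ j * (1 / R n)))) \<longlonglongrightarrow> dhat ((t - y0) / h) / h * (\<Prod>j\<in>(UNIV::'n set). hat (1 + v $ j * 0))"
          by (intro tendsto_mult tendsto_const tendsto_prod)
        then show ?thesis unfolding e by (simp add: hat_def)
      qed
      \<comment> \<open>Derivatives in space directions are of order 1 / R n, so only the time
        direction survives in the limit.\<close>
      have t2: "(\<lambda>n. tent (0, axis j 1) (y n) (H n) x) \<longlonglongrightarrow> 0" for j
      proof (rule Lim_null_comparison[OF _ Rinf])
        have "\<bar>tent (0, axis j 1) (y n) (H n) x\<bar> \<le> 1 / (H n \<bullet> (0, axis j 1))" for n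
          by (rule abs_tent_le(2)[OF Hb]) (auto simp: Basis_strip)
        then show "\<forall>\<^sub>F n in sequentially. norm (tent (0, axis j 1) (y n) (H n) x) \<le> 1 / R n"
          by (simp add: H_def one)
      qed
      have "(\<lambda>n. tent (1, 0) (y n) (H n) x *\<^sub>R V (1, 0) x + (\<Sum>j\<in>UNIV. tent (0, axis j 1) (y n) (H n) x *\<^sub>R V (0, axis j 1) x))
        \<longlonglongrightarrow> (dhat ((t - y0) / h) / h) *\<^sub>R V (1, 0) x + (\<Sum>j\<in>(UNIV::'n set). 0 *\<^sub>R V (0, axis j 1) x)"
        by (intro tendsto_add tendsto_sum tendsto_scaleR tendsto_const t1 t2)
      then show "(\<lambda>n. \<Sum>b\<in>Basis. tent b (y n) (H n) x *\<^sub>R V b x) \<longlonglongrightarrow> (dhat ((fst x - y0) / h) / h) *\<^sub>R (k x \<odot> f x)"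
        unfolding sum_Basis_strip by (simp add: V_def x)
    qed
  qed
  then show ?thesis unfolding V0 by (simp add: LIMSEQ_const_iff)
qed

text \<open>The factor \<open>dhat\<close> is 1 on the first half of its interval and -1 on the
  second. Thus the tent identity says that the slice pairing has equal integrals over adjacent
  intervals, as \<open>AE_constant_of_midpoint\<close> demands.\<close>

lemma A2_pairing_constant:
  fixes f :: "real \<times> (real, 'n::{finite,linorder}) vec \<Rightarrow> 'n cliff"
  assumes a: "a > 0" and f: "f \<in> A2 a" and B: "B \<in> sets borel" "bounded B"
  defines "k \<equiv> \<lambda>x. cl_rep (\<lambda>\<xi>. indicator B \<xi> *\<^sub>R cl_one) (- x)"
  shows "\<exists>c. AE t in lborel. t \<in> {-a<..<a} \<longrightarrow> (\<integral>v. k (t, v) \<odot> f (t, v) \<partial>lborel) = c"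
proof -
  have kA2: "k \<in> A2 a" unfolding k_def by (intro A2_minus cl_rep_in_A2 a indicator_exp_weighted[OF a B])
  let ?u = "\<lambda>x. indicator (strip a) x *\<^sub>R (k x \<odot> f x)"
  have i: "integrable lborel ?u" by (rule A2_mult_integrable(2)[OF f kA2])
  define \<kappa> where "\<kappa> t = (\<integral>v. ?u (t, v) \<partial>lborel)" for t
  have \<kappa>_eq: "\<kappa> t = (if t \<in> {-a<..<a} then \<integral>v. k (t, v) \<odot> f (t, v) \<partial>lborel else 0)" for t
    unfolding \<kappa>_def by (auto simp: indicator_def strip_def abs_less_iff)
  have i2: "integrable (lborel \<Otimes>\<^sub>M lborel) ?u" using i by (simp add: lborel_prod)
  have \<kappa>i: "integrable lborel \<kappa>"
    unfolding \<kappa>_def[abs_def] by (rule lborel_pair.integrable_fst'[OF i2])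
  have "\<exists>c. AE t in lborel. t \<in> {-a<..<a} \<longrightarrow> \<kappa> t = c"
  proof (rule AE_constant_of_midpoint[OF a \<kappa>i])
    show "\<kappa> t = 0" if "t \<notin> {-a<..<a}" for t using that by (auto simp: \<kappa>_eq)
    fix y0 h :: real assume h: "h > 0" "-a < y0" "y0 + 2 * h < a"
    let ?d = "\<lambda>t. dhat ((t - y0) / h) / h"
    have [measurable]: "?u \<in> borel_measurable borel" using borel_measurable_integrable[OF i] by simp
    have dle: "\<bar>?d t\<bar> \<le> 1 / h" for t using abs_dhat_le[of "(t - y0) / h"] h by (simp add: divide_right_mono)
    have di: "integrable lborel (\<lambda>x. ?d (fst x) *\<^sub>R ?u x)"
    proof (rule Bochner_Integration.integrable_bound[OF integrable_scaleR_right[OF i, of "1 / h"]])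
      show "AE x in lborel. norm (?d (fst x) *\<^sub>R ?u x) \<le> norm ((1 / h) *\<^sub>R ?u x)"
      proof (rule AE_I2)
        fix x
        show "norm (?d (fst x) *\<^sub>R ?u x) \<le> norm ((1 / h) *\<^sub>R ?u x)"
          unfolding norm_scaleR[of "?d (fst x)"] norm_scaleR[of "1 / h"] using dle[of "fst x"] h by (intro mult_right_mono) auto
      qed
    qed measurable
    have "0 = (\<integral>x. ?d (fst x) *\<^sub>R (k x \<odot> f x) \<partial>lborel)"
      using A2_tent_integral[OF a f B h] by (simp add: k_def)
    also have "\<dots> = (\<integral>x. ?d (fst x) *\<^sub>R ?u x \<partial>lborel)"
    proof (rule Bochner_Integration.integral_cong[OF refl])
      fix x :: "real \<times> (real, 'n) vec"
      show "?d (fst x) *\<^sub>R (k x \<odot> f x) = ?d (fst x) *\<^sub>R ?u x"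
      proof (cases "x \<in> strip a")
        case False
        then have "(fst x - y0) / h \<notin> {0..2}" using h by (auto simp: strip_def abs_less_iff field_simps)
        then show ?thesis by (simp add: dhat_eq_0)
      qed simp
    qed
    also have "\<dots> = (\<integral>t. (\<integral>v. ?d t *\<^sub>R ?u (t, v) \<partial>lborel) \<partial>lborel)"
      using lborel_pair.integral_fst'[of "\<lambda>x. ?d (fst x) *\<^sub>R ?u x"] di by (simp add: lborel_prod)
    also have "\<dots> = (\<integral>t. ?d t *\<^sub>R \<kappa> t \<partial>lborel)"
      unfolding \<kappa>_def by (simp only: integral_scaleR_right)
    also have "\<dots> = (\<integral>t. (1 / h) *\<^sub>R (indicator {y0..y0+h} t *\<^sub>R \<kappa> t - indicator {y0+h..y0+2*h} t *\<^sub>R \<kappa> t) \<partial>lborel)"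
    proof (rule integral_cong_AE)
      have [measurable]: "\<kappa> \<in> borel_measurable borel" using borel_measurable_integrable[OF \<kappa>i] by simp
      show "(\<lambda>t. ?d t *\<^sub>R \<kappa> t) \<in> borel_measurable lborel" by measurable
      show "(\<lambda>t. (1 / h) *\<^sub>R (indicator {y0..y0+h} t *\<^sub>R \<kappa> t - indicator {y0+h..y0+2*h} t *\<^sub>R \<kappa> t)) \<in> borel_measurable lborel" by measurable
      show "AE t in lborel. ?d t *\<^sub>R \<kappa> t = (1 / h) *\<^sub>R (indicator {y0..y0+h} t *\<^sub>R \<kappa> t - indicator {y0+h..y0+2*h} t *\<^sub>R \<kappa> t)"
        using AE_lborel_singleton[of y0] AE_lborel_singleton[of "y0 + h"] AE_lborel_singleton[of "y0 + 2 * h"]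
      proof eventually_elim
        case (elim t)
        have "dhat ((t - y0) / h) = indicator {y0..y0+h} t - indicator {y0+h..y0+2*h} t"
          using elim h unfolding dhat_def ramp_deriv_def by (auto simp: indicator_def field_simps)
        then show ?case by (simp add: scaleR_diff_left scaleR_diff_right right_diff_distrib divide_inverse mult.commute)
      qed
    qed
    also have "\<dots> = (1 / h) *\<^sub>R (integral {y0..y0+h} \<kappa> - integral {y0+h..y0+2*h} \<kappa>)"
    proof -
      have s: "set_integrable lborel {u..v} \<kappa>" for u v
        unfolding set_integrable_def by (intro integrable_mult_indicator \<kappa>i) auto
      have "integral {u..v} \<kappa> = (\<integral>t. indicator {u..v} t *\<^sub>R \<kappa> t \<partial>lborel)" for u v
        using set_borel_integral_eq_integral(2)[OF s] by (simp add: set_lebesgue_integral_def)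
      then show ?thesis
        using s unfolding set_integrable_def by (simp add: integral_scaleR_right)
    qed
    finally show "integral {y0..y0+h} \<kappa> = integral {y0+h..y0+2*h} \<kappa>" using h by simp
  qed
  then show ?thesis unfolding \<kappa>_eq by (auto elim!: eventually_mono)
qed

section \<open>The integral representation\<close>

lemma fourier_L2_cong_AE:
  fixes h :: "(real, 'n::finite) vec \<Rightarrow> 'm::finite cliff"
  assumes H: "fourier_L2 h H" and G: "G \<in> borel_measurable borel" and eq: "AE \<xi> in lborel. H \<xi> = G \<xi>"
  shows "fourier_L2 h G"
  unfolding fourier_L2_def
proof (intro conjI fourier_L2D(1)[OF H])
  note [measurable] = G L2_measurable[OF fourier_L2D(2)[OF H]]
  have "(\<integral>\<^sup>+\<xi>. ennreal ((norm (G \<xi>))\<^sup>2) \<partial>lborel) = (\<integral>\<^sup>+\<xi>. ennreal ((norm (H \<xi>))\<^sup>2) \<partial>lborel)"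
    using eq by (intro nn_integral_cong_AE) auto
  then show "L2 G" using G fourier_L2D(2)[OF H] by (simp add: L2_iff_nn_integral)
  have "(\<integral>\<^sup>+\<xi>. ennreal ((norm (fourier1 (\<lambda>x. indicator (ball 0 R) x *\<^sub>R h x) \<xi> - G \<xi>))\<^sup>2) \<partial>lborel)
    = (\<integral>\<^sup>+\<xi>. ennreal ((norm (fourier1 (\<lambda>x. indicator (ball 0 R) x *\<^sub>R h x) \<xi> - H \<xi>))\<^sup>2) \<partial>lborel)" for R
    using eq by (intro nn_integral_cong_AE) auto
  then show "((\<lambda>R. \<integral>\<^sup>+\<xi>. ennreal ((norm (fourier1 (\<lambda>x. indicator (ball 0 R) x *\<^sub>R h x) \<xi> - G \<xi>))\<^sup>2) \<partial>lborel) \<longlongrightarrow> 0) at_top"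
    using fourier_L2D(3)[OF H] by simp
qed

lemma AE_lborel_dense:
  assumes P: "AE t in lborel. P t" and "u < (v::real)"
  obtains t where "u < t" "t < v" "P t"
proof (rule ccontr)
  assume neg: "\<not> thesis"
  have "AE t in lborel. t \<notin> {u<..<v}"
    using P by eventually_elim (use neg that in auto)
  then have "{u<..<v} \<in> null_sets lborel"
    by (subst AE_iff_null_sets) auto
  then have "emeasure lborel {u<..<v} = 0" by blast
  then show False using \<open>u < v\<close> by simp
qed

lemma cl_exp_tendsto: "((\<lambda>t. cl_exp t \<xi> \<odot> y) \<longlongrightarrow> y) (at 0)"
proof -
  have "isCont (\<lambda>t. cosh (t * norm \<xi>) *\<^sub>R y - (\<i> * of_real (sinh (t * norm \<xi>) / norm \<xi>)) *s (cl_vec \<xi> \<odot> y)) 0"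
    by (cases "\<xi> = 0") (auto intro!: continuous_intros vsmult.continuous)
  then show ?thesis
    unfolding isCont_def cl_exp_mult by simp
qed

text \<open>Parseval turns the pairing into the integral of exp (i t \<xi>) H over B. Its
  independence of t is the integrated form of the differential equation for the transforms of the
  slices.\<close>

lemma pairing_fourier:
  fixes f :: "real \<times> (real, 'n::{finite,linorder}) vec \<Rightarrow> 'n cliff"
  assumes a: "a > 0" and B: "B \<in> sets borel" "bounded B" and t: "\<bar>t\<bar> < a"
    and H: "fourier_L2 (\<lambda>v. f (t, v)) H"
  shows "(\<integral>v. cl_rep (\<lambda>\<xi>. indicator B \<xi> *\<^sub>R cl_one) (- (t, v)) \<odot> f (t, v) \<partial>lborel) = (\<integral>\<xi>. indicator B \<xi> *\<^sub>R (cl_exp (- t) \<xi> \<odot> H \<xi>) \<partial>lborel)"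
    and "integrable lborel (\<lambda>\<xi>. indicator B \<xi> *\<^sub>R (cl_exp (- t) \<xi> \<odot> H \<xi>))"
proof -
  let ?g = "\<lambda>\<xi>. indicator B \<xi> *\<^sub>R (cl_one :: 'n cliff)"
  let ?b = "\<lambda>\<xi>. cl_exp (- t) \<xi> \<odot> ?g \<xi>"
  have g: "exp_weighted a ?g" by (rule exp_weighted_bweight[OF a indicator_exp_weighted[OF a B]])
  have mt: "\<bar>- t\<bar> < a" using t by simp
  note b = exp_weighted_exp[OF g mt]
  have e: "?b \<xi> \<odot> H \<xi> = indicator B \<xi> *\<^sub>R (cl_exp (- t) \<xi> \<odot> H \<xi>)" for \<xi>
    by (simp add: cl.scaleR_right cl.scaleR_left)
  show "(\<integral>v. cl_rep ?g (- (t, v)) \<odot> f (t, v) \<partial>lborel) = (\<integral>\<xi>. indicator B \<xi> *\<^sub>R (cl_exp (- t) \<xi> \<odot> H \<xi>) \<partial>lborel)"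
    using fourier_parseval[OF b H] unfolding e by (simp add: cl_rep_fourier1)
  show "integrable lborel (\<lambda>\<xi>. indicator B \<xi> *\<^sub>R (cl_exp (- t) \<xi> \<odot> H \<xi>))"
    using L2_cl_mult(2)[OF b(2) fourier_L2D(2)[OF H]] unfolding e .
qed

text \<open>At all good times exp (i t \<xi>) times the transform of the slice has the same
  integrals over a generating class of sets, hence is one and the same function almost
  everywhere.\<close>

lemma A2_representation_ae:
  fixes f :: "real \<times> (real, 'n::{finite,linorder}) vec \<Rightarrow> 'n cliff"
  assumes a: "a > 0" and f: "f \<in> A2 a"
  obtains g where "g \<in> borel_measurable borel"
    "AE t in lborel. t \<in> {-a<..<a} \<longrightarrow> fourier_L2 (\<lambda>v. f (t, v)) (\<lambda>\<xi>. cl_exp t \<xi> \<odot> g \<xi>)"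
proof -
  obtain E :: "(real, 'n) vec set set" where E: "countable E" "Int_stable E" "UNIV \<in> E" "sets borel = sigma_sets UNIV E"
    by (rule countable_Int_stable_generator)
  \<comment> \<open>Test spectra must be bounded; the balls exhaust the space.\<close>
  define B where "B X n = X \<inter> ball 0 (real n)" for X :: "(real, 'n) vec set" and n
  have B: "B X n \<in> sets borel" "bounded (B X n)" if "X \<in> E" for X n
  proof -
    have "X \<in> sets borel" using that unfolding E(4) by blast
    then show "B X n \<in> sets borel" unfolding B_def by (intro sets.Int) simp_all
    show "bounded (B X n)" unfolding B_def by (intro bounded_Int) simp
  qed
  define \<kappa> where "\<kappa> X n t = (\<integral>v. cl_rep (\<lambda>\<xi>. indicator (B X n) \<xi> *\<^sub>R cl_one) (- (t, v)) \<odot> f (t, v) \<partial>lborel)" for X n t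
  have "\<exists>c. AE t in lborel. t \<in> {-a<..<a} \<longrightarrow> \<kappa> X n t = c" if "X \<in> E" for X n
    unfolding \<kappa>_def by (rule A2_pairing_constant[OF a f B[OF that]])
  then obtain c where c: "\<And>X n. X \<in> E \<Longrightarrow> AE t in lborel. t \<in> {-a<..<a} \<longrightarrow> \<kappa> X n t = c X n"
    by metis
  define good where "good t \<longleftrightarrow> L2 (\<lambda>v. f (t, v)) \<and> (\<forall>X\<in>E. \<forall>n. \<kappa> X n t = c X n)" for t
  have ae: "AE t in lborel. t \<in> {-a<..<a} \<longrightarrow> good t"
  proof -
    have "AE t in lborel. \<forall>X\<in>E. \<forall>n. t \<in> {-a<..<a} \<longrightarrow> \<kappa> X n t = c X n"
      unfolding AE_ball_countable[OF E(1)] AE_all_countable using c by blast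
    then show ?thesis
      using A2_slice_L2[OF f] by eventually_elim (auto simp: good_def)
  qed
  obtain t0 where t0: "-a < t0" "t0 < a" "good t0"
    using AE_lborel_dense[OF ae, of "-a" a] a by auto
  have "\<exists>H. \<forall>t. good t \<longrightarrow> fourier_L2 (\<lambda>v. f (t, v)) (H t)"
    by (rule choice) (metis good_def fourier_L2_exists)
  then obtain H where H: "\<And>t. good t \<Longrightarrow> fourier_L2 (\<lambda>v. f (t, v)) (H t)" by blast
  have Hm: "H t \<in> borel_measurable borel" if "good t" for t
    by (rule L2_measurable[OF fourier_L2D(2)[OF H[OF that]]])
  define g where "g \<xi> = cl_exp (- t0) \<xi> \<odot> H t0 \<xi>" for \<xi>
  have gm: "g \<in> borel_measurable borel"
    using Hm[OF t0(3)] unfolding g_def[abs_def] by measurable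
  have eq: "AE \<xi> in lborel. H t \<xi> = cl_exp t \<xi> \<odot> g \<xi>" if t: "good t" "t \<in> {-a<..<a}" for t
  proof -
    let ?u = "\<lambda>t \<xi>. cl_exp (- t) \<xi> \<odot> H t \<xi>"
    have "AE \<xi> in lborel. indicator (ball 0 (real n)) \<xi> *\<^sub>R ?u t \<xi> - indicator (ball 0 (real n)) \<xi> *\<^sub>R ?u t0 \<xi> = 0" for n
    proof (rule AE_zero_of_integral_zero[OF _ E(2,4), where A="\<lambda>_. UNIV"])
      have p: "(\<integral>\<xi>. indicator (B X n) \<xi> *\<^sub>R ?u s \<xi> \<partial>lborel) = c X n" "integrable lborel (\<lambda>\<xi>. indicator (B X n) \<xi> *\<^sub>R ?u s \<xi>)"
        if "good s" "s \<in> {-a<..<a}" "X \<in> E" for s X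
      proof -
        have s: "\<bar>s\<bar> < a" using that by auto
        note P = pairing_fourier[OF a B[OF \<open>X \<in> E\<close>] s H[OF \<open>good s\<close>]]
        show "integrable lborel (\<lambda>\<xi>. indicator (B X n) \<xi> *\<^sub>R ?u s \<xi>)" by (rule P(2))
        show "(\<integral>\<xi>. indicator (B X n) \<xi> *\<^sub>R ?u s \<xi> \<partial>lborel) = c X n"
          using P(1)[of n] \<open>good s\<close> \<open>X \<in> E\<close> unfolding good_def \<kappa>_def by simp
      qed
      have t0': "t0 \<in> {-a<..<a}" using t0 by simp
      have "B UNIV n = ball 0 (real n)" by (simp add: B_def)
      then show "integrable lborel (\<lambda>\<xi>. indicator (ball 0 (real n)) \<xi> *\<^sub>R ?u t \<xi> - indicator (ball 0 (real n)) \<xi> *\<^sub>R ?u t0 \<xi>)"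
        using p(2)[OF t E(3)] p(2)[OF t0(3) t0' E(3)] by simp
      fix X assume X: "X \<in> E"
      have "indicator X \<xi> *\<^sub>R (indicator (ball 0 (real n)) \<xi> *\<^sub>R ?u t \<xi> - indicator (ball 0 (real n)) \<xi> *\<^sub>R ?u t0 \<xi>)
        = indicator (B X n) \<xi> *\<^sub>R ?u t \<xi> - indicator (B X n) \<xi> *\<^sub>R ?u t0 \<xi>" for \<xi>
        by (auto simp: B_def indicator_def)
      then show "(\<integral>\<xi>. indicator X \<xi> *\<^sub>R (indicator (ball 0 (real n)) \<xi> *\<^sub>R ?u t \<xi> - indicator (ball 0 (real n)) \<xi> *\<^sub>R ?u t0 \<xi>) \<partial>lborel) = 0"
        using p[OF t X] p[OF t0(3) t0' X] by simp
    qed (use E in auto)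
    then have "AE \<xi> in lborel. \<forall>n::nat. indicator (ball 0 (real n)) \<xi> *\<^sub>R ?u t \<xi> - indicator (ball 0 (real n)) \<xi> *\<^sub>R ?u t0 \<xi> = 0"
      by (simp only: AE_all_countable) blast
    then show ?thesis
    proof eventually_elim
      case (elim \<xi>)
      obtain n :: nat where "norm \<xi> < real n" using reals_Archimedean2 by blast
      then have "?u t \<xi> = g \<xi>" using elim[rule_format, of n] by (simp add: g_def)
      \<comment> \<open>Multiplying by exp (- i t \<xi>) undoes the factor exp (i t \<xi>), by the
        group law.\<close>
      then show "H t \<xi> = cl_exp t \<xi> \<odot> g \<xi>"
        using cl_exp_add[of t \<xi> "- t" "H t \<xi>"] by simp
    qed
  qed
  have "AE t in lborel. t \<in> {-a<..<a} \<longrightarrow> fourier_L2 (\<lambda>v. f (t, v)) (\<lambda>\<xi>. cl_exp t \<xi> \<odot> g \<xi>)"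
    using ae
  proof eventually_elim
    case (elim t)
    show ?case
    proof
      assume t: "t \<in> {-a<..<a}"
      then have gt: "good t" using elim by blast
      have "(\<lambda>\<xi>. cl_exp t \<xi> \<odot> g \<xi>) \<in> borel_measurable borel" using gm by measurable
      then show "fourier_L2 (\<lambda>v. f (t, v)) (\<lambda>\<xi>. cl_exp t \<xi> \<odot> g \<xi>)"
        by (rule fourier_L2_cong_AE[OF H[OF gt] _ eq[OF gt t]])
    qed
  qed
  with gm that show thesis by blast
qed

text \<open>On good slices the Plancherel bound controls the weighted norm and inversion yields the
  formula. Good times are dense and both sides of the formula are continuous, which extends it to
  the whole strip.\<close>

lemma A2_representation:
  fixes f :: "real \<times> (real, 'n::{finite,linorder}) vec \<Rightarrow> 'n cliff"
  assumes a: "a > 0" and f: "f \<in> A2 a"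
  obtains g where "g \<in> borel_measurable borel"
    "(\<integral>\<^sup>+\<xi>. ennreal (bweight a \<xi> * (norm (g \<xi>))\<^sup>2) \<partial>lborel) < \<infinity>"
    "AE t in lborel. t \<in> {-a<..<a} \<longrightarrow> fourier_L2 (\<lambda>v. f (t, v)) (\<lambda>\<xi>. cl_exp t \<xi> \<odot> g \<xi>)"
    "\<And>x. x \<in> strip a \<Longrightarrow> f x = (1 / (2 * pi) ^ CARD('n)) *\<^sub>R cl_rep g x"
proof -
  obtain g where gm [measurable]: "g \<in> borel_measurable borel"
    and F: "AE t in lborel. t \<in> {-a<..<a} \<longrightarrow> fourier_L2 (\<lambda>v. f (t, v)) (\<lambda>\<xi>. cl_exp t \<xi> \<odot> g \<xi>)"
    using A2_representation_ae[OF a f] by blast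
  have "(\<integral>\<^sup>+\<xi>. ennreal (bweight a \<xi> * (norm (g \<xi>))\<^sup>2) \<partial>lborel)
    = (\<integral>\<^sup>+t. indicator {-a<..<a} t * (\<integral>\<^sup>+\<xi>. ennreal ((norm (cl_exp t \<xi> \<odot> g \<xi>))\<^sup>2) \<partial>lborel) \<partial>lborel)"
    by (rule nn_integral_bweight[OF a gm])
  also have "\<dots> \<le> (\<integral>\<^sup>+t. ennreal ((2 * pi) ^ CARD('n)) * (indicator {-a<..<a} t * (\<integral>\<^sup>+v. ennreal ((norm (f (t, v)))\<^sup>2) \<partial>lborel)) \<partial>lborel)"
  proof (rule nn_integral_mono_AE)
    show "AE t in lborel. indicator {-a<..<a} t * (\<integral>\<^sup>+\<xi>. ennreal ((norm (cl_exp t \<xi> \<odot> g \<xi>))\<^sup>2) \<partial>lborel)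
       \<le> ennreal ((2 * pi) ^ CARD('n)) * (indicator {-a<..<a} t * (\<integral>\<^sup>+v. ennreal ((norm (f (t, v)))\<^sup>2) \<partial>lborel))"
      using F
    proof eventually_elim
      case (elim t)
      then show ?case using fourier_L2_bound[of "\<lambda>v. f (t, v)" "\<lambda>\<xi>. cl_exp t \<xi> \<odot> g \<xi>"]
        by (cases "t \<in> {-a<..<a}") (auto simp: indicator_def)
    qed
  qed
  also have "\<dots> = ennreal ((2 * pi) ^ CARD('n)) * (\<integral>\<^sup>+t. indicator {-a<..<a} t * (\<integral>\<^sup>+v. ennreal ((norm (f (t, v)))\<^sup>2) \<partial>lborel) \<partial>lborel)"
    using A2_nn_integral(1)[OF f] by (intro nn_integral_cmult) simp
  also have "\<dots> < \<infinity>"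
    using A2_nn_integral(2)[OF f] by (simp add: ennreal_mult_less_top)
  finally have fin: "(\<integral>\<^sup>+\<xi>. ennreal (bweight a \<xi> * (norm (g \<xi>))\<^sup>2) \<partial>lborel) < \<infinity>" .
  have g: "exp_weighted a g" by (rule exp_weighted_bweight[OF a gm fin])
  let ?F = "\<lambda>x. (1 / (2 * pi) ^ CARD('n)) *\<^sub>R cl_rep g x"
  have good: "f (t, v) = ?F (t, v)" if t: "t \<in> {-a<..<a}" and Ft: "fourier_L2 (\<lambda>v. f (t, v)) (\<lambda>\<xi>. cl_exp t \<xi> \<odot> g \<xi>)" for t v
  proof -
    have ta: "\<bar>t\<bar> < a" using t by auto
    have "(2 * pi) ^ CARD('n) *\<^sub>R f (t, v) = (\<integral>\<xi>. exp (\<i> * of_real (v \<bullet> \<xi>)) *s (cl_exp t \<xi> \<odot> g \<xi>) \<partial>lborel)"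
      by (rule fourier_inversion[OF Ft exp_weighted_exp(1)[OF g ta] A2_slice_isCont[OF f ta]])
    then have "(2 * pi) ^ CARD('n) *\<^sub>R f (t, v) = cl_rep g (t, v)" by (simp add: cl_rep_def)
    then have "?F (t, v) = (1 / (2 * pi) ^ CARD('n)) *\<^sub>R ((2 * pi) ^ CARD('n) *\<^sub>R f (t, v))" by simp
    also have "\<dots> = f (t, v)" unfolding scaleR_scaleR by simp
    finally show ?thesis by simp
  qed
  have "f x = ?F x" if x: "x \<in> strip a" for x
  proof (rule ccontr)
    assume ne: "f x \<noteq> ?F x"
    obtain t1 v where xe: "x = (t1, v)" by (cases x)
    have t1: "\<bar>t1\<bar> < a" using x by (simp add: xe strip_def)
    let ?d = "\<lambda>t. f (t, v) - ?F (t, v)"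
    have c1: "isCont (\<lambda>x. f x - ?F x) (t1, v)"
      using A2_isCont[OF f x] has_derivative_continuous[OF cl_rep_has_derivative(2)[OF g x]]
      unfolding xe by (intro continuous_intros)
    have c2: "isCont (\<lambda>t. (t, v)) t1" by (intro continuous_intros)
    have "isCont ?d t1" using isCont_o2[OF c2 c1] by simp
    \<comment> \<open>A nonzero difference at t1 would persist nearby, yet there are good times
      immediately to the right of t1.\<close>
    then have "\<forall>\<^sub>F t in at t1. ?d t \<noteq> 0"
      using ne unfolding isCont_def xe by (intro tendsto_imp_eventually_ne[of _ "?d t1"]) auto
    then obtain \<delta> where \<delta>: "\<delta> > 0" "\<And>t. t \<noteq> t1 \<Longrightarrow> \<bar>t - t1\<bar> < \<delta> \<Longrightarrow> ?d t \<noteq> 0"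
      unfolding eventually_at dist_real_def by auto
    have "t1 < min a (t1 + \<delta>)" using t1 \<delta>(1) by auto
    from AE_lborel_dense[OF F this] obtain t where t: "t1 < t" "t < min a (t1 + \<delta>)"
      "t \<in> {-a<..<a} \<longrightarrow> fourier_L2 (\<lambda>v. f (t, v)) (\<lambda>\<xi>. cl_exp t \<xi> \<odot> g \<xi>)" by blast
    then have "t \<in> {-a<..<a}" using t1 by auto
    then have "?d t = 0" using good[of t v] t(3) by simp
    then show False using \<delta>(2)[of t] t by auto
  qed
  with gm fin F that show thesis by blast
qed

section \<open>The Fourier transform of the trace at time zero\<close>

lemma L2_scaleR: "L2 h \<Longrightarrow> L2 (\<lambda>x. c *\<^sub>R h x)"
  unfolding L2_def by (auto simp: power_mult_distrib)

text \<open>Time 0 may be exceptional. Good times T n tend to 0, their slices converge in L2 to the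
  trace, and their spectra converge to g; any transform H of the trace must therefore equal
  g.\<close>

lemma A2_fourier_trace:
  fixes f :: "real \<times> (real, 'n::{finite,linorder}) vec \<Rightarrow> 'n cliff"
  assumes a: "a > 0" and gm [measurable]: "g \<in> borel_measurable borel"
    and fin: "(\<integral>\<^sup>+\<xi>. ennreal (bweight a \<xi> * (norm (g \<xi>))\<^sup>2) \<partial>lborel) < \<infinity>"
    and F: "AE t in lborel. t \<in> {-a<..<a} \<longrightarrow> fourier_L2 (\<lambda>v. f (t, v)) (\<lambda>\<xi>. cl_exp t \<xi> \<odot> g \<xi>)"
    and rep: "\<And>x. x \<in> strip a \<Longrightarrow> f x = (1 / (2 * pi) ^ CARD('n)) *\<^sub>R cl_rep g x"
  shows "fourier_L2 (\<lambda>v. f (0, v)) g"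
proof -
  have g: "exp_weighted a g" by (rule exp_weighted_bweight[OF a gm fin])
  let ?c = "1 / (2 * pi) ^ CARD('n)"
  let ?u = "\<lambda>t \<xi>. cl_exp t \<xi> \<odot> g \<xi>"
  have f_eq: "f (t, v) = ?c *\<^sub>R fourier1 (?u t) (- v)" if "\<bar>t\<bar> < a" for t v
    using rep[of "(t, v)"] that by (simp add: strip_def cl_rep_fourier1)
  have u0: "?u 0 = g" by simp
  have gL: "integrable lborel g" "L2 g"
    using exp_weighted_exp[OF g, of 0] a by simp_all
  have f0: "L2 (\<lambda>v. f (0, v))"
  proof -
    have m: "(\<lambda>v. fourier1 g (- v)) \<in> borel_measurable borel"
      using measurable_compose[OF borel_measurable_uminus[OF measurable_ident] fourier1_measurable[OF gm]] by simp
    have "(\<integral>\<^sup>+v. ennreal ((norm (fourier1 g (- v)))\<^sup>2) \<partial>lborel) < \<infinity>"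
      using fourier1_L2_bound_nn[OF gL] gL(2) by (auto simp: L2_iff_nn_integral ennreal_mult_less_top intro: le_less_trans)
    with m have "L2 (\<lambda>v. fourier1 g (- v))" by (simp add: L2_iff_nn_integral)
    then have "L2 (\<lambda>v. ?c *\<^sub>R fourier1 g (- v))" by (rule L2_scaleR)
    then show ?thesis using f_eq[of 0] a by simp
  qed
  obtain H where H: "fourier_L2 (\<lambda>v. f (0, v)) H" using fourier_L2_exists[OF f0] by blast
  note [measurable] = L2_measurable[OF fourier_L2D(2)[OF H]]
  \<comment> \<open>The offset 2 keeps T n below a / 2, so that exp (a |\<xi>|) |g|^2, which is
    integrable, dominates all the squared spectra.\<close>
  have "\<exists>T. \<forall>n. 0 < T n \<and> T n < a / real (n + 2) \<and> fourier_L2 (\<lambda>v. f (T n, v)) (?u (T n))"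
  proof (rule choice, rule allI)
    fix n
    have "0 < a / real (n + 2)" using a by simp
    from AE_lborel_dense[OF F this] obtain t where t: "0 < t" "t < a / real (n + 2)"
      "t \<in> {-a<..<a} \<longrightarrow> fourier_L2 (\<lambda>v. f (t, v)) (?u t)" by blast
    have "a / real (n + 2) \<le> a" using a by (simp add: field_simps)
    then show "\<exists>t. 0 < t \<and> t < a / real (n + 2) \<and> fourier_L2 (\<lambda>v. f (t, v)) (?u t)"
      using t a by (intro exI[of _ t]) auto
  qed
  then obtain T where T: "\<And>n. 0 < T n" "\<And>n. T n < a / real (n + 2)" "\<And>n. fourier_L2 (\<lambda>v. f (T n, v)) (?u (T n))" by blast
  have Ta: "T n < a / 2" "\<bar>T n\<bar> < a" for n
  proof -
    have "a / real (n + 2) \<le> a / 2" using a by (intro divide_left_mono) auto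
    then show "T n < a / 2" using T(2)[of n] by linarith
    then show "\<bar>T n\<bar> < a" using T(1)[of n] a by linarith
  qed
  have T0: "T \<longlonglongrightarrow> 0"
  proof (rule tendsto_sandwich[OF _ _ tendsto_const])
    have "(\<lambda>n. a / real (n + 2)) \<longlonglongrightarrow> 0"
      using LIMSEQ_ignore_initial_segment[OF lim_const_over_n[of a], of 2] by simp
    then show "(\<lambda>n. a / real (n + 2)) \<longlonglongrightarrow> 0" .
    show "\<forall>\<^sub>F n in sequentially. 0 \<le> T n" using T(1) by (auto simp: less_imp_le)
    show "\<forall>\<^sub>F n in sequentially. T n \<le> a / real (n + 2)" using T(2) by (auto simp: less_imp_le)
  qed
  let ?D = "\<lambda>n. \<integral>\<^sup>+\<xi>. ennreal ((norm (g \<xi> - ?u (T n) \<xi>))\<^sup>2) \<partial>lborel"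
  have D: "?D \<longlonglongrightarrow> 0"
  proof -
    have w: "integrable lborel (\<lambda>\<xi>. 4 * (exp (2 * (a / 2) * norm \<xi>) * (norm (g \<xi>))\<^sup>2))"
    proof (rule integrable_mult_right)
      have "a / 2 < a" using a by simp
      then show "integrable lborel (\<lambda>\<xi>. exp (2 * (a / 2) * norm \<xi>) * (norm (g \<xi>))\<^sup>2)"
        using g unfolding exp_weighted_def by blast
    qed
    have "?D \<longlonglongrightarrow> (\<integral>\<^sup>+\<xi>. 0 \<partial>(lborel :: (real, 'n) vec measure))"
    proof (rule nn_integral_dominated_convergence[where w="\<lambda>\<xi>. ennreal (4 * (exp (2 * (a / 2) * norm \<xi>) * (norm (g \<xi>))\<^sup>2))"])
      show "(\<integral>\<^sup>+\<xi>. ennreal (4 * (exp (2 * (a / 2) * norm \<xi>) * (norm (g \<xi>))\<^sup>2)) \<partial>lborel) < \<infinity>"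
        by (subst nn_integral_eq_integral[OF w]) auto
      show "AE \<xi> in lborel. (\<lambda>n. ennreal ((norm (g \<xi> - ?u (T n) \<xi>))\<^sup>2)) \<longlonglongrightarrow> 0"
      proof (rule AE_I2)
        fix \<xi> :: "(real, 'n) vec"
        have "(\<lambda>n. ?u (T n) \<xi>) \<longlonglongrightarrow> g \<xi>"
        proof (rule filterlim_compose[OF cl_exp_tendsto])
          show "filterlim T (at 0) sequentially"
            unfolding filterlim_at using T0 T(1) by (auto simp: less_imp_neq[THEN not_sym])
        qed
        then have "(\<lambda>n. (norm (g \<xi> - ?u (T n) \<xi>))\<^sup>2) \<longlonglongrightarrow> (norm (g \<xi> - g \<xi>))\<^sup>2"
          by (intro tendsto_intros)
        then show "(\<lambda>n. ennreal ((norm (g \<xi> - ?u (T n) \<xi>))\<^sup>2)) \<longlonglongrightarrow> 0"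
          using tendsto_ennrealI by fastforce
      qed
      show "AE \<xi> in lborel. ennreal ((norm (g \<xi> - ?u (T n) \<xi>))\<^sup>2) \<le> ennreal (4 * (exp (2 * (a / 2) * norm \<xi>) * (norm (g \<xi>))\<^sup>2))" for n
      proof (intro AE_I2 ennreal_leI)
        fix \<xi> :: "(real, 'n) vec"
        let ?e = "exp (a / 2 * norm \<xi>)"
        have e1: "norm (g \<xi>) \<le> ?e * norm (g \<xi>)" using a mult_right_mono[of 1 ?e "norm (g \<xi>)"] by simp
        have "exp (\<bar>T n\<bar> * norm \<xi>) \<le> ?e"
          unfolding exp_le_cancel_iff by (rule mult_right_mono) (use T(1)[of n] Ta(1)[of n] in auto)
        then have e2: "norm (?u (T n) \<xi>) \<le> ?e * norm (g \<xi>)"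
          by (intro order_trans[OF norm_cl_exp_le] mult_right_mono) auto
        have "(norm (g \<xi> - ?u (T n) \<xi>))\<^sup>2 \<le> 2 * (norm (g \<xi>))\<^sup>2 + 2 * (norm (?u (T n) \<xi>))\<^sup>2"
          by (rule norm_diff_power2_le)
        also have "\<dots> \<le> 2 * (?e * norm (g \<xi>))\<^sup>2 + 2 * (?e * norm (g \<xi>))\<^sup>2"
          by (intro add_mono mult_left_mono power_mono e1 e2) auto
        also have "\<dots> = 4 * (exp (2 * (a / 2) * norm \<xi>) * (norm (g \<xi>))\<^sup>2)"
          by (simp add: power_mult_distrib exp_double[symmetric])
        finally show "(norm (g \<xi> - ?u (T n) \<xi>))\<^sup>2 \<le> 4 * (exp (2 * (a / 2) * norm \<xi>) * (norm (g \<xi>))\<^sup>2)" .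
      qed
    qed measurable
    then show ?thesis by simp
  qed
  have HD: "(\<lambda>n. \<integral>\<^sup>+\<xi>. ennreal ((norm (H \<xi> - ?u (T n) \<xi>))\<^sup>2) \<partial>lborel) \<longlonglongrightarrow> 0"
  proof (rule tendsto_sandwich[OF _ _ tendsto_const])
    let ?P = "ennreal ((2 * pi) ^ CARD('n))"
    \<comment> \<open>The outer \<open>?P\<close> comes from the transform of the difference of
      slices, \<open>?c\<close> from the normalisation, and the inner \<open>?P\<close> from
      representing that difference as an inverse transform.\<close>
    have "(\<lambda>n. ?P * (ennreal (?c\<^sup>2) * (?P * ?D n))) \<longlonglongrightarrow> ?P * (ennreal (?c\<^sup>2) * (?P * 0))"
      by (intro ennreal_tendsto_cmult D) auto
    then show "(\<lambda>n. ?P * (ennreal (?c\<^sup>2) * (?P * ?D n))) \<longlonglongrightarrow> 0" by simp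
    have "(\<integral>\<^sup>+\<xi>. ennreal ((norm (H \<xi> - ?u (T n) \<xi>))\<^sup>2) \<partial>lborel) \<le> ?P * (ennreal (?c\<^sup>2) * (?P * ?D n))" for n
    proof -
      let ?w = "\<lambda>\<xi>. g \<xi> - ?u (T n) \<xi>"
      note uT = exp_weighted_exp[OF g Ta(2)[of n]]
      have wi: "integrable lborel ?w" "L2 ?w" using gL uT by (auto intro: L2_diff)
      have [measurable]: "fourier1 ?w \<in> borel_measurable borel" by (rule fourier1_measurable) measurable
      have "(\<integral>\<^sup>+\<xi>. ennreal ((norm (H \<xi> - ?u (T n) \<xi>))\<^sup>2) \<partial>lborel) \<le> ?P * (\<integral>\<^sup>+v. ennreal ((norm (f (0, v) - f (T n, v)))\<^sup>2) \<partial>lborel)"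
        by (rule fourier_L2_bound[OF fourier_L2_diff[OF H T(3)]])
      also have "(\<integral>\<^sup>+v. ennreal ((norm (f (0, v) - f (T n, v)))\<^sup>2) \<partial>lborel) = (\<integral>\<^sup>+v. ennreal (?c\<^sup>2) * ennreal ((norm (fourier1 ?w (- v)))\<^sup>2) \<partial>lborel)"
      proof (rule nn_integral_cong)
        fix v
        have "f (0, v) - f (T n, v) = ?c *\<^sub>R fourier1 ?w (- v)"
          using f_eq[of 0 v] f_eq[OF Ta(2), of n v] a unfolding fourier1_diff[OF gL(1) uT(1)] by (simp add: scaleR_diff_right)
        then have "(norm (f (0, v) - f (T n, v)))\<^sup>2 = ?c\<^sup>2 * (norm (fourier1 ?w (- v)))\<^sup>2"
          by (simp only: norm_scaleR power_mult_distrib power2_abs)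
        then show "ennreal ((norm (f (0, v) - f (T n, v)))\<^sup>2) = ennreal (?c\<^sup>2) * ennreal ((norm (fourier1 ?w (- v)))\<^sup>2)"
          by (simp only: ennreal_mult zero_le_power2)
      qed
      also have "\<dots> = ennreal (?c\<^sup>2) * (\<integral>\<^sup>+v. ennreal ((norm (fourier1 ?w (- v)))\<^sup>2) \<partial>lborel)"
        by (rule nn_integral_cmult) measurable
      also have "\<dots> \<le> ennreal (?c\<^sup>2) * (?P * ?D n)"
        by (intro mult_left_mono fourier1_L2_bound_nn wi) auto
      finally show ?thesis by (simp add: mult_left_mono)
    qed
    then show "\<forall>\<^sub>F n in sequentially. (\<integral>\<^sup>+\<xi>. ennreal ((norm (H \<xi> - ?u (T n) \<xi>))\<^sup>2) \<partial>lborel) \<le> ?P * (ennreal (?c\<^sup>2) * (?P * ?D n))"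
      by (intro always_eventually allI)
  qed simp
  have "(\<lambda>n::nat. \<integral>\<^sup>+\<xi>. ennreal ((norm ((H \<xi> - ?u (T n) \<xi>) - (g \<xi> - ?u (T n) \<xi>)))\<^sup>2) \<partial>lborel) \<longlonglongrightarrow> 0"
    by (rule tendsto_nn_integral_norm_diff[OF _ _ HD D]) measurable
  then have "(\<integral>\<^sup>+\<xi>. ennreal ((norm (H \<xi> - g \<xi>))\<^sup>2) \<partial>lborel) = 0" by (simp add: LIMSEQ_const_iff)
  then have "AE \<xi> in lborel. H \<xi> = g \<xi>" by (intro AE_eq_of_nn_integral_0) auto
  then show ?thesis by (rule fourier_L2_cong_AE[OF H gm])
qed

section \<open>The reproducing property\<close>

lemma integral_open_Icc:
  fixes u :: "real \<Rightarrow> 'b::euclidean_space"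
  assumes [measurable]: "u \<in> borel_measurable borel"
  shows "(\<integral>t. indicator {-a<..<a} t *\<^sub>R u t \<partial>lborel) = (\<integral>t. indicator {-a..a} t *\<^sub>R u t \<partial>lborel)"
proof (rule integral_cong_AE)
  show "AE t in lborel. indicator {-a<..<a} t *\<^sub>R u t = indicator {-a..a} t *\<^sub>R u t"
    using AE_lborel_singleton[of a] AE_lborel_singleton[of "-a"] by eventually_elim (auto simp: indicator_def)
qed measurable

lemma integral_cosh_bweight:
  fixes \<xi> :: "(real, 'n::finite) vec"
  assumes a: "a > 0" and \<xi>: "\<xi> \<noteq> 0"
  shows "integrable lborel (\<lambda>t. indicator {-a<..<a} t * cosh (2 * t * norm \<xi>))"
    and "(\<integral>t. indicator {-a<..<a} t * cosh (2 * t * norm \<xi>) \<partial>lborel) = bweight a \<xi>"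
proof -
  let ?r = "norm \<xi>"
  have r: "?r > 0" using \<xi> by simp
  have [measurable]: "(\<lambda>t::real. cosh (2 * t * ?r)) \<in> borel_measurable borel"
    unfolding cosh_def by measurable
  have c: "continuous_on S (\<lambda>t::real. cosh (2 * t * ?r))" for S by (intro continuous_intros)
  have i: "integrable lborel (\<lambda>t. indicator {-a..a} t *\<^sub>R cosh (2 * t * ?r))"
    by (rule borel_integrable_compact[OF compact_Icc c])
  show "integrable lborel (\<lambda>t. indicator {-a<..<a} t * cosh (2 * t * ?r))"
    by (rule Bochner_Integration.integrable_bound[OF i]) (auto simp: indicator_def)
  have "(\<integral>t. indicator {-a<..<a} t * cosh (2 * t * ?r) \<partial>lborel) = (\<integral>t. indicator {-a..a} t *\<^sub>R cosh (2 * t * ?r) \<partial>lborel)"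
    using integral_open_Icc[of "\<lambda>t. cosh (2 * t * ?r)" a] by simp
  also have "\<dots> = sinh (2 * a * ?r) / (2 * ?r) - sinh (2 * (- a) * ?r) / (2 * ?r)"
  proof (rule integral_FTC_atLeastAtMost[OF _ _ c])
    show "((\<lambda>t. sinh (2 * t * ?r) / (2 * ?r)) has_vector_derivative cosh (2 * t * ?r)) (at t within {-a..a})" for t
      unfolding has_real_derivative_iff_has_vector_derivative[symmetric] using r by (auto intro!: derivative_eq_intros)
  qed (use a in auto)
  also have "\<dots> = bweight a \<xi>"
  proof -
    have "exp (2 * a * ?r) - exp (- 2 * a * ?r) = 2 * sinh (2 * a * ?r)" by (simp add: sinh_def)
    then show ?thesis unfolding bweight_def by simp
  qed
  finally show "(\<integral>t. indicator {-a<..<a} t * cosh (2 * t * ?r) \<partial>lborel) = bweight a \<xi>" .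
qed

text \<open>The group law detaches the fixed time s. In the remaining exponential the odd sinh part
  integrates to zero and the cosh part to the weight.\<close>

lemma integral_cl_exp:
  fixes \<xi> :: "(real, 'n::{finite,linorder}) vec"
  assumes a: "a > 0" and \<xi>: "\<xi> \<noteq> 0"
  shows "(\<integral>t. indicator {-a<..<a} t *\<^sub>R (cl_exp (2 * t + s) \<xi> \<odot> y) \<partial>lborel) = bweight a \<xi> *\<^sub>R (cl_exp s \<xi> \<odot> y)"
proof -
  let ?r = "norm \<xi>" and ?z = "cl_exp s \<xi> \<odot> y"
  let ?i = "indicator {-a<..<a} :: real \<Rightarrow> real"
  note C = integral_cosh_bweight[OF a \<xi>]
  have [measurable]: "(\<lambda>t::real. sinh (2 * t * ?r)) \<in> borel_measurable borel"
    unfolding sinh_def by measurable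
  have Si: "integrable lborel (\<lambda>t. ?i t * sinh (2 * t * ?r))"
  proof (rule Bochner_Integration.integrable_bound[OF C(1)])
    have "\<bar>sinh u\<bar> \<le> cosh u" for u :: real
      using cosh_real_nonneg[of u] by (simp add: abs_le_iff sinh_def cosh_def)
    then show "AE t in lborel. norm (?i t * sinh (2 * t * ?r)) \<le> norm (?i t * cosh (2 * t * ?r))"
      by (auto simp: abs_mult intro!: mult_left_mono)
  qed measurable
  have S0: "(\<integral>t. ?i t * sinh (2 * t * ?r) \<partial>lborel) = 0"
  proof -
    have "(\<integral>t. ?i (- t) * sinh (2 * (- t) * ?r) \<partial>lborel) = (\<integral>t. ?i t * sinh (2 * t * ?r) \<partial>lborel)"
      by (rule integral_lborel_minus(1)[of "\<lambda>t. ?i t * sinh (2 * t * ?r)"]) measurable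
    moreover have "?i (- t) * sinh (2 * (- t) * ?r) = - (?i t * sinh (2 * t * ?r))" for t
      by (auto simp: indicator_def)
    ultimately have "- (\<integral>t. ?i t * sinh (2 * t * ?r) \<partial>lborel) = (\<integral>t. ?i t * sinh (2 * t * ?r) \<partial>lborel)"
      by (simp only: Bochner_Integration.integral_minus)
    then show ?thesis by simp
  qed
  have "?i t *\<^sub>R (cl_exp (2 * t + s) \<xi> \<odot> y) = (?i t * cosh (2 * t * ?r)) *\<^sub>R ?z - (?i t * sinh (2 * t * ?r)) *\<^sub>R ((\<i> / of_real ?r) *s (cl_vec \<xi> \<odot> ?z))" for t
  proof -
    have "cl_exp (2 * t + s) \<xi> \<odot> y = cosh (2 * t * ?r) *\<^sub>R ?z - (\<i> * of_real (sinh (2 * t * ?r) / ?r)) *s (cl_vec \<xi> \<odot> ?z)"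
      unfolding cl_exp_add[symmetric] by (rule cl_exp_mult)
    also have "(\<i> * of_real (sinh (2 * t * ?r) / ?r)) *s (cl_vec \<xi> \<odot> ?z) = sinh (2 * t * ?r) *\<^sub>R ((\<i> / of_real ?r) *s (cl_vec \<xi> \<odot> ?z))"
      by (simp add: vec_eq_iff scaleR_conv_of_real[where 'a=complex])
    finally show ?thesis by (simp add: scaleR_diff_right)
  qed
  then have "(\<integral>t. ?i t *\<^sub>R (cl_exp (2 * t + s) \<xi> \<odot> y) \<partial>lborel)
     = (\<integral>t. (?i t * cosh (2 * t * ?r)) *\<^sub>R ?z - (?i t * sinh (2 * t * ?r)) *\<^sub>R ((\<i> / of_real ?r) *s (cl_vec \<xi> \<odot> ?z)) \<partial>lborel)"
    by (simp only:)
  also have "\<dots> = (\<integral>t. ?i t * cosh (2 * t * ?r) \<partial>lborel) *\<^sub>R ?z - (\<integral>t. ?i t * sinh (2 * t * ?r) \<partial>lborel) *\<^sub>R ((\<i> / of_real ?r) *s (cl_vec \<xi> \<odot> ?z))"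
    by (subst Bochner_Integration.integral_diff)
      (rule integrable_scaleR_left[OF C(1)], rule integrable_scaleR_left[OF Si],
        simp only: integral_scaleR_left[OF C(1)] integral_scaleR_left[OF Si])
  finally show ?thesis unfolding C(2) S0 by simp
qed

lemma cl_conj_bounded_linear: "bounded_linear cl_conj"
  using cl_conj_linear by (rule linear_conv_bounded_linear[THEN iffD1])

lemma cl_conj_measurable [measurable]: "cl_conj \<in> borel_measurable borel"
  by (intro borel_measurable_continuous_onI linear_continuous_on cl_conj_bounded_linear)

text \<open>Conjugation reverses the phases and fixes \<open>cl_exp\<close>. So each slice of the
  conjugated kernel is a forward Fourier transform of an explicit function, ready for
  Parseval.\<close>

lemma cl_conj_bergman:
  fixes x :: "real \<times> (real, 'n::{finite,linorder}) vec"
  assumes a: "a > 0" and x: "x \<in> strip a" and t: "\<bar>t\<bar> < a"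
  defines "b \<equiv> \<lambda>\<xi>. (1 / (2 * pi) ^ CARD('n)) *\<^sub>R (1 / bweight a \<xi>) *\<^sub>R (exp (\<i> * of_real (snd x \<bullet> \<xi>)) *s cl_exp (t + fst x) \<xi>)"
  shows "integrable lborel b" and "L2 b" and "cl_conj (bergman a (t, v) x) = fourier1 b v"
proof -
  let ?g = "bergman_symbol a x"
  have g: "exp_weighted a ?g"
    by (rule exp_weighted_bweight[OF a bergman_symbol_measurable bergman_symbol_weight[OF a x]])
  note u = exp_weighted_exp[OF g t]
  have [measurable]: "b \<in> borel_measurable borel" unfolding b_def by measurable
  have add: "cl_exp t \<xi> \<odot> cl_exp (fst x) \<xi> = cl_exp (t + fst x) \<xi>" for \<xi> :: "(real, 'n) vec"
    using cl_exp_add[of t \<xi> "fst x" cl_one] by simp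
  have ug: "cl_exp t \<xi> \<odot> ?g \<xi> = (1 / (2 * pi) ^ CARD('n)) *\<^sub>R (1 / bweight a \<xi>) *\<^sub>R (exp (- \<i> * of_real (snd x \<bullet> \<xi>)) *s cl_exp (t + fst x) \<xi>)" for \<xi>
    unfolding bergman_symbol_def cl.scaleR_right cl_mult_scale add ..
  have nb: "norm (b \<xi>) = norm (cl_exp t \<xi> \<odot> ?g \<xi>)" for \<xi>
    unfolding ug b_def by simp
  show "integrable lborel b"
    by (rule Bochner_Integration.integrable_bound[OF u(1)]) (auto simp: nb)
  show "L2 b" by (rule L2_bound[OF u(2)]) (auto simp: nb)
  let ?k = "\<lambda>\<xi>. exp (\<i> * of_real (v \<bullet> \<xi>)) *s (cl_exp t \<xi> \<odot> ?g \<xi>)"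
  have ki: "integrable lborel ?k" by (rule Bochner_Integration.integrable_bound[OF u(1)]) auto
  have "cl_conj (bergman a (t, v) x) = cl_conj (\<integral>\<xi>. ?k \<xi> \<partial>lborel)"
    unfolding bergman_eq_cl_rep cl_rep_def by simp
  also have "\<dots> = (\<integral>\<xi>. cl_conj (?k \<xi>) \<partial>lborel)"
    by (rule integral_bounded_linear[OF cl_conj_bounded_linear ki, symmetric])
  also have "\<dots> = (\<integral>\<xi>. exp (- \<i> * of_real (\<xi> \<bullet> v)) *s b \<xi> \<partial>lborel)"
  proof (rule Bochner_Integration.integral_cong[OF refl])
    fix \<xi>
    have "cnj (exp (\<i> * of_real (v \<bullet> \<xi>))) = exp (- \<i> * of_real (\<xi> \<bullet> v))" "cnj (exp (- \<i> * of_real (snd x \<bullet> \<xi>))) = exp (\<i> * of_real (snd x \<bullet> \<xi>))"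
      by (simp_all add: exp_cnj inner_commute)
    then show "cl_conj (?k \<xi>) = exp (- \<i> * of_real (\<xi> \<bullet> v)) *s b \<xi>"
      unfolding ug b_def by (simp only: cl_conj_scale linear_scale[OF cl_conj_linear] cl_exp_conj)
  qed
  finally show "cl_conj (bergman a (t, v) x) = fourier1 b v" by (simp add: fourier1_def)
qed

text \<open>After Parseval on the slices, the time t enters once from the kernel and once from the
  slice of f, which gives the exponent 2 t + x0. Exchanging the integrals produces the weight, which
  cancels the inverse weight in the kernel.\<close>

lemma bergman_reproducing:
  fixes f :: "real \<times> (real, 'n::{finite,linorder}) vec \<Rightarrow> 'n cliff"
  assumes a: "a > 0" and f: "f \<in> A2 a" and x: "x \<in> strip a"
  shows "f x = (\<integral>w0\<in>{-a<..<a}. (\<integral>wv. cl_conj (bergman a (w0, wv) x) \<odot> f (w0, wv) \<partial>lborel) \<partial>lborel)"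
proof -
  obtain g where gm [measurable]: "g \<in> borel_measurable borel"
    and fin: "(\<integral>\<^sup>+\<xi>. ennreal (bweight a \<xi> * (norm (g \<xi>))\<^sup>2) \<partial>lborel) < \<infinity>"
    and F: "AE t in lborel. t \<in> {-a<..<a} \<longrightarrow> fourier_L2 (\<lambda>v. f (t, v)) (\<lambda>\<xi>. cl_exp t \<xi> \<odot> g \<xi>)"
    and rep: "\<And>x. x \<in> strip a \<Longrightarrow> f x = (1 / (2 * pi) ^ CARD('n)) *\<^sub>R cl_rep g x"
    using A2_representation[OF a f] by blast
  have g: "exp_weighted a g" by (rule exp_weighted_bweight[OF a gm fin])
  let ?c = "1 / (2 * pi) ^ CARD('n)"
  let ?i = "indicator {-a<..<a} :: real \<Rightarrow> real"
  let ?Q = "\<lambda>t \<xi>. (1 / bweight a \<xi>) *\<^sub>R (exp (\<i> * of_real (snd x \<bullet> \<xi>)) *s (cl_exp (2 * t + fst x) \<xi> \<odot> g \<xi>))"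
  let ?G = "\<lambda>t. \<integral>v. cl_conj (bergman a (t, v) x) \<odot> f (t, v) \<partial>lborel"
  have G_eq: "?G t = ?c *\<^sub>R (\<integral>\<xi>. ?Q t \<xi> \<partial>lborel)" if t: "t \<in> {-a<..<a}" and Ft: "fourier_L2 (\<lambda>v. f (t, v)) (\<lambda>\<xi>. cl_exp t \<xi> \<odot> g \<xi>)" for t
  proof -
    let ?b = "\<lambda>\<xi>. ?c *\<^sub>R (1 / bweight a \<xi>) *\<^sub>R (exp (\<i> * of_real (snd x \<bullet> \<xi>)) *s cl_exp (t + fst x) \<xi>)"
    have ta: "\<bar>t\<bar> < a" using t by auto
    note b = cl_conj_bergman[OF a x ta]
    have "?G t = (\<integral>\<xi>. ?b \<xi> \<odot> (cl_exp t \<xi> \<odot> g \<xi>) \<partial>lborel)"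
      unfolding b(3) by (rule fourier_parseval[OF b(1,2) Ft])
    moreover have "?b \<xi> \<odot> (cl_exp t \<xi> \<odot> g \<xi>) = ?c *\<^sub>R ?Q t \<xi>" for \<xi>
    proof -
      have "t + fst x + t = 2 * t + fst x" by simp
      then show ?thesis by (simp only: cl.scaleR_left cl_mult_scale cl_exp_add)
    qed
    ultimately show ?thesis by (simp only: integral_scaleR_right)
  qed
  \<comment> \<open>The exponential at 2 t + x0 is bounded by 2 cosh (2 t |\<xi>|) exp (|x0|
    |\<xi>|). Its t-integral is twice the weight, which cancels, and exp (|x0| |\<xi>|) |g| is
    integrable because |x0| < a.\<close>
  have hi: "integrable (lborel \<Otimes>\<^sub>M lborel) (\<lambda>(\<xi>, t). ?i t *\<^sub>R ?Q t \<xi>)"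
  proof -
    let ?w = "\<lambda>\<xi>. exp (\<bar>fst x\<bar> * norm \<xi>) * norm (g \<xi>)"
    have wi: "integrable lborel ?w"
    proof (rule Bochner_Integration.integrable_bound[OF exp_weighted_integrable[OF g]])
      show "\<bar>fst x\<bar> < a" using x by (simp add: strip_def)
      show "AE \<xi> in lborel. norm (?w \<xi>) \<le> norm ((1 + norm \<xi>) * exp (\<bar>fst x\<bar> * norm \<xi>) * norm (g \<xi>))"
        by (rule AE_I2) (simp add: mult.assoc distrib_right abs_mult)
    qed measurable
    have m: "(\<lambda>(\<xi>, t). ?i t *\<^sub>R ?Q t \<xi>) \<in> borel_measurable (lborel \<Otimes>\<^sub>M lborel)"
      unfolding lborel_prod case_prod_beta' by measurable
    have bound: "norm (?i t *\<^sub>R ?Q t \<xi>) \<le> 2 * (1 / bweight a \<xi>) * ?w \<xi> * (?i t * cosh (2 * t * norm \<xi>))" for t \<xi>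
    proof -
      have "norm (cl_exp (2 * t + fst x) \<xi> \<odot> g \<xi>) \<le> exp (\<bar>2 * t + fst x\<bar> * norm \<xi>) * norm (g \<xi>)"
        by (rule norm_cl_exp_le)
      also have "exp (\<bar>2 * t + fst x\<bar> * norm \<xi>) \<le> exp (\<bar>2 * t * norm \<xi>\<bar>) * exp (\<bar>fst x\<bar> * norm \<xi>)"
        unfolding exp_add[symmetric] by (simp add: abs_mult distrib_right[symmetric] mult_right_mono)
      also have "exp \<bar>2 * t * norm \<xi>\<bar> \<le> 2 * cosh (2 * t * norm \<xi>)"
        by (simp add: cosh_def abs_if)
      finally have q: "norm (cl_exp (2 * t + fst x) \<xi> \<odot> g \<xi>) \<le> 2 * cosh (2 * t * norm \<xi>) * exp (\<bar>fst x\<bar> * norm \<xi>) * norm (g \<xi>)"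
        by (simp add: mult_right_mono)
      have "norm (?i t *\<^sub>R ?Q t \<xi>) = ?i t * (1 / bweight a \<xi>) * norm (cl_exp (2 * t + fst x) \<xi> \<odot> g \<xi>)"
        using bweight_nonneg[OF a, of \<xi>] by simp
      also have "\<dots> \<le> ?i t * (1 / bweight a \<xi>) * (2 * cosh (2 * t * norm \<xi>) * exp (\<bar>fst x\<bar> * norm \<xi>) * norm (g \<xi>))"
        using bweight_nonneg[OF a, of \<xi>] by (intro mult_left_mono q) auto
      finally show ?thesis by (simp add: mult_ac)
    qed
    show ?thesis
    proof (rule lborel_pair.Fubini_integrable[OF m])
      have it: "integrable lborel (\<lambda>t. ?i t *\<^sub>R ?Q t \<xi>)" if "\<xi> \<noteq> 0" for \<xi>
      proof (rule Bochner_Integration.integrable_bound[OF integrable_mult_right[OF integral_cosh_bweight(1)[OF a that], of "2 * (1 / bweight a \<xi>) * ?w \<xi>"]])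
        show "AE t in lborel. norm (?i t *\<^sub>R ?Q t \<xi>) \<le> norm (2 * (1 / bweight a \<xi>) * ?w \<xi> * (?i t * cosh (2 * t * norm \<xi>)))"
          unfolding real_norm_def by (intro AE_I2 order_trans[OF bound abs_ge_self])
      qed measurable
      show "AE \<xi> in lborel. integrable lborel (\<lambda>t. case (\<xi>, t) of (\<xi>, t) \<Rightarrow> ?i t *\<^sub>R ?Q t \<xi>)"
        unfolding prod.case using AE_lborel_nonzero by eventually_elim (rule it)
      show "integrable lborel (\<lambda>\<xi>. \<integral>t. norm (case (\<xi>, t) of (\<xi>, t) \<Rightarrow> ?i t *\<^sub>R ?Q t \<xi>) \<partial>lborel)"
      proof (rule Bochner_Integration.integrable_bound[OF integrable_mult_right[OF wi, of 2]])
        show "(\<lambda>\<xi>. \<integral>t. norm (case (\<xi>, t) of (\<xi>, t) \<Rightarrow> ?i t *\<^sub>R ?Q t \<xi>) \<partial>lborel) \<in> borel_measurable lborel"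
          using m by measurable
        show "AE \<xi> in lborel. norm (\<integral>t. norm (case (\<xi>, t) of (\<xi>, t) \<Rightarrow> ?i t *\<^sub>R ?Q t \<xi>) \<partial>lborel) \<le> norm (2 * ?w \<xi>)"
          using AE_lborel_nonzero
        proof eventually_elim
          case (elim \<xi>)
          have "(\<integral>t. norm (?i t *\<^sub>R ?Q t \<xi>) \<partial>lborel) \<le> (\<integral>t. 2 * (1 / bweight a \<xi>) * ?w \<xi> * (?i t * cosh (2 * t * norm \<xi>)) \<partial>lborel)"
            by (intro integral_mono integrable_norm it elim integrable_mult_right integral_cosh_bweight(1) a bound)
          also have "\<dots> = 2 * (1 / bweight a \<xi>) * ?w \<xi> * bweight a \<xi>"
            by (simp only: integral_mult_right_zero integral_cosh_bweight(2)[OF a elim])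
          also have "\<dots> = 2 * ?w \<xi>" using bweight_pos[OF a elim] by simp
          finally have "(\<integral>t. norm (?i t *\<^sub>R ?Q t \<xi>) \<partial>lborel) \<le> 2 * ?w \<xi>" .
          moreover have "0 \<le> (\<integral>t. norm (?i t *\<^sub>R ?Q t \<xi>) \<partial>lborel)" by (rule Bochner_Integration.integral_nonneg) simp
          ultimately show ?case by (simp only: prod.case real_norm_def abs_of_nonneg)
        qed
      qed
    qed
  qed
  have "(\<integral>w0\<in>{-a<..<a}. ?G w0 \<partial>lborel) = (\<integral>t. ?c *\<^sub>R (\<integral>\<xi>. ?i t *\<^sub>R ?Q t \<xi> \<partial>lborel) \<partial>lborel)"
    unfolding set_lebesgue_integral_def
  proof (rule integral_cong_AE)
    note [measurable] = A2_measurable[OF f] A2_measurable[OF bergman_in_A2[OF a x]]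
    \<comment> \<open>The measurability of \<open>f\<close> is available only after multiplication
      with the indicator of the strip.\<close>
    have "(\<lambda>t. \<integral>v. cl_conj (indicator (strip a) (t, v) *\<^sub>R bergman a (t, v) x) \<odot> (indicator (strip a) (t, v) *\<^sub>R f (t, v)) \<partial>lborel) \<in> borel_measurable lborel"
      by measurable
    moreover have "(\<integral>v. cl_conj (indicator (strip a) (t, v) *\<^sub>R bergman a (t, v) x) \<odot> (indicator (strip a) (t, v) *\<^sub>R f (t, v)) \<partial>lborel) = ?i t *\<^sub>R ?G t" for t
      by (cases "\<bar>t\<bar> < a") (auto simp: indicator_def strip_def abs_less_iff cl.zero_right)
    ultimately show "(\<lambda>t. ?i t *\<^sub>R ?G t) \<in> borel_measurable lborel" by (simp only:)
    show "(\<lambda>t. ?c *\<^sub>R (\<integral>\<xi>. ?i t *\<^sub>R ?Q t \<xi> \<partial>lborel)) \<in> borel_measurable lborel"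
      by measurable
    show "AE t in lborel. ?i t *\<^sub>R ?G t = ?c *\<^sub>R (\<integral>\<xi>. ?i t *\<^sub>R ?Q t \<xi> \<partial>lborel)"
      using F
    proof eventually_elim
      case (elim t)
      show ?case
      proof (cases "t \<in> {-a<..<a}")
        case True
        then show ?thesis using G_eq[OF True] elim by (simp only: indicator_simps scaleR_one simp_thms)
      qed simp
    qed
  qed
  also have "\<dots> = ?c *\<^sub>R (\<integral>t. (\<integral>\<xi>. ?i t *\<^sub>R ?Q t \<xi> \<partial>lborel) \<partial>lborel)"
    by (rule integral_scaleR_right)
  also have "(\<integral>t. (\<integral>\<xi>. ?i t *\<^sub>R ?Q t \<xi> \<partial>lborel) \<partial>lborel) = (\<integral>\<xi>. (\<integral>t. ?i t *\<^sub>R ?Q t \<xi> \<partial>lborel) \<partial>lborel)"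
    by (rule lborel_pair.Fubini_integral[OF hi])
  also have "\<dots> = (\<integral>\<xi>. exp (\<i> * of_real (snd x \<bullet> \<xi>)) *s (cl_exp (fst x) \<xi> \<odot> g \<xi>) \<partial>lborel)"
  proof (rule integral_cong_AE)
    show "AE \<xi> in lborel. (\<integral>t. ?i t *\<^sub>R ?Q t \<xi> \<partial>lborel) = exp (\<i> * of_real (snd x \<bullet> \<xi>)) *s (cl_exp (fst x) \<xi> \<odot> g \<xi>)"
      using AE_lborel_nonzero
    proof eventually_elim
      case (elim \<xi>)
      let ?L = "\<lambda>u. (1 / bweight a \<xi>) *\<^sub>R (exp (\<i> * of_real (snd x \<bullet> \<xi>)) *s u)"
      have L: "bounded_linear ?L"
        by (intro bounded_linear_compose[OF bounded_linear_scaleR_right vsmult.bounded_linear_right])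
      have i: "integrable lborel (\<lambda>t. ?i t *\<^sub>R (cl_exp (2 * t + fst x) \<xi> \<odot> g \<xi>))"
      proof -
        have "continuous_on {-a..a} (\<lambda>t. cl_exp (2 * t + fst x) \<xi> \<odot> g \<xi>)"
          unfolding cl_exp_mult using elim by (intro continuous_intros vsmult.continuous_on) auto
        from borel_integrable_compact[OF compact_Icc this] show ?thesis
          by (rule Bochner_Integration.integrable_bound) (auto simp: indicator_def)
      qed
      have "(\<integral>t. ?i t *\<^sub>R ?Q t \<xi> \<partial>lborel) = (\<integral>t. ?L (?i t *\<^sub>R (cl_exp (2 * t + fst x) \<xi> \<odot> g \<xi>)) \<partial>lborel)"
        by (intro Bochner_Integration.integral_cong refl) (simp add: vsmult.scaleR_right)
      also have "\<dots> = ?L (\<integral>t. ?i t *\<^sub>R (cl_exp (2 * t + fst x) \<xi> \<odot> g \<xi>) \<partial>lborel)"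
        by (rule integral_bounded_linear[OF L i])
      also have "\<dots> = ?L (bweight a \<xi> *\<^sub>R (cl_exp (fst x) \<xi> \<odot> g \<xi>))"
        by (simp only: integral_cl_exp[OF a elim])
      also have "\<dots> = exp (\<i> * of_real (snd x \<bullet> \<xi>)) *s (cl_exp (fst x) \<xi> \<odot> g \<xi>)"
        using bweight_pos[OF a elim] by (simp add: vsmult.scaleR_right)
      finally show ?case .
    qed
  qed measurable
  also have "\<dots> = cl_rep g x" by (simp add: cl_rep_def)
  also have "?c *\<^sub>R cl_rep g x = f x" using rep[OF x] by simp
  finally show ?thesis ..
qed

theorem theorem3p6:
  fixes a :: real
  assumes "a > 0"
  shows "(\<forall>f :: real \<times> ((real, 'n::{finite,linorder}) vec) \<Rightarrow> 'n cliff.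
            f \<in> A2 a \<longleftrightarrow>
            (\<exists>g. fourier_L2 (\<lambda>v. f (0, v)) g \<and>
                 (1 / (2 * pi) ^ CARD('n)) *
                   (\<integral>\<^sup>+ \<xi>. ennreal ((exp (2 * a * norm \<xi>) - exp (- 2 * a * norm \<xi>))
                        * (norm (g \<xi>))\<^sup>2 / (2 * norm \<xi>)) \<partial>lborel) < \<infinity> \<and>
                 (\<forall>x\<in>strip a. f x = (1 / (2 * pi) ^ CARD('n)) *\<^sub>R
                                    (\<integral>\<xi>. e_ker x \<xi> \<odot> g \<xi> \<partial>lborel))))
       \<and> (\<forall>x\<in>strip a. (\<lambda>w. bergman a w x) \<in> (A2 a :: (real \<times> ((real, 'n) vec) \<Rightarrow> 'n cliff) set))
       \<and> (\<forall>f\<in>(A2 a :: (real \<times> ((real, 'n) vec) \<Rightarrow> 'n cliff) set). \<forall>x\<in>strip a.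
            f x = (\<integral>w0\<in>{-a<..<a}. (\<integral>wv. cl_conj (bergman a (w0, wv) x) \<odot> f (w0, wv) \<partial>lborel) \<partial>lborel))"
proof (intro conjI allI ballI)
  \<comment> \<open>The constant is positive and finite, so it has no influence on
    finiteness.\<close>
  have w: "(1 / (2 * pi) ^ CARD('n)) * (\<integral>\<^sup>+ \<xi>. ennreal ((exp (2 * a * norm \<xi>) - exp (- 2 * a * norm \<xi>))
        * (norm (g \<xi>))\<^sup>2 / (2 * norm \<xi>)) \<partial>lborel) < \<infinity> \<longleftrightarrow> (\<integral>\<^sup>+\<xi>. ennreal (bweight a \<xi> * (norm (g \<xi>))\<^sup>2) \<partial>lborel) < \<infinity>"
    for g :: "(real, 'n) vec \<Rightarrow> 'n cliff"
  proof -
    have "(exp (2 * a * norm \<xi>) - exp (- 2 * a * norm \<xi>)) * (norm (g \<xi>))\<^sup>2 / (2 * norm \<xi>) = bweight a \<xi> * (norm (g \<xi>))\<^sup>2" for \<xi>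
      by (simp add: bweight_def)
    moreover have "ennreal (1 / (2 * pi) ^ CARD('n)) \<noteq> 0" by simp
    ultimately show ?thesis by (auto simp: ennreal_mult_less_top)
  qed
  fix f :: "real \<times> ((real, 'n) vec) \<Rightarrow> 'n cliff"
  show "f \<in> A2 a \<longleftrightarrow>
            (\<exists>g. fourier_L2 (\<lambda>v. f (0, v)) g \<and>
                 (1 / (2 * pi) ^ CARD('n)) *
                   (\<integral>\<^sup>+ \<xi>. ennreal ((exp (2 * a * norm \<xi>) - exp (- 2 * a * norm \<xi>))
                        * (norm (g \<xi>))\<^sup>2 / (2 * norm \<xi>)) \<partial>lborel) < \<infinity> \<and>
                 (\<forall>x\<in>strip a. f x = (1 / (2 * pi) ^ CARD('n)) *\<^sub>R
                                    (\<integral>\<xi>. e_ker x \<xi> \<odot> g \<xi> \<partial>lborel)))"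
    unfolding w
  proof
    assume "f \<in> A2 a"
    then obtain g where g: "g \<in> borel_measurable borel"
      "(\<integral>\<^sup>+\<xi>. ennreal (bweight a \<xi> * (norm (g \<xi>))\<^sup>2) \<partial>lborel) < \<infinity>"
      "AE t in lborel. t \<in> {-a<..<a} \<longrightarrow> fourier_L2 (\<lambda>v. f (t, v)) (\<lambda>\<xi>. cl_exp t \<xi> \<odot> g \<xi>)"
      "\<And>x. x \<in> strip a \<Longrightarrow> f x = (1 / (2 * pi) ^ CARD('n)) *\<^sub>R cl_rep g x"
      using A2_representation[OF assms] by blast
    have "fourier_L2 (\<lambda>v. f (0, v)) g"
      by (rule A2_fourier_trace[OF assms g])
    then show "\<exists>g. fourier_L2 (\<lambda>v. f (0, v)) g \<and> (\<integral>\<^sup>+\<xi>. ennreal (bweight a \<xi> * (norm (g \<xi>))\<^sup>2) \<partial>lborel) < \<infinity> \<and>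
       (\<forall>x\<in>strip a. f x = (1 / (2 * pi) ^ CARD('n)) *\<^sub>R (\<integral>\<xi>. e_ker x \<xi> \<odot> g \<xi> \<partial>lborel))"
      using g by (intro exI[of _ g] conjI ballI) (simp_all only: e_ker_integral[OF g(1)])
  next
    assume "\<exists>g. fourier_L2 (\<lambda>v. f (0, v)) g \<and> (\<integral>\<^sup>+\<xi>. ennreal (bweight a \<xi> * (norm (g \<xi>))\<^sup>2) \<partial>lborel) < \<infinity> \<and>
       (\<forall>x\<in>strip a. f x = (1 / (2 * pi) ^ CARD('n)) *\<^sub>R (\<integral>\<xi>. e_ker x \<xi> \<odot> g \<xi> \<partial>lborel))"
    then obtain g where g: "fourier_L2 (\<lambda>v. f (0, v)) g" "(\<integral>\<^sup>+\<xi>. ennreal (bweight a \<xi> * (norm (g \<xi>))\<^sup>2) \<partial>lborel) < \<infinity>"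
       "\<And>x. x \<in> strip a \<Longrightarrow> f x = (1 / (2 * pi) ^ CARD('n)) *\<^sub>R (\<integral>\<xi>. e_ker x \<xi> \<odot> g \<xi> \<partial>lborel)" by blast
    \<comment> \<open>The normalising constant is moved into the spectrum, so that \<open>f\<close>
      agrees on the strip with a function \<open>cl_rep\<close>; its values elsewhere are arbitrary,
      hence \<open>A2_cong\<close>.\<close>
    let ?g = "\<lambda>\<xi>. (1 / (2 * pi) ^ CARD('n)) *\<^sub>R g \<xi>"
    have [measurable]: "g \<in> borel_measurable borel" by (rule L2_measurable[OF fourier_L2D(2)[OF g(1)]])
    show "f \<in> A2 a"
    proof (rule A2_cong)
      show "cl_rep ?g \<in> A2 a"
        by (rule cl_rep_in_A2[OF assms _ nn_integral_bweight_scaleR[OF assms _ g(2)]]) measurable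
      show "f x = cl_rep ?g x" if "x \<in> strip a" for x
        using g(3)[OF that] by (simp only: e_ker_integral[OF \<open>g \<in> borel_measurable borel\<close>] cl_rep_scaleR)
    qed
  qed
next
  fix x :: "real \<times> ((real, 'n) vec)" assume "x \<in> strip a"
  then show "(\<lambda>w. bergman a w x) \<in> A2 a" by (rule bergman_in_A2[OF assms])
next
  fix f :: "real \<times> ((real, 'n) vec) \<Rightarrow> 'n cliff" and x :: "real \<times> ((real, 'n) vec)"
  assume "f \<in> A2 a" "x \<in> strip a"
  then show "f x = (\<integral>w0\<in>{-a<..<a}. (\<integral>wv. cl_conj (bergman a (w0, wv) x) \<odot> f (w0, wv) \<partial>lborel) \<partial>lborel)"
    by (rule bergman_reproducing[OF assms])
qed

end
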